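(* Let $P$ be a (fixed) oriented path with three blocks such that the last one has length 1. One can check in time $O(n^{|P|-2}m^2)$ whether a given oriented graph with $n$ vertices and $m$ arcs contains an induced $P$-subdivision.
   Context: All digraphs are finite and simple (no loops, no parallel arcs). An oriented graph is a digraph with no directed 2-cycle. A subdivision of a digraph $D$ (also called a $D$-subdivision) is a digraph obtained from $D$ by replacing each arc $ab$ by a directed $(a,b)$-path of length at least 1, these paths being internally disjoint with new internal vertices. An induced $D$-subdivision in $G$ is an induced subdigraph of $G$ that is (isomorphic to) a $D$-subdivision. An oriented path is an orientation of an undirected path, traversed from its first vertex (origin) to its last vertex (terminus). The blocks of an oriented path are its maximal directed subpaths (ordered along the traversal); the length of a path is its number of arcs. $|P|$ denotes the number of vertices of $P$. *)

theory Defs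
  imports
    "Graph_Theory.Digraph_Component"
    "Graph_Theory.Digraph_Isomorphism"
    "Graph_Theory.Pair_Digraph"
    "Graph_Theory.Vertex_Walk"
begin

section \<open>Oriented graphs, oriented paths and their blocks\<close>

text \<open>The library locale \<open>pair_digraph\<close> describes the finite digraphs without loops; parallel
  arcs are excluded by the representation of the arc set as a relation.\<close>

definition oriented_graph :: "'a pair_pre_digraph \<Rightarrow> bool" where
  "oriented_graph G \<longleftrightarrow> pair_digraph G \<and> (\<forall>u v. (u, v) \<in> parcs G \<longrightarrow> (v, u) \<notin> parcs G)"

text \<open>\<open>P\<close> is an orientation of the undirected path whose vertices, listed from the origin to the
  terminus, are \<open>xs\<close>.\<close>

definition oriented_path :: "'a pair_pre_digraph \<Rightarrow> 'a list \<Rightarrow> bool" where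
  "oriented_path P xs \<longleftrightarrow>
     oriented_graph P \<and> xs \<noteq> [] \<and> distinct xs \<and> pverts P = set xs \<and>
     parcs P \<union> (parcs P)\<inverse> = set (vwalk_arcs xs) \<union> (set (vwalk_arcs xs))\<inverse>"

text \<open>The pair \<open>(i, j)\<close> stands for the subpath on the vertices \<open>xs ! i, \<dots>, xs ! j\<close>, which has
  \<open>j - i\<close> arcs. It may be directed along the traversal or against it.\<close>

definition directed_segment :: "'a pair_pre_digraph \<Rightarrow> 'a list \<Rightarrow> nat \<times> nat \<Rightarrow> bool" where
  "directed_segment P xs = (\<lambda>(i, j). i < j \<and> j < length xs \<and>
     ((\<forall>k\<in>{i..<j}. (xs ! k, xs ! Suc k) \<in> parcs P) \<or>
      (\<forall>k\<in>{i..<j}. (xs ! Suc k, xs ! k) \<in> parcs P)))"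

definition blocks :: "'a pair_pre_digraph \<Rightarrow> 'a list \<Rightarrow> (nat \<times> nat) set" where
  "blocks P xs = {(i, j). directed_segment P xs (i, j) \<and>
     (\<forall>i' j'. directed_segment P xs (i', j') \<and> i' \<le> i \<and> j \<le> j' \<longrightarrow> i' = i \<and> j' = j)}"


section \<open>Induced subdivisions\<close>

text \<open>\<open>p e\<close> is the vertex sequence of the directed path that replaces the arc \<open>e\<close>. Subdivisions
  live on the same vertex type as \<open>D\<close>, so this is meant for infinite types.\<close>

definition is_subdivision :: "'a pair_pre_digraph \<Rightarrow> 'a pair_pre_digraph \<Rightarrow> bool" where
  "is_subdivision D S \<longleftrightarrow> (\<exists>p :: 'a \<times> 'a \<Rightarrow> 'a list.
     (\<forall>(a, b)\<in>parcs D. vpath (p (a, b)) (with_proj S) \<and> 1 \<le> vwalk_length (p (a, b)) \<and>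
        hd (p (a, b)) = a \<and> last (p (a, b)) = b \<and>
        set (p (a, b)) \<inter> pverts D = {a, b}) \<and>
     (\<forall>e\<in>parcs D. \<forall>f\<in>parcs D. e \<noteq> f \<longrightarrow> set (p e) \<inter> set (p f) \<subseteq> pverts D) \<and>
     pverts S = pverts D \<union> (\<Union>e\<in>parcs D. set (p e)) \<and>
     parcs S = (\<Union>e\<in>parcs D. set (vwalk_arcs (p e))))"

definition contains_induced_subdivision ::
  "nat pair_pre_digraph \<Rightarrow> nat pair_pre_digraph \<Rightarrow> bool" where
  "contains_induced_subdivision D G \<longleftrightarrow>
     (\<exists>H S. induced_subgraph H (with_proj G) \<and> is_subdivision D S \<and> digraph_iso H (with_proj S))"


section \<open>Random access machines with uniform cost\<close>

text \<open>A random access machine with finitely many registers per program and an unbounded memory,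
  both holding natural numbers. The arithmetic is addition and truncated subtraction only:
  multiplication at unit cost would make the uniform cost measure unrealistic. Control flow is
  structured, which only restricts the programs of a machine with jumps. \<open>Load r a\<close> and
  \<open>Store a r\<close> address the memory through the contents of register \<open>a\<close>.\<close>

record ram =
  reg :: "nat \<Rightarrow> nat"
  mem :: "nat \<Rightarrow> nat"

datatype prog =
    Skip
  | Const nat nat
  | Add nat nat nat
  | Sub nat nat nat
  | Load nat nat
  | Store nat nat
  | Seq prog prog
  | IfLess nat nat prog prog
  | WhileLess nat nat prog

text \<open>\<open>exec c s t s'\<close>: started in state \<open>s\<close>, program \<open>c\<close> halts in state \<open>s'\<close> after \<open>t\<close> steps. Every
  elementary instruction and every evaluation of a test is one step.\<close>

inductive exec :: "prog \<Rightarrow> ram \<Rightarrow> nat \<Rightarrow> ram \<Rightarrow> bool" where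
  Skip: "exec Skip s 1 s"
| Const: "exec (Const r k) s 1 (s\<lparr>reg := (reg s)(r := k)\<rparr>)"
| Add: "exec (Add r a b) s 1 (s\<lparr>reg := (reg s)(r := reg s a + reg s b)\<rparr>)"
| Sub: "exec (Sub r a b) s 1 (s\<lparr>reg := (reg s)(r := reg s a - reg s b)\<rparr>)"
| Load: "exec (Load r a) s 1 (s\<lparr>reg := (reg s)(r := mem s (reg s a))\<rparr>)"
| Store: "exec (Store a r) s 1 (s\<lparr>mem := (mem s)(reg s a := reg s r)\<rparr>)"
| Seq: "exec c s t s' \<Longrightarrow> exec d s' t' s'' \<Longrightarrow> exec (Seq c d) s (t + t') s''"
| IfTrue: "reg s a < reg s b \<Longrightarrow> exec c s t s' \<Longrightarrow> exec (IfLess a b c d) s (Suc t) s'"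
| IfFalse: "\<not> reg s a < reg s b \<Longrightarrow> exec d s t s' \<Longrightarrow> exec (IfLess a b c d) s (Suc t) s'"
| WhileTrue: "reg s a < reg s b \<Longrightarrow> exec c s t s' \<Longrightarrow> exec (WhileLess a b c) s' t' s'' \<Longrightarrow>
    exec (WhileLess a b c) s (Suc (t + t')) s''"
| WhileFalse: "\<not> reg s a < reg s b \<Longrightarrow> exec (WhileLess a b c) s 1 s"

inductive_cases exec_elims:
  "exec Skip s t s'" "exec (Const r k) s t s'" "exec (Add r a b) s t s'"
  "exec (Sub r a b) s t s'" "exec (Load r a) s t s'" "exec (Store a r) s t s'"
  "exec (Seq c d) s t s'" "exec (IfLess a b c d) s t s'"

inductive_cases exec_WhileE: "exec (WhileLess a b c) s t s'"

lemma exec_deterministic: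
  "exec c s t s' \<Longrightarrow> exec c s u s'' \<Longrightarrow> t = u \<and> s' = s''"
proof (induction arbitrary: u s'' rule: exec.induct)
  case (WhileTrue s a b c t s' t' s1)
  obtain t1 s2 t2 where "u = Suc (t1 + t2)" "exec c s t1 s2" "exec (WhileLess a b c) s2 t2 s''"
    using WhileTrue.prems WhileTrue.hyps(1) by (cases rule: exec_WhileE) auto
  with WhileTrue.IH show ?case by blast
next
  case (WhileFalse s a b c)
  then show ?case by (auto elim: exec_WhileE)
next
  case (Seq c s t s' d t' s1)
  obtain t1 s2 t2 where "u = t1 + t2" "exec c s t1 s2" "exec d s2 t2 s''"
    using Seq.prems by (cases rule: exec_elims(7)) auto
  with Seq.IH show ?case by blast
next
  case (IfTrue s a b c t s' d)
  obtain t1 where "u = Suc t1" "exec c s t1 s''"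
    using IfTrue.prems IfTrue.hyps(1) by (cases rule: exec_elims(8)) auto
  with IfTrue.IH show ?case by blast
next
  case (IfFalse s a b d t s' c)
  obtain t1 where "u = Suc t1" "exec d s t1 s''"
    using IfFalse.prems IfFalse.hyps(1) by (cases rule: exec_elims(8)) auto
  with IfFalse.IH show ?case by blast
qed (auto elim: exec_elims)


text \<open>The input digraph has vertex set \<open>{..<n}\<close> and its arcs are given in an arbitrary order:
  registers \<open>0\<close> and \<open>1\<close> hold the numbers of vertices and arcs, memory cells \<open>2 * i\<close> and
  \<open>2 * i + 1\<close> hold the tail and the head of the \<open>i\<close>-th arc, everything else is \<open>0\<close>.
  An adjacency matrix can be set up from this in one pass over the arcs.\<close>

definition input_state :: "nat \<Rightarrow> (nat \<times> nat) list \<Rightarrow> ram" where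
  "input_state n as =
     \<lparr>reg = (\<lambda>_. 0)(0 := n, 1 := length as),
      mem = (\<lambda>k. if k < 2 * length as
                  then (if even k then fst else snd) (as ! (k div 2)) else 0)\<rparr>"

text \<open>The answer is left in register \<open>0\<close>; \<open>T n m\<close> bounds the number of steps on digraphs with
  \<open>n\<close> vertices and \<open>m\<close> arcs.\<close>

definition decides_in_time ::
  "prog \<Rightarrow> (nat pair_pre_digraph \<Rightarrow> bool) \<Rightarrow> (nat pair_pre_digraph \<Rightarrow> bool) \<Rightarrow>
   (nat \<Rightarrow> nat \<Rightarrow> nat) \<Rightarrow> bool" where
  "decides_in_time c \<C> Q T \<longleftrightarrow>
     (\<forall>n as. let G = \<lparr>pverts = {..<n}, parcs = set as\<rparr> in
        distinct as \<and> \<C> G \<longrightarrow>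
        (\<exists>t s. exec c (input_state n as) t s \<and> t \<le> T n (length as) \<and>
               reg s 0 = (if Q G then 1 else 0)))"

end

theory Submission
  imports Defs
begin

text \<open>
  After reversing all arcs if necessary, an induced \<open>P\<close>-subdivision can be trimmed until its first
  block has the length \<open>k\<close> of the first block of \<open>P\<close> and its third block is a single arc \<open>t z\<close>; only
  the second block, a directed path from \<open>t\<close> to the end \<open>s\<close> of the first one, stays unbounded.
  The algorithm guesses an injection of the vertices of \<open>P\<close> such that the first arc and the last
  arc \<open>t z\<close> of \<open>P\<close> go to arcs, and tests that the image is induced as in \<open>P\<close>, except that the arc
  from \<open>t\<close> to its successor \<open>y\<close> in the second block may be missing. It remains to reach \<open>y\<close> from
  \<open>t\<close> through vertices that have no neighbour among the guessed ones, except \<open>t\<close> and, as an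
  out-neighbour, \<open>y\<close>. With an adjacency matrix this search takes \<open>O(n\<^sup>2)\<close> steps, and there are
  \<open>O(n ^ (\<bar>P\<bar> - 4) * m\<^sup>2)\<close> guesses.

  Reachability suffices although a shortest path from \<open>t\<close> to \<open>y\<close> need not be induced: it has no
  forward chords, and if it has an arc from \<open>v j\<close> back to \<open>v i\<close>, then, for the largest such \<open>j\<close>, the
  vertex \<open>v i\<close> has no other neighbour among \<open>v j, v (j + 1), \<dots>, y\<close>, so that \<open>v j\<close> and \<open>v i\<close> can
  take over the roles of \<open>t\<close> and \<open>z\<close>. This uses that the third block has length 1.
\<close>

section \<open>A language with bounded loops and its compilation\<close>

text \<open>\<open>t\<close>, \<open>z\<close> and every vertex that the search may visit satisfy
  one and the same condition towards the rest of the guess: no arc comes from there, and an arc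
  going there can only end in \<open>y\<close>. The condition does not tell the roles apart, which
  is why an exchange of \<open>t\<close> and \<open>z\<close> preserves it and why a shortest path
  can be chosen over all choices of \<open>z\<close> at once. Since it constrains single vertices
  and never pairs of them, it is compatible with plain reachability; the pairs are taken care of by
  minimality alone, and so arcs between \<open>t\<close> and visited vertices remain untested. The
  cost is counted on a machine without multiplication, for a program all of whose loops are bounded
  by \<open>n\<close> or \<open>m\<close>. The bound is then read off the syntax, independently of
  correctness. In return the search always takes \<open>n\<close> rounds, some possibly idle, and a
  success only sets a flag while the remaining guesses are still tried.\<close>

text \<open>Variable \<open>p\<close> lives in register \<open>p\<close>, and the registers above the variables in scope serve as
  scratch space. Only the variables \<open>0\<close> and \<open>1\<close>, which hold the numbers of vertices and arcs, may
  bound a loop, so the running time is a function of these two numbers.\<close>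

datatype exp =
    Num nat
  | Var nat
  | Plus exp exp
  | Minus exp exp
  | Read exp

primrec ev :: "exp \<Rightarrow> nat list \<Rightarrow> (nat \<Rightarrow> nat) \<Rightarrow> nat" where
  "ev (Num k) vs \<mu> = k"
| "ev (Var p) vs \<mu> = vs ! p"
| "ev (Plus a b) vs \<mu> = ev a vs \<mu> + ev b vs \<mu>"
| "ev (Minus a b) vs \<mu> = ev a vs \<mu> - ev b vs \<mu>"
| "ev (Read a) vs \<mu> = \<mu> (ev a vs \<mu>)"

primrec wf_exp :: "nat \<Rightarrow> exp \<Rightarrow> bool" where
  "wf_exp d (Num k) \<longleftrightarrow> True"
| "wf_exp d (Var p) \<longleftrightarrow> p < d"
| "wf_exp d (Plus a b) \<longleftrightarrow> wf_exp d a \<and> wf_exp d b"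
| "wf_exp d (Minus a b) \<longleftrightarrow> wf_exp d a \<and> wf_exp d b"
| "wf_exp d (Read a) \<longleftrightarrow> wf_exp d a"

text \<open>Registers from \<open>d\<close> upwards form an evaluation stack: the value ends up in
  register \<open>d\<close>, and a second operand is computed in \<open>Suc d\<close> while the
  first one waits. The machine has no move instruction, so a variable is copied by adding it to
  0.\<close>

primrec exp_prog :: "nat \<Rightarrow> exp \<Rightarrow> prog" where
  "exp_prog d (Num k) = Const d k"
| "exp_prog d (Var p) = Seq (Const d 0) (Add d d p)"
| "exp_prog d (Plus a b) = Seq (exp_prog d a) (Seq (exp_prog (Suc d) b) (Add d d (Suc d)))"
| "exp_prog d (Minus a b) = Seq (exp_prog d a) (Seq (exp_prog (Suc d) b) (Sub d d (Suc d)))"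
| "exp_prog d (Read a) = Seq (exp_prog d a) (Load d d)"

primrec exp_time :: "exp \<Rightarrow> nat" where
  "exp_time (Num k) = 1"
| "exp_time (Var p) = 2"
| "exp_time (Plus a b) = exp_time a + (exp_time b + 1)"
| "exp_time (Minus a b) = exp_time a + (exp_time b + 1)"
| "exp_time (Read a) = exp_time a + 1"

datatype stmt =
    Nop
  | Write exp exp
  | Ifz exp stmt stmt
  | Then stmt stmt
  | Bind exp stmt
  | For nat stmt

primrec sem :: "stmt \<Rightarrow> nat list \<Rightarrow> (nat \<Rightarrow> nat) \<Rightarrow> (nat \<Rightarrow> nat)" where
  "sem Nop vs \<mu> = \<mu>"
| "sem (Write a b) vs \<mu> = \<mu>(ev a vs \<mu> := ev b vs \<mu>)"
| "sem (Ifz e s t) vs \<mu> = (if ev e vs \<mu> = 0 then sem s vs \<mu> else sem t vs \<mu>)"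
| "sem (Then s t) vs \<mu> = sem t vs (sem s vs \<mu>)"
| "sem (Bind e s) vs \<mu> = sem s (vs @ [ev e vs \<mu>]) \<mu>"
| "sem (For p s) vs \<mu> = fold (\<lambda>v. sem s (vs @ [v])) [0..<vs ! p] \<mu>"

primrec wf_stmt :: "nat \<Rightarrow> stmt \<Rightarrow> bool" where
  "wf_stmt d Nop \<longleftrightarrow> True"
| "wf_stmt d (Write a b) \<longleftrightarrow> wf_exp d a \<and> wf_exp d b"
| "wf_stmt d (Ifz e s t) \<longleftrightarrow> wf_exp d e \<and> wf_stmt d s \<and> wf_stmt d t"
| "wf_stmt d (Then s t) \<longleftrightarrow> wf_stmt d s \<and> wf_stmt d t"
| "wf_stmt d (Bind e s) \<longleftrightarrow> wf_exp d e \<and> wf_stmt (Suc d) s"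
| "wf_stmt d (For p s) \<longleftrightarrow> p < 2 \<and> wf_stmt (Suc d) s"

text \<open>\<open>Bind\<close> and \<open>For\<close> leave their value in register
  \<open>d\<close>, which thereby becomes variable \<open>d\<close> of the body, compiled at depth
  \<open>Suc d\<close>. Only strict comparison is available, so the test for 0 is a comparison with
  1.\<close>

primrec stmt_prog :: "nat \<Rightarrow> stmt \<Rightarrow> prog" where
  "stmt_prog d Nop = Skip"
| "stmt_prog d (Write a b) = Seq (exp_prog d a) (Seq (exp_prog (Suc d) b) (Store d (Suc d)))"
| "stmt_prog d (Ifz e s t) =
     Seq (exp_prog d e) (Seq (Const (Suc d) 1) (IfLess d (Suc d) (stmt_prog d s) (stmt_prog d t)))"
| "stmt_prog d (Then s t) = Seq (stmt_prog d s) (stmt_prog d t)"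
| "stmt_prog d (Bind e s) = Seq (exp_prog d e) (stmt_prog (Suc d) s)"
| "stmt_prog d (For p s) = Seq (Const d 0)
     (WhileLess d p (Seq (stmt_prog (Suc d) s) (Seq (Const (Suc d) 1) (Add d d (Suc d)))))"

text \<open>Charging both branches of \<open>Ifz\<close> makes the bound independent of the data.
  Each iteration of a loop pays 3 extra steps for the test, the constant 1 and the increment; the 2
  covers clearing the counter and the final failing test.\<close>

primrec stmt_time :: "nat \<Rightarrow> nat \<Rightarrow> stmt \<Rightarrow> nat" where
  "stmt_time n m Nop = 1"
| "stmt_time n m (Write a b) = exp_time a + (exp_time b + 1)"
| "stmt_time n m (Ifz e s t) = exp_time e + 2 + (stmt_time n m s + stmt_time n m t)"
| "stmt_time n m (Then s t) = stmt_time n m s + stmt_time n m t"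
| "stmt_time n m (Bind e s) = exp_time e + stmt_time n m s"
| "stmt_time n m (For p s) = 2 + (if p = 0 then n else m) * (stmt_time n m s + 3)"

definition holds_vars :: "nat list \<Rightarrow> ram \<Rightarrow> bool" where
  "holds_vars vs s \<longleftrightarrow> (\<forall>i<length vs. reg s i = vs ! i)"

lemma holds_vars_snoc:
  "holds_vars (vs @ [v]) s \<longleftrightarrow> holds_vars vs s \<and> reg s (length vs) = v"
  by (auto simp: holds_vars_def nth_append less_Suc_eq)

text \<open>The depth \<open>d\<close> may exceed the number of variables, because a second operand
  is evaluated above a pending first one. That registers below \<open>d\<close> are unchanged is
  what preserves this pending value in the induction.\<close>

lemma exec_exp_prog:
  assumes "holds_vars vs s" "wf_exp (length vs) e" "length vs \<le> d"
  shows "\<exists>s'. exec (exp_prog d e) s (exp_time e) s' \<and> mem s' = mem s \<and>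
    reg s' d = ev e vs (mem s) \<and> (\<forall>i<d. reg s' i = reg s i)"
  using assms
proof (induction e arbitrary: d s)
  case (Num k)
  show ?case using exec.Const[of d k s]
    by (intro exI[of _ "s\<lparr>reg := (reg s)(d := k)\<rparr>"]) simp
next
  case (Var p)
  define s1 where "s1 = s\<lparr>reg := (reg s)(d := 0)\<rparr>"
  have "exec (exp_prog d (Var p)) s (1 + 1) (s1\<lparr>reg := (reg s1)(d := reg s1 d + reg s1 p)\<rparr>)"
    using exec.Seq[OF exec.Const[of d 0 s] exec.Add[of d d p]] by (simp add: s1_def)
  with Var show ?case
    by (intro exI[of _ "s1\<lparr>reg := (reg s1)(d := reg s1 d + reg s1 p)\<rparr>"])
      (auto simp: holds_vars_def s1_def numeral_2_eq_2)
next
  case (Plus a b)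
  obtain s1 where 1: "exec (exp_prog d a) s (exp_time a) s1" "mem s1 = mem s"
      "reg s1 d = ev a vs (mem s)" "\<forall>i<d. reg s1 i = reg s i"
    using Plus.IH(1)[of s d] Plus.prems by auto
  have "holds_vars vs s1" using Plus.prems 1 by (simp add: holds_vars_def)
  then obtain s2 where 2: "exec (exp_prog (Suc d) b) s1 (exp_time b) s2" "mem s2 = mem s1"
      "reg s2 (Suc d) = ev b vs (mem s1)" "\<forall>i<Suc d. reg s2 i = reg s1 i"
    using Plus.IH(2)[of s1 "Suc d"] Plus.prems by auto
  show ?case
    using exec.Seq[OF 1(1) exec.Seq[OF 2(1) exec.Add[of d d "Suc d" s2]]] 1(2-4) 2(2-4)
    unfolding exp_prog.simps exp_time.simps
    by (intro exI conjI) (assumption, auto)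
next
  case (Minus a b)
  obtain s1 where 1: "exec (exp_prog d a) s (exp_time a) s1" "mem s1 = mem s"
      "reg s1 d = ev a vs (mem s)" "\<forall>i<d. reg s1 i = reg s i"
    using Minus.IH(1)[of s d] Minus.prems by auto
  have "holds_vars vs s1" using Minus.prems 1 by (simp add: holds_vars_def)
  then obtain s2 where 2: "exec (exp_prog (Suc d) b) s1 (exp_time b) s2" "mem s2 = mem s1"
      "reg s2 (Suc d) = ev b vs (mem s1)" "\<forall>i<Suc d. reg s2 i = reg s1 i"
    using Minus.IH(2)[of s1 "Suc d"] Minus.prems by auto
  show ?case
    using exec.Seq[OF 1(1) exec.Seq[OF 2(1) exec.Sub[of d d "Suc d" s2]]] 1(2-4) 2(2-4)
    unfolding exp_prog.simps exp_time.simps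
    by (intro exI conjI) (assumption, auto)
next
  case (Read a)
  obtain s1 where 1: "exec (exp_prog d a) s (exp_time a) s1" "mem s1 = mem s"
      "reg s1 d = ev a vs (mem s)" "\<forall>i<d. reg s1 i = reg s i"
    using Read.IH[of s d] Read.prems by auto
  show ?case
    using exec.Seq[OF 1(1) exec.Load[of d d s1]] 1(2-4) unfolding exp_prog.simps exp_time.simps
    by (intro exI conjI) (assumption, auto)
qed

lemma exec_stmt_prog:
  assumes "holds_vars vs s" "wf_stmt (length vs) st" "2 \<le> length vs"
  shows "\<exists>t s'. exec (stmt_prog (length vs) st) s t s' \<and> t \<le> stmt_time (vs ! 0) (vs ! 1) st \<and>
    mem s' = sem st vs (mem s) \<and> holds_vars vs s'"
  using assms
proof (induction st arbitrary: vs s)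
  case Nop
  show ?case using exec.Skip[of s] Nop by force
next
  case (Write a b)
  obtain s1 where 1: "exec (exp_prog (length vs) a) s (exp_time a) s1" "mem s1 = mem s"
      "reg s1 (length vs) = ev a vs (mem s)" "\<forall>i<length vs. reg s1 i = reg s i"
    using exec_exp_prog Write.prems by fastforce
  have "holds_vars vs s1" using Write.prems 1 by (simp add: holds_vars_def)
  then obtain s2 where 2: "exec (exp_prog (Suc (length vs)) b) s1 (exp_time b) s2" "mem s2 = mem s1"
      "reg s2 (Suc (length vs)) = ev b vs (mem s1)" "\<forall>i<Suc (length vs). reg s2 i = reg s1 i"
    using exec_exp_prog[of vs s1 b "Suc (length vs)"] Write.prems by auto
  show ?case
    using exec.Seq[OF 1(1) exec.Seq[OF 2(1) exec.Store]] 1(2-4) 2(2-4) Write.prems(1)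
    unfolding stmt_prog.simps
    by (intro exI conjI) (assumption, auto simp: holds_vars_def)
next
  case (Ifz e c1 c2)
  let ?d = "length vs"
  obtain s1 where 1: "exec (exp_prog ?d e) s (exp_time e) s1" "mem s1 = mem s"
      "reg s1 ?d = ev e vs (mem s)" "\<forall>i<?d. reg s1 i = reg s i"
    using exec_exp_prog Ifz.prems by fastforce
  define s2 where "s2 = s1\<lparr>reg := (reg s1)(Suc ?d := 1)\<rparr>"
  have 2: "exec (Const (Suc ?d) 1) s1 1 s2" unfolding s2_def by (rule exec.Const)
  have hv: "holds_vars vs s2" using Ifz.prems 1 by (simp add: holds_vars_def s2_def)
  obtain t3 s3 where 3: "exec (stmt_prog ?d c1) s2 t3 s3" "t3 \<le> stmt_time (vs ! 0) (vs ! 1) c1"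
      "mem s3 = sem c1 vs (mem s2)" "holds_vars vs s3"
    using Ifz.IH(1)[OF hv] Ifz.prems by auto
  obtain t4 s4 where 4: "exec (stmt_prog ?d c2) s2 t4 s4" "t4 \<le> stmt_time (vs ! 0) (vs ! 1) c2"
      "mem s4 = sem c2 vs (mem s2)" "holds_vars vs s4"
    using Ifz.IH(2)[OF hv] Ifz.prems by auto
  have r: "reg s2 ?d = ev e vs (mem s)" "reg s2 (Suc ?d) = 1" "mem s2 = mem s"
    using 1 by (auto simp: s2_def)
  show ?case
  proof (cases "ev e vs (mem s) = 0")
    case True
    then have "reg s2 ?d < reg s2 (Suc ?d)" using r by simp
    from exec.Seq[OF 1(1) exec.Seq[OF 2 exec.IfTrue[OF this 3(1)]]] show ?thesis
      using True 3(2-4) r(3)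
      unfolding stmt_prog.simps by (intro exI conjI) (assumption, auto)
  next
    case False
    then have "\<not> reg s2 ?d < reg s2 (Suc ?d)" using r by simp
    from exec.Seq[OF 1(1) exec.Seq[OF 2 exec.IfFalse[OF this 4(1)]]] show ?thesis
      using False 4(2-4) r(3)
      unfolding stmt_prog.simps by (intro exI conjI) (assumption, auto)
  qed
next
  case (Then c1 c2)
  obtain t1 s1 where 1: "exec (stmt_prog (length vs) c1) s t1 s1"
      "t1 \<le> stmt_time (vs ! 0) (vs ! 1) c1" "mem s1 = sem c1 vs (mem s)" "holds_vars vs s1"
    using Then.IH(1)[of vs s] Then.prems by auto
  obtain t2 s2 where 2: "exec (stmt_prog (length vs) c2) s1 t2 s2"
      "t2 \<le> stmt_time (vs ! 0) (vs ! 1) c2" "mem s2 = sem c2 vs (mem s1)" "holds_vars vs s2"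
    using Then.IH(2)[of vs s1] Then.prems 1 by auto
  show ?case
    using exec.Seq[OF 1(1) 2(1)] 1(2-4) 2(2-4) unfolding stmt_prog.simps
    by (intro exI conjI) (assumption, auto)
next
  case (Bind e c)
  obtain s1 where 1: "exec (exp_prog (length vs) e) s (exp_time e) s1" "mem s1 = mem s"
      "reg s1 (length vs) = ev e vs (mem s)" "\<forall>i<length vs. reg s1 i = reg s i"
    using exec_exp_prog Bind.prems by fastforce
  let ?vs = "vs @ [ev e vs (mem s)]"
  have hv: "holds_vars ?vs s1" using Bind.prems 1 by (simp add: holds_vars_snoc) (simp add: holds_vars_def)
  obtain t2 s2 where 2: "exec (stmt_prog (length ?vs) c) s1 t2 s2"
      "t2 \<le> stmt_time (?vs ! 0) (?vs ! 1) c" "mem s2 = sem c ?vs (mem s1)" "holds_vars ?vs s2"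
    using Bind.IH[OF hv] Bind.prems by auto
  have "?vs ! 0 = vs ! 0" "?vs ! 1 = vs ! 1" using Bind.prems by (auto simp: nth_append)
  moreover have "exec (stmt_prog (length vs) (Bind e c)) s (exp_time e + t2) s2"
    using exec.Seq[OF 1(1)] 2(1) by simp
  ultimately show ?case using 1(2-4) 2(2-4) by (intro exI conjI) (assumption, auto simp: holds_vars_snoc)
next
  case (For p c)
  let ?d = "length vs" and ?n = "vs ! p"
  let ?T = "stmt_time (vs ! 0) (vs ! 1) c"
  let ?body = "Seq (stmt_prog (Suc ?d) c) (Seq (Const (Suc ?d) 1) (Add ?d ?d (Suc ?d)))"
  \<comment> \<open>Induction on the number \<open>k\<close> of iterations still to come, so the
    counter stands at \<open>?n - k\<close>; the register \<open>p\<close> that bounds the loop is a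
    variable of \<open>vs\<close> and survives the body.\<close>
  have loop: "\<exists>t s'. exec (WhileLess ?d p ?body) s t s' \<and> t \<le> 1 + k * (?T + 3) \<and>
      mem s' = fold (\<lambda>v. sem c (vs @ [v])) [?n - k..<?n] (mem s) \<and> holds_vars vs s'"
    if "holds_vars (vs @ [?n - k]) s" "k \<le> ?n" for k s
    using that
  proof (induction k arbitrary: s)
    case 0
    then have "\<not> reg s ?d < reg s p"
      using For.prems by (auto simp: holds_vars_snoc) (auto simp: holds_vars_def)
    from exec.WhileFalse[OF this, of ?body] show ?case using 0
      by (intro exI conjI) (assumption, auto simp: holds_vars_snoc)
  next
    case (Suc k)
    let ?vs = "vs @ [?n - Suc k]"
    obtain t1 s1 where 1: "exec (stmt_prog (length ?vs) c) s t1 s1"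
        "t1 \<le> stmt_time (?vs ! 0) (?vs ! 1) c" "mem s1 = sem c ?vs (mem s)" "holds_vars ?vs s1"
      using For.IH[OF Suc.prems(1)] For.prems by auto
    have vs: "?vs ! 0 = vs ! 0" "?vs ! 1 = vs ! 1" using For.prems by (auto simp: nth_append)
    define s2 where "s2 = s1\<lparr>reg := (reg s1)(Suc ?d := 1)\<rparr>"
    define s3 where "s3 = s2\<lparr>reg := (reg s2)(?d := reg s2 ?d + reg s2 (Suc ?d))\<rparr>"
    have b: "exec ?body s (t1 + (1 + 1)) s3"
      using exec.Seq[OF 1(1) exec.Seq[OF exec.Const[of "Suc ?d" 1 s1] exec.Add[of ?d ?d "Suc ?d"]]]
      by (simp add: s3_def s2_def)
    have "holds_vars vs s3" using 1(4) by (auto simp: holds_vars_def s3_def s2_def nth_append)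
    moreover have "reg s3 ?d = ?n - k"
      using 1(4) Suc.prems(2) by (auto simp: holds_vars_snoc s3_def s2_def)
    ultimately have hv: "holds_vars (vs @ [?n - k]) s3" by (simp add: holds_vars_snoc)
    have m3: "mem s3 = mem s1" by (simp add: s3_def s2_def)
    obtain t4 s4 where 4: "exec (WhileLess ?d p ?body) s3 t4 s4" "t4 \<le> 1 + k * (?T + 3)"
        "mem s4 = fold (\<lambda>v. sem c (vs @ [v])) [?n - k..<?n] (mem s3)" "holds_vars vs s4"
      using Suc.IH[OF hv] Suc.prems by auto
    have "reg s ?d < reg s p"
      using Suc.prems For.prems by (auto simp: holds_vars_snoc) (auto simp: holds_vars_def)
    note w = exec.WhileTrue[OF this b 4(1)]
    have "[?n - Suc k..<?n] = (?n - Suc k) # [?n - k..<?n]"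
      using Suc.prems(2) by (subst upt_conv_Cons) (auto simp: Suc_diff_Suc)
    then have "mem s4 = fold (\<lambda>v. sem c (vs @ [v])) [?n - Suc k..<?n] (mem s)"
      using 4(3) 1(3) m3 by simp
    with w 4(2,4) 1(2) show ?case unfolding vs
      by (intro exI conjI) (assumption, auto)
  qed
  define s1 where "s1 = s\<lparr>reg := (reg s)(?d := 0)\<rparr>"
  have e1: "exec (Const ?d 0) s 1 s1" unfolding s1_def by (rule exec.Const)
  have "holds_vars (vs @ [?n - ?n]) s1"
    using For.prems by (simp add: holds_vars_snoc s1_def) (simp add: holds_vars_def)
  from loop[OF this] obtain t s' where 2: "exec (WhileLess ?d p ?body) s1 t s'"
      "t \<le> 1 + ?n * (?T + 3)" "mem s' = fold (\<lambda>v. sem c (vs @ [v])) [?n - ?n..<?n] (mem s1)"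
      "holds_vars vs s'" by auto
  have "(if p = 0 then vs ! 0 else vs ! 1) = ?n"
    using For.prems by (cases p) (auto simp: less_Suc_eq numeral_2_eq_2)
  with exec.Seq[OF e1 2(1)] 2(2-4) show ?case
    unfolding stmt_prog.simps by (intro exI conjI) (assumption, auto simp: s1_def)
qed

section \<open>Polynomial bounds on running times\<close>

definition time_bounded :: "stmt \<Rightarrow> nat \<Rightarrow> nat \<Rightarrow> bool" where
  "time_bounded s a b \<longleftrightarrow> (\<exists>C. \<forall>n\<ge>1. \<forall>m\<ge>1. stmt_time n m s \<le> C * (n ^ a * m ^ b))"

lemma time_bounded_mono:
  assumes "time_bounded s a b" "a \<le> a'" "b \<le> b'"
  shows "time_bounded s a' b'"
proof -
  obtain C where C: "\<And>n m. n \<ge> 1 \<Longrightarrow> m \<ge> 1 \<Longrightarrow> stmt_time n m s \<le> C * (n ^ a * m ^ b)"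
    using assms(1) unfolding time_bounded_def by blast
  have "n ^ a * m ^ b \<le> n ^ a' * m ^ b'" if "n \<ge> 1" "m \<ge> 1" for n m :: nat
    using that assms(2,3) by (intro mult_mono power_increasing) auto
  with C show ?thesis unfolding time_bounded_def by (meson le_trans mult_le_mono2)
qed

lemma time_bounded_const:
  assumes "\<And>n m. stmt_time n m s = c"
  shows "time_bounded s a b"
  unfolding time_bounded_def by (rule exI[of _ c]) (simp add: assms Suc_le_eq)

text \<open>Additive constants are absorbed because \<open>n ^ a * m ^ b\<close> is at least 1 for
  positive \<open>n\<close> and \<open>m\<close>; inputs without arcs are answered separately by the
  final program.\<close>

lemma time_bounded_add:
  assumes "time_bounded s a b" "time_bounded t a b"
    and "\<And>n m. stmt_time n m r \<le> c + (stmt_time n m s + stmt_time n m t)"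
  shows "time_bounded r a b"
proof -
  obtain C where C: "\<And>n m. n \<ge> 1 \<Longrightarrow> m \<ge> 1 \<Longrightarrow> stmt_time n m s \<le> C * (n ^ a * m ^ b)"
    using assms(1) unfolding time_bounded_def by blast
  obtain D where D: "\<And>n m. n \<ge> 1 \<Longrightarrow> m \<ge> 1 \<Longrightarrow> stmt_time n m t \<le> D * (n ^ a * m ^ b)"
    using assms(2) unfolding time_bounded_def by blast
  have "stmt_time n m r \<le> (c + (C + D)) * (n ^ a * m ^ b)" if nm: "n \<ge> 1" "m \<ge> 1" for n m
  proof -
    define M where "M = n ^ a * m ^ b"
    have "1 \<le> M" using nm by (simp add: M_def)
    then have "c * 1 \<le> c * M" by (intro mult_le_mono2)
    then show ?thesis
      using C[OF nm] D[OF nm] assms(3)[of n m] unfolding M_def[symmetric] add_mult_distrib by linarith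
  qed
  then show ?thesis unfolding time_bounded_def by blast
qed

lemma time_bounded_Write: "time_bounded (Write x y) a b"
  by (rule time_bounded_const) simp

lemma time_bounded_Nop: "time_bounded Nop a b"
  by (rule time_bounded_const) simp

lemma time_bounded_Then:
  "time_bounded s a b \<Longrightarrow> time_bounded t a b \<Longrightarrow> time_bounded (Then s t) a b"
  by (rule time_bounded_add[of s a b t _ 0]) auto

lemma time_bounded_Ifz:
  "time_bounded s a b \<Longrightarrow> time_bounded t a b \<Longrightarrow> time_bounded (Ifz e s t) a b"
  by (rule time_bounded_add[of s a b t _ "exp_time e + 2"]) auto

lemma time_bounded_Bind: "time_bounded s a b \<Longrightarrow> time_bounded (Bind e s) a b"
  by (rule time_bounded_add[of s a b Nop _ "exp_time e", OF _ time_bounded_Nop]) auto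

lemma time_bounded_For:
  assumes "time_bounded s a b" and "p = 0 \<and> a' = Suc a \<and> b' = b \<or> p \<noteq> 0 \<and> a' = a \<and> b' = Suc b"
  shows "time_bounded (For p s) a' b'"
proof -
  obtain C where C: "\<And>n m. n \<ge> 1 \<Longrightarrow> m \<ge> 1 \<Longrightarrow> stmt_time n m s \<le> C * (n ^ a * m ^ b)"
    using assms(1) unfolding time_bounded_def by blast
  have "stmt_time n m (For p s) \<le> (C + 5) * (n ^ a' * m ^ b')" if nm: "n \<ge> 1" "m \<ge> 1" for n m
  proof -
    let ?k = "if p = 0 then n else m"
    have k: "n ^ a' * m ^ b' = ?k * (n ^ a * m ^ b)" using assms(2) by auto
    have pos: "1 \<le> n ^ a * m ^ b" using nm by simp
    define M where "M = n ^ a * m ^ b"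
    define K where "K = ?k"
    have M: "1 \<le> M" "stmt_time n m s \<le> C * M" using pos C[OF nm] by (simp_all add: M_def)
    then have "K * (stmt_time n m s + 3) \<le> K * (C * M + 3 * M)"
      by (intro mult_le_mono2) linarith
    then have "stmt_time n m (For p s) \<le> 2 + K * (C * M + 3 * M)" by (simp add: K_def)
    also have "1 * 1 \<le> K * M" using nm M by (intro mult_le_mono) (auto simp: K_def)
    \<comment> \<open>The 5 is 3 per iteration plus a single 2, which is at most
      \<open>2 * (K * M)\<close>.\<close>
    then have "2 + K * (C * M + 3 * M) \<le> (C + 5) * (K * M)" by (simp add: algebra_simps)
    finally show ?thesis unfolding k M_def[symmetric] K_def[symmetric] .
  qed
  then show ?thesis unfolding time_bounded_def by blast
qed

section \<open>The algorithm\<close>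

abbreviation flag_exp :: exp where "flag_exp \<equiv> Plus (Var 1) (Var 1)"
abbreviation tmp_exp :: exp where "tmp_exp \<equiv> Plus flag_exp (Num 1)"
abbreviation row_exp :: exp where "row_exp \<equiv> Plus flag_exp (Num 2)"

definition tail_exp :: "bool \<Rightarrow> nat \<Rightarrow> exp" where
  "tail_exp r i = Read (Plus (Plus (Var i) (Var i)) (Num (of_bool r)))"

definition head_exp :: "bool \<Rightarrow> nat \<Rightarrow> exp" where
  "head_exp r i = Read (Plus (Plus (Var i) (Var i)) (Num (of_bool (\<not> r))))"

text \<open>The machine cannot multiply in one step, so the start of row \<open>u\<close> of the
  matrix is looked up in a table instead of being computed from \<open>u * n\<close>.\<close>

definition adj_exp :: "exp \<Rightarrow> exp \<Rightarrow> exp" where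
  "adj_exp u v = Read (Plus (Read (Plus row_exp u)) v)"

text \<open>Truncated subtraction makes at least one summand 0, so this is the distance of two
  numbers and vanishes exactly on equality.\<close>

definition dist_exp :: "exp \<Rightarrow> exp \<Rightarrow> exp" where
  "dist_exp a b = Plus (Minus a b) (Minus b a)"

lemma ev_dist_exp [simp]: "ev (dist_exp a b) vs \<mu> = 0 \<longleftrightarrow> ev a vs \<mu> = ev b vs \<mu>"
  "0 < ev (dist_exp a b) vs \<mu> \<longleftrightarrow> ev a vs \<mu> \<noteq> ev b vs \<mu>"
  by (auto simp: dist_exp_def)

text \<open>A conjunction of tests: the mark \<open>True\<close> asks that the expression vanishes,
  \<open>False\<close> that it does not. The lists used depend on \<open>P\<close> only, so their
  length counts as a constant.\<close>

fun guards :: "(bool \<times> exp) list \<Rightarrow> stmt \<Rightarrow> stmt" where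
  "guards [] s = s"
| "guards ((b, e) # ts) s = (if b then Ifz e (guards ts s) Nop else Ifz e Nop (guards ts s))"

lemma sem_guards:
  "sem (guards ts s) vs \<mu> =
     (if \<forall>(b, e)\<in>set ts. (ev e vs \<mu> = 0) = b then sem s vs \<mu> else \<mu>)"
  by (induction ts s rule: guards.induct) auto

lemma wf_guards: "wf_stmt d (guards ts s) \<longleftrightarrow> (\<forall>(b, e)\<in>set ts. wf_exp d e) \<and> wf_stmt d s"
  by (induction ts s rule: guards.induct) auto

lemma time_bounded_guards: "time_bounded s a b \<Longrightarrow> time_bounded (guards ts s) a b"
  by (induction ts s rule: guards.induct)
     (auto intro: time_bounded_Ifz time_bounded_Nop)

lemma fold_upt_invariant:
  assumes "P 0 x" "\<And>i x. i < k \<Longrightarrow> P i x \<Longrightarrow> P (Suc i) (f i x)"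
  shows "P k (fold f [0..<k] x)"
  using assms by (induction k) auto

text \<open>The registers \<open>0\<close>, \<open>1\<close>, \<open>2\<close> hold \<open>n\<close>, \<open>m\<close> and the address of the array of states. The guessed
  image of the \<open>j\<close>-th vertex of \<open>P\<close> is in register \<open>pos N j\<close>; the registers \<open>3\<close> and \<open>N + 2\<close> in between
  are the counters of the two loops over the arcs.\<close>

definition pos :: "nat \<Rightarrow> nat \<Rightarrow> nat" where
  "pos N j = (if j < N - 2 then 4 + j else 5 + j)"

definition copy_tests :: "nat \<Rightarrow> (nat \<Rightarrow> nat \<Rightarrow> bool) \<Rightarrow> (bool \<times> exp) list" where
  "copy_tests N A =
     [(False, dist_exp (Var (pos N i)) (Var (pos N j))). i \<leftarrow> [0..<N], j \<leftarrow> [0..<i]] @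
     [(\<not> A i j, adj_exp (Var (pos N i)) (Var (pos N j))). i \<leftarrow> [0..<N], j \<leftarrow> [0..<N],
        (i, j) \<noteq> (N - 2, N - 3)]"

definition free_tests :: "nat \<Rightarrow> exp \<Rightarrow> (bool \<times> exp) list" where
  "free_tests N v =
     [(False, dist_exp v (Var (pos N i))). i \<leftarrow> [0..<N]] @
     [(True, adj_exp v (Var (pos N i))). i \<leftarrow> [0..<N], i \<noteq> N - 2 \<and> i \<noteq> N - 3] @
     [(True, adj_exp (Var (pos N i)) v). i \<leftarrow> [0..<N], i \<noteq> N - 2]"

definition scan_stmt :: "nat \<Rightarrow> stmt" where
  "scan_stmt d = For 0 (guards [(True, dist_exp (Read (Plus (Var 2) (Var d))) (Num 1))]
     (Write tmp_exp (Var d)))"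

definition expand_stmt :: "nat \<Rightarrow> nat \<Rightarrow> nat \<Rightarrow> stmt" where
  "expand_stmt N u d = For 0
     (guards ([(False, adj_exp (Var u) (Var d)), (True, Read (Plus (Var 2) (Var d)))] @
         free_tests N (Var d))
       (Write (Plus (Var 2) (Var d)) (Num 1)))"

text \<open>One round of the search. Instead of a queue, a linear scan looks for a vertex in state
  1, which has the same order of cost as the pass over the row of that vertex. The temporary starts
  as \<open>n\<close>, which is no vertex and so signals that nothing is pending.\<close>

definition process_stmt :: "nat \<Rightarrow> nat \<Rightarrow> stmt" where
  "process_stmt N d = Then (Write tmp_exp (Var 0)) (Then (scan_stmt d)
     (Bind (Read tmp_exp) (guards [(False, Minus (Var 0) (Var d))]
       (Then (Write (Plus (Var 2) (Var d)) (Num 2))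
       (Then (guards [(False, adj_exp (Var d) (Var (pos N (N - 3))))] (Write flag_exp (Num 1)))
         (expand_stmt N d (Suc d)))))))"

definition reach_stmt :: "nat \<Rightarrow> nat \<Rightarrow> stmt" where
  "reach_stmt N d = Then (For 0 (Write (Plus (Var 2) (Var d)) (Num 0)))
     (Then (Write (Plus (Var 2) (Var (pos N (N - 2)))) (Num 1))
       (For 0 (process_stmt N (Suc d))))"

definition arc_loop :: "bool \<Rightarrow> nat \<Rightarrow> stmt \<Rightarrow> stmt" where
  "arc_loop r d s = For 1 (Bind (tail_exp r d) (Bind (head_exp r d) s))"

definition search_stmt :: "bool \<Rightarrow> nat \<Rightarrow> (nat \<Rightarrow> nat \<Rightarrow> bool) \<Rightarrow> stmt" where
  "search_stmt r N A = arc_loop r 3 ((For 0 ^^ (N - 4)) (arc_loop r (N + 2)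
     (guards (copy_tests N A) (reach_stmt N (N + 5)))))"

text \<open>The table of row starts is filled by repeated addition of \<open>n\<close>. Its last
  entry is the end of the matrix, from which \<open>main_stmt\<close> reads the address of the
  states. The matrix relies on the memory above the input being 0.\<close>

definition setup_stmt :: "bool \<Rightarrow> stmt" where
  "setup_stmt r = Then (Write row_exp (Plus (Plus row_exp (Var 0)) (Num 1)))
     (Then (For 0 (Write (Plus (Plus row_exp (Var 2)) (Num 1))
                     (Plus (Read (Plus row_exp (Var 2))) (Var 0))))
        (For 1 (Write (Plus (Read (Plus row_exp (tail_exp r 2))) (head_exp r 2)) (Num 1))))"

definition main_stmt :: "bool \<Rightarrow> nat \<Rightarrow> (nat \<Rightarrow> nat \<Rightarrow> bool) \<Rightarrow> stmt" where
  "main_stmt r N A =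
     Then (setup_stmt r) (Bind (Read (Plus row_exp (Var 0))) (search_stmt r N A))"

text \<open>The positions \<open>N - 1\<close>, \<open>N - 2\<close>, \<open>N - 3\<close> are those of \<open>z\<close>, \<open>t\<close> and \<open>y\<close>.\<close>

definition partial_copy :: "(nat \<times> nat) set \<Rightarrow> nat \<Rightarrow> (nat \<Rightarrow> nat \<Rightarrow> bool) \<Rightarrow> (nat \<Rightarrow> nat) \<Rightarrow> bool"
  where "partial_copy E N A f \<longleftrightarrow> inj_on f {..<N} \<and>
     (\<forall>i<N. \<forall>j<N. (i, j) \<noteq> (N - 2, N - 3) \<longrightarrow> (f i, f j) \<in> E \<longleftrightarrow> A i j)"

text \<open>Arcs between \<open>v\<close> and \<open>t = f (N - 2)\<close> are unrestricted, and an
  arc from \<open>v\<close> to \<open>y = f (N - 3)\<close> is what the path has to end with. The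
  chords that this admits are dealt with afterwards by minimality.\<close>

definition free_vertex :: "(nat \<times> nat) set \<Rightarrow> nat \<Rightarrow> (nat \<Rightarrow> nat) \<Rightarrow> nat \<Rightarrow> bool" where
  "free_vertex E N f v \<longleftrightarrow> (\<forall>i<N. v \<noteq> f i) \<and>
     (\<forall>i<N. i \<noteq> N - 2 \<and> i \<noteq> N - 3 \<longrightarrow> (v, f i) \<notin> E) \<and>
     (\<forall>i<N. i \<noteq> N - 2 \<longrightarrow> (f i, v) \<notin> E)"

text \<open>Taking \<open>u = f (N - 2)\<close> covers the case that the untested arc from
  \<open>t\<close> to \<open>y\<close> is present.\<close>

definition linked :: "(nat \<times> nat) set \<Rightarrow> nat \<Rightarrow> (nat \<Rightarrow> nat) \<Rightarrow> bool" where
  "linked E N f \<longleftrightarrow> (\<exists>u. (f (N - 2), u) \<in> {(u, v) \<in> E. free_vertex E N f v}\<^sup>* \<and> (u, f (N - 3)) \<in> E)"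

section \<open>Memory contents during a run on a fixed input\<close>

locale input =
  fixes r :: bool and n :: nat and arcs :: "(nat \<times> nat) list"
  assumes arcs_range: "set arcs \<subseteq> {..<n} \<times> {..<n}"
begin

abbreviation "m \<equiv> length arcs"

definition arc :: "nat \<Rightarrow> nat \<times> nat" where
  "arc k = (if r then prod.swap (arcs ! k) else arcs ! k)"

definition E :: "(nat \<times> nat) set" where "E = arc ` {..<m}"

definition matrix :: nat where "matrix = 2 * m + n + 3"
definition states :: nat where "states = matrix + n * n"

definition loaded :: "(nat \<Rightarrow> nat) \<Rightarrow> bool" where
  "loaded \<mu> \<longleftrightarrow> (\<forall>k<m. \<mu> (2 * k) = fst (arcs ! k) \<and> \<mu> (Suc (2 * k)) = snd (arcs ! k))"

text \<open>Memory above the input: the answer in cell \<open>2 * m\<close>, a temporary in the next one, the addresses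
  of the rows of the adjacency matrix (and of its end), the matrix, and the state of each vertex in
  the search: 0 if unseen, 1 if seen, 2 if processed.\<close>

definition ready :: "(nat \<Rightarrow> nat) \<Rightarrow> bool" where
  "ready \<mu> \<longleftrightarrow> loaded \<mu> \<and> (\<forall>u\<le>n. \<mu> (2 * m + 2 + u) = matrix + u * n) \<and>
     (\<forall>u<n. \<forall>v<n. \<mu> (matrix + u * n + v) = of_bool ((u, v) \<in> E))"

definition base :: "nat list \<Rightarrow> bool" where
  "base vs \<longleftrightarrow> 3 \<le> length vs \<and> vs ! 0 = n \<and> vs ! 1 = m \<and> vs ! 2 = states"

lemma base_append [simp]: "base vs \<Longrightarrow> base (vs @ ws)"
  by (auto simp: base_def nth_append)

lemma arc_range: "k < m \<Longrightarrow> fst (arc k) < n \<and> snd (arc k) < n"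
  using arcs_range nth_mem[of k arcs] by (cases "arcs ! k") (auto simp: arc_def)

lemma E_range: "(u, v) \<in> E \<Longrightarrow> u < n \<and> v < n"
  unfolding E_def using arc_range by (metis fst_conv imageE lessThan_iff snd_conv)

lemma ev_tail_head:
  assumes "loaded \<mu>" "vs ! i = k" "k < m"
  shows "ev (tail_exp r i) vs \<mu> = fst (arc k)" "ev (head_exp r i) vs \<mu> = snd (arc k)"
  using assms by (auto simp: loaded_def tail_exp_def head_exp_def arc_def mult_2)

lemma matrix_cell_less: "u < n \<Longrightarrow> v < n \<Longrightarrow> u * n + v < n * n"
proof -
  assume "u < n" "v < n"
  then have "Suc u * n \<le> n * n" by (intro mult_le_mono1) simp
  with \<open>v < n\<close> show ?thesis by simp
qed

lemma matrix_cell_inj: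
  "v < n \<Longrightarrow> v' < n \<Longrightarrow> u * n + v = u' * n + v' \<longleftrightarrow> u = u' \<and> v = v'"
proof
  assume v: "v < n" "v' < n" and eq: "u * n + v = u' * n + v'"
  have "(u * n + v) div n = u" "(u' * n + v') div n = u'" using v by auto
  with eq have "u = u'" by simp
  with eq show "u = u' \<and> v = v'" by simp
qed auto

lemma ev_adj_exp:
  assumes "ready \<mu>" "base vs" "ev a vs \<mu> < n" "ev b vs \<mu> < n"
  shows "ev (adj_exp a b) vs \<mu> = of_bool ((ev a vs \<mu>, ev b vs \<mu>) \<in> E)"
  using assms by (auto simp: adj_exp_def ready_def base_def mult_2 simp del: of_bool_eq)

lemma loaded_upd: "loaded \<mu> \<Longrightarrow> 2 * m \<le> a \<Longrightarrow> loaded (\<mu>(a := x))"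
  by (auto simp: loaded_def)

text \<open>The cells allowed here (flag, temporary, states) are the only ones written once the
  matrix is complete.\<close>

lemma ready_upd:
  assumes "ready \<mu>" "a = 2 * m \<or> a = Suc (2 * m) \<or> states \<le> a"
  shows "ready (\<mu>(a := x))"
proof -
  have "matrix + u * n + v < states" if "u < n" "v < n" for u v
    using matrix_cell_less[OF that] by (simp add: states_def)
  then have ne: "\<And>u v. u < n \<Longrightarrow> v < n \<Longrightarrow> matrix + u * n + v \<noteq> a"
    using assms(2) by (fastforce simp: matrix_def)
  have "\<And>u. u \<le> n \<Longrightarrow> 2 * m + 2 + u \<noteq> a" 
    using assms(2) by (auto simp: states_def matrix_def)
  moreover have "loaded (\<mu>(a := x))"
    using assms by (intro loaded_upd) (auto simp: ready_def states_def matrix_def)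
  ultimately show ?thesis using assms(1) ne by (simp add: ready_def)
qed

lemma ready_cong:
  assumes "ready \<mu>" "\<And>a. a < states \<Longrightarrow> \<nu> a = \<mu> a"
  shows "ready \<nu>"
proof -
  have lt: "matrix + u * n + v < states" if "u < n" "v < n" for u v
    using matrix_cell_less[OF that] by (simp add: states_def)
  have "\<And>u. u \<le> n \<Longrightarrow> 2 * m + 2 + u < states" "\<And>k. k < m \<Longrightarrow> Suc (2 * k) < states"
    by (auto simp: states_def matrix_def)
  with lt assms show ?thesis by (simp add: ready_def loaded_def Suc_lessD)
qed

lemma ready_setup:
  assumes "loaded \<mu>" "\<And>a. 2 * m \<le> a \<Longrightarrow> \<mu> a = 0"
  shows "ready (sem (setup_stmt r) [n, m] \<mu>) \<and> sem (setup_stmt r) [n, m] \<mu> (2 * m) = 0"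
proof -
  \<comment> \<open>The table of \<open>n + 1\<close> row starts begins at \<open>2 * m + 2\<close>,
    so the matrix begins at \<open>2 * m + 2 + n + 1\<close>.\<close>
  define \<mu>1 where "\<mu>1 = \<mu>(2 * m + 2 := matrix)"
  define \<mu>2 where "\<mu>2 = fold (\<lambda>v. sem (Write (Plus (Plus row_exp (Var 2)) (Num 1))
      (Plus (Read (Plus row_exp (Var 2))) (Var 0))) ([n, m] @ [v])) [0..<n] \<mu>1"
  have "(\<forall>k\<le>n. \<mu>2 (2 * m + 2 + k) = matrix + k * n) \<and>
      (\<forall>a. a < 2 * m + 2 \<or> 2 * m + 2 + n < a \<longrightarrow> \<mu>2 a = \<mu> a)"
    unfolding \<mu>2_def
  proof (rule fold_upt_invariant[where P = "\<lambda>i \<nu>. (\<forall>k\<le>i. \<nu> (2 * m + 2 + k) = matrix + k * n) \<and>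
      (\<forall>a. a < 2 * m + 2 \<or> 2 * m + 2 + n < a \<longrightarrow> \<nu> a = \<mu> a)"])
    show "(\<forall>k\<le>0. \<mu>1 (2 * m + 2 + k) = matrix + k * n) \<and>
      (\<forall>a. a < 2 * m + 2 \<or> 2 * m + 2 + n < a \<longrightarrow> \<mu>1 a = \<mu> a)"
      by (auto simp: \<mu>1_def)
  qed (auto simp: mult_2 le_Suc_eq)
  then have row: "\<And>k. k \<le> n \<Longrightarrow> \<mu>2 (2 * m + 2 + k) = matrix + k * n"
    and rest: "\<And>a. a < 2 * m + 2 \<or> 2 * m + 2 + n < a \<Longrightarrow> \<mu>2 a = \<mu> a" by auto
  define \<mu>3 where "\<mu>3 = fold (\<lambda>v. sem (Write (Plus (Read (Plus row_exp (tail_exp r 2)))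
      (head_exp r 2)) (Num 1)) ([n, m] @ [v])) [0..<m] \<mu>2"
  have "(\<forall>a<matrix. \<mu>3 a = \<mu>2 a) \<and>
      (\<forall>u<n. \<forall>v<n. \<mu>3 (matrix + u * n + v) = of_bool ((u, v) \<in> arc ` {..<m}))"
    unfolding \<mu>3_def
  proof (rule fold_upt_invariant[where P = "\<lambda>i \<nu>. (\<forall>a<matrix. \<nu> a = \<mu>2 a) \<and>
      (\<forall>u<n. \<forall>v<n. \<nu> (matrix + u * n + v) = of_bool ((u, v) \<in> arc ` {..<i}))"])
    show "(\<forall>a<matrix. \<mu>2 a = \<mu>2 a) \<and>
      (\<forall>u<n. \<forall>v<n. \<mu>2 (matrix + u * n + v) = of_bool ((u, v) \<in> arc ` {..<0}))"
      using rest assms(2) by (auto simp: matrix_def)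
  next
    fix i \<nu>
    assume i: "i < m" and P: "(\<forall>a<matrix. \<nu> a = \<mu>2 a) \<and>
      (\<forall>u<n. \<forall>v<n. \<nu> (matrix + u * n + v) = of_bool ((u, v) \<in> arc ` {..<i}))"
    have low: "\<nu> a = \<mu> a" if "a < 2 * m" for a using P rest that by (simp add: matrix_def)
    have "loaded \<nu>" using assms(1) low by (auto simp: loaded_def)
    note th = ev_tail_head[OF this _ i]
    obtain x y where xy: "arc i = (x, y)" "x < n" "y < n" using arc_range[OF i] by (cases "arc i") auto
    have "\<nu> (2 * m + 2 + x) = matrix + x * n" using P row[of x] xy by (simp add: matrix_def)
    then have s: "sem (Write (Plus (Read (Plus row_exp (tail_exp r 2))) (head_exp r 2)) (Num 1))
        ([n, m] @ [i]) \<nu> = \<nu>(matrix + x * n + y := 1)"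
      using th[of "[n, m, i]" 2] xy by (simp add: mult_2)
    show "(\<forall>a<matrix. sem (Write (Plus (Read (Plus row_exp (tail_exp r 2))) (head_exp r 2)) (Num 1))
        ([n, m] @ [i]) \<nu> a = \<mu>2 a) \<and>
      (\<forall>u<n. \<forall>v<n. sem (Write (Plus (Read (Plus row_exp (tail_exp r 2))) (head_exp r 2)) (Num 1))
        ([n, m] @ [i]) \<nu> (matrix + u * n + v) = of_bool ((u, v) \<in> arc ` {..<Suc i}))"
      unfolding s using P xy matrix_cell_inj by (auto simp: lessThan_Suc add.assoc)
  qed
  moreover have "sem (setup_stmt r) [n, m] \<mu> = \<mu>3"
    unfolding setup_stmt_def \<mu>3_def \<mu>2_def \<mu>1_def sem.simps
    by (simp add: matrix_def mult_2 numeral_3_eq_3)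
  moreover have "loaded \<mu>3" using assms(1) rest calculation(1) by (auto simp: loaded_def matrix_def)
  ultimately show ?thesis
    using row rest assms(2) by (simp add: ready_def E_def matrix_def)
qed

section \<open>Evaluation of the tests on a guessed copy\<close>

definition holds_copy :: "nat \<Rightarrow> (nat \<Rightarrow> nat) \<Rightarrow> nat list \<Rightarrow> bool" where
  "holds_copy N f vs \<longleftrightarrow> (\<forall>j<N. pos N j < length vs \<and> vs ! pos N j = f j \<and> f j < n)"

lemma holds_copy_append [simp]: "holds_copy N f vs \<Longrightarrow> holds_copy N f (vs @ ws)"
  by (auto simp: holds_copy_def nth_append)

lemma holds_copyD: "holds_copy N f vs \<Longrightarrow> j < N \<Longrightarrow> vs ! pos N j = f j \<and> f j < n"
  by (simp add: holds_copy_def)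

lemma free_tests_iff:
  assumes "ready \<mu>" "base vs" "holds_copy N f vs" "ev v vs \<mu> = x" "x < n"
  shows "(\<forall>(b, e)\<in>set (free_tests N v). (ev e vs \<mu> = 0) = b) \<longleftrightarrow> free_vertex E N f x"
  using assms holds_copyD[OF assms(3)] ev_adj_exp[OF assms(1,2)]
  by (simp add: free_tests_def free_vertex_def ball_Un) auto

lemma copy_tests_iff:
  assumes "ready \<mu>" "base vs" "holds_copy N f vs"
  shows "(\<forall>(b, e)\<in>set (copy_tests N A). (ev e vs \<mu> = 0) = b) \<longleftrightarrow> partial_copy E N A f"
proof -
  have inj: "inj_on f {..<N} \<longleftrightarrow> (\<forall>i<N. \<forall>j<i. f i \<noteq> f j)"
  proof
    assume "inj_on f {..<N}"
    then show "\<forall>i<N. \<forall>j<i. f i \<noteq> f j"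
      by (metis inj_on_def lessThan_iff less_trans less_irrefl)
  next
    assume *: "\<forall>i<N. \<forall>j<i. f i \<noteq> f j"
    show "inj_on f {..<N}"
    proof (rule inj_onI)
      fix i j
      assume "i \<in> {..<N}" "j \<in> {..<N}" "f i = f j"
      with *[rule_format, of i j] *[rule_format, of j i] show "i = j"
        by (cases i j rule: linorder_cases) auto
    qed
  qed
  have ev_dist: "ev (dist_exp (Var (pos N i)) (Var (pos N j))) vs \<mu> = 0 \<longleftrightarrow> f i = f j"
    and ev_adj: "ev (adj_exp (Var (pos N i)) (Var (pos N j))) vs \<mu> = 0 \<longleftrightarrow> (f i, f j) \<notin> E"
    if "i < N" "j < N" for i j
    using holds_copyD[OF assms(3)] ev_adj_exp[OF assms(1,2)] that by auto
  have mem: "(b, e) \<in> set (copy_tests N A) \<longleftrightarrow>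
      (\<exists>i<N. \<exists>j<i. b = False \<and> e = dist_exp (Var (pos N i)) (Var (pos N j))) \<or>
      (\<exists>i<N. \<exists>j<N. (i, j) \<noteq> (N - 2, N - 3) \<and> b = (\<not> A i j) \<and>
         e = adj_exp (Var (pos N i)) (Var (pos N j)))" for b e
    by (fastforce simp: copy_tests_def)
  show ?thesis
    unfolding partial_copy_def inj
  proof (rule iffI, intro conjI allI impI)
    fix i j
    assume *: "\<forall>(b, e)\<in>set (copy_tests N A). (ev e vs \<mu> = 0) = b" and ij: "i < N" "j < i"
    have "(False, dist_exp (Var (pos N i)) (Var (pos N j))) \<in> set (copy_tests N A)"
      unfolding mem using ij by (intro disjI1 exI[of _ i] conjI exI[of _ j]) auto
    from bspec[OF * this] have "ev (dist_exp (Var (pos N i)) (Var (pos N j))) vs \<mu> \<noteq> 0"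
      unfolding prod.case by (rule iffD1[OF eq_False])
    with ev_dist[of i j] ij show "f i \<noteq> f j" by simp
  next
    fix i j
    assume *: "\<forall>(b, e)\<in>set (copy_tests N A). (ev e vs \<mu> = 0) = b"
      and ij: "i < N" "j < N" "(i, j) \<noteq> (N - 2, N - 3)"
    have "(\<not> A i j, adj_exp (Var (pos N i)) (Var (pos N j))) \<in> set (copy_tests N A)"
      unfolding mem using ij by (intro disjI2 exI[of _ i] conjI exI[of _ j]) auto
    from bspec[OF * this] have "ev (adj_exp (Var (pos N i)) (Var (pos N j))) vs \<mu> = 0 \<longleftrightarrow> \<not> A i j"
      unfolding prod.case .
    with ev_adj[OF ij(1,2)] show "(f i, f j) \<in> E \<longleftrightarrow> A i j" by simp
  next
    assume *: "(\<forall>i<N. \<forall>j<i. f i \<noteq> f j) \<and>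
      (\<forall>i<N. \<forall>j<N. (i, j) \<noteq> (N - 2, N - 3) \<longrightarrow> ((f i, f j) \<in> E) = A i j)"
    show "\<forall>(b, e)\<in>set (copy_tests N A). (ev e vs \<mu> = 0) = b"
    proof (rule ballI)
      fix t
      assume t: "t \<in> set (copy_tests N A)"
      obtain b e where be: "t = (b, e)" by (cases t)
      consider (dist) i j where "i < N" "j < i" "b = False"
          "e = dist_exp (Var (pos N i)) (Var (pos N j))"
        | (adj) i j where "i < N" "j < N" "(i, j) \<noteq> (N - 2, N - 3)" "b = (\<not> A i j)"
          "e = adj_exp (Var (pos N i)) (Var (pos N j))"
        using t unfolding be mem by (elim disjE exE conjE) metis+
      then have "(ev e vs \<mu> = 0) = b"
      proof cases
        case (dist i j)
        then have "f i \<noteq> f j" using * by blast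
        with dist ev_dist[of i j] show ?thesis by simp
      next
        case (adj i j)
        then have "(f i, f j) \<in> E \<longleftrightarrow> A i j" using * by blast
        with adj ev_adj[of i j] show ?thesis by simp
      qed
      then show "case t of (b, e) \<Rightarrow> (ev e vs \<mu> = 0) = b" by (simp add: be)
    qed
  qed
qed

section \<open>The search for a path from \<open>t\<close> to \<open>y\<close>\<close>

lemma sem_scan_stmt:
  assumes "base vs" "length vs = d"
  shows "\<exists>x. sem (scan_stmt d) vs \<mu> = \<mu>(Suc (2 * m) := x) \<and>
    (x < n \<and> \<mu> (states + x) = 1 \<or> x = \<mu> (Suc (2 * m)) \<and> (\<forall>v<n. \<mu> (states + v) \<noteq> 1))"
proof -
  have b: "vs ! 0 = n" "(vs @ [v]) ! 1 = m" "(vs @ [v]) ! 2 = states" "(vs @ [v]) ! d = v" for v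
    using assms by (auto simp: base_def nth_append)
  have ne: "states + v \<noteq> Suc (2 * m)" for v by (simp add: states_def matrix_def)
  let ?inv = "\<lambda>i \<nu>. \<exists>x. \<nu> = \<mu>(Suc (2 * m) := x) \<and>
    (x < n \<and> \<mu> (states + x) = 1 \<or> x = \<mu> (Suc (2 * m)) \<and> (\<forall>v<i. \<mu> (states + v) \<noteq> 1))"
  let ?s = "guards [(True, dist_exp (Read (Plus (Var 2) (Var d))) (Num 1))] (Write tmp_exp (Var d))"
  show ?thesis
    unfolding scan_stmt_def sem.simps b(1)
  proof (rule fold_upt_invariant[where P = ?inv])
    show "?inv 0 \<mu>"
      by (rule exI[of _ "\<mu> (Suc (2 * m))"]) simp
  next
    fix i \<nu>
    assume i: "i < n" and "?inv i \<nu>"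
    then obtain x where x: "\<nu> = \<mu>(Suc (2 * m) := x)"
      "x < n \<and> \<mu> (states + x) = 1 \<or> x = \<mu> (Suc (2 * m)) \<and> (\<forall>v<i. \<mu> (states + v) \<noteq> 1)" by blast
    have "sem ?s (vs @ [i]) \<nu> = (if \<mu> (states + i) = 1 then \<mu>(Suc (2 * m) := i) else \<nu>)"
      using b ne x(1) by (simp add: mult_2)
    with x i show "?inv (Suc i) (sem ?s (vs @ [i]) \<nu>)"
      by (auto simp: less_Suc_eq)
  qed
qed

lemma sem_expand_stmt:
  assumes "base vs" "length vs = d" "ready \<mu>" "holds_copy N f vs" "u < d" "vs ! u = w" "w < n"
  shows "(\<forall>a<states. sem (expand_stmt N u d) vs \<mu> a = \<mu> a) \<and>
    (\<forall>v<n. sem (expand_stmt N u d) vs \<mu> (states + v) =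
      (if \<mu> (states + v) = 0 \<and> (w, v) \<in> E \<and> free_vertex E N f v then 1 else \<mu> (states + v)))"
proof -
  let ?g = "\<lambda>v. (w, v) \<in> E \<and> free_vertex E N f v"
  have b: "vs ! 0 = n" "(vs @ [v]) ! 2 = states" "(vs @ [v]) ! d = v" "(vs @ [v]) ! u = w" for v
    using assms by (auto simp: base_def nth_append)
  let ?inv = "\<lambda>i \<nu>. (\<forall>a<states. \<nu> a = \<mu> a) \<and>
    (\<forall>v. v < n \<longrightarrow> \<nu> (states + v) =
      (if v < i \<and> \<mu> (states + v) = 0 \<and> ?g v then 1 else \<mu> (states + v)))"
  let ?s = "guards ([(False, adj_exp (Var u) (Var d)), (True, Read (Plus (Var 2) (Var d)))] @
         free_tests N (Var d)) (Write (Plus (Var 2) (Var d)) (Num 1))"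
  have "?inv n (sem (expand_stmt N u d) vs \<mu>)"
    unfolding expand_stmt_def sem.simps(6) b(1)
  proof (rule fold_upt_invariant[where P = ?inv])
    fix i \<nu>
    assume i: "i < n" and P: "?inv i \<nu>"
    have r: "ready \<nu>" using P by (intro ready_cong[OF assms(3)]) auto
    have bs: "base (vs @ [i])" "holds_copy N f (vs @ [i])" using assms by auto
    have "ev (adj_exp (Var u) (Var d)) (vs @ [i]) \<nu> = of_bool ((w, i) \<in> E)"
      using ev_adj_exp[OF r bs(1), of "Var u" "Var d"] b assms(7) i by simp
    moreover have "(\<forall>(b, e)\<in>set (free_tests N (Var d)). (ev e (vs @ [i]) \<nu> = 0) = b) \<longleftrightarrow>
        free_vertex E N f i"
      by (rule free_tests_iff[OF r bs]) (use b i in auto)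
    ultimately have "sem ?s (vs @ [i]) \<nu> = (if ?g i \<and> \<mu> (states + i) = 0 then \<nu>(states + i := 1) else \<nu>)"
      unfolding sem_guards using b P i by (simp add: ball_Un)
    with P i show "?inv (Suc i) (sem ?s (vs @ [i]) \<nu>)"
      by (auto simp: less_Suc_eq)
  qed auto
  then show ?thesis by simp
qed

text \<open>Soundness and closure of a graph search, with \<open>fl\<close> the flag left by earlier
  guesses. The last conjunct measures progress: every round processes a new vertex unless none is
  pending, so after \<open>n\<close> rounds none can be pending.\<close>

definition reach_inv :: "nat \<Rightarrow> (nat \<Rightarrow> nat) \<Rightarrow> bool \<Rightarrow> nat \<Rightarrow> (nat \<Rightarrow> nat) \<Rightarrow> bool" where
  "reach_inv N f fl i \<mu> \<longleftrightarrow> ready \<mu> \<and> (\<forall>v<n. \<mu> (states + v) \<le> 2) \<and> \<mu> (states + f (N - 2)) \<noteq> 0 \<and>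
    (\<forall>v<n. \<mu> (states + v) \<noteq> 0 \<longrightarrow> (f (N - 2), v) \<in> {(u, v) \<in> E. free_vertex E N f v}\<^sup>*) \<and>
    (\<forall>u<n. \<mu> (states + u) = 2 \<longrightarrow>
       (\<forall>v<n. (u, v) \<in> E \<and> free_vertex E N f v \<longrightarrow> \<mu> (states + v) \<noteq> 0)) \<and>
    \<mu> (2 * m) = of_bool (fl \<or> (\<exists>u<n. \<mu> (states + u) = 2 \<and> (u, f (N - 3)) \<in> E)) \<and>
    (i \<le> card {u. u < n \<and> \<mu> (states + u) = 2} \<or> (\<forall>v<n. \<mu> (states + v) \<noteq> 1))"

lemma reach_inv_process:
  assumes "base vs" "length vs = d" "holds_copy N f vs" "4 \<le> N" "reach_inv N f fl i \<mu>"
  shows "reach_inv N f fl (Suc i) (sem (process_stmt N d) vs \<mu>)"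
proof -
  have ne: "states + v \<noteq> Suc (2 * m)" "states + v \<noteq> 2 * m" for v by (auto simp: states_def matrix_def)
  have b: "vs ! 0 = n" "vs ! 1 = m" using assms by (auto simp: base_def)
  define \<mu>1 where "\<mu>1 = \<mu>(Suc (2 * m) := n)"
  obtain x where x: "sem (scan_stmt d) vs \<mu>1 = \<mu>1(Suc (2 * m) := x)"
    "x < n \<and> \<mu>1 (states + x) = 1 \<or> x = \<mu>1 (Suc (2 * m)) \<and> (\<forall>v<n. \<mu>1 (states + v) \<noteq> 1)"
    using sem_scan_stmt[OF assms(1,2)] by blast
  define \<mu>2 where "\<mu>2 = \<mu>(Suc (2 * m) := x)"
  have inv: "reach_inv N f fl i \<mu>2"
    using assms(5) ne unfolding reach_inv_def \<mu>2_def by (simp add: ready_upd)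
  have st: "\<mu>2 (states + v) = \<mu> (states + v)" for v using ne by (simp add: \<mu>2_def)
  let ?vs = "vs @ [x]"
  define R where "R = guards [(False, Minus (Var 0) (Var d))]
       (Then (Write (Plus (Var 2) (Var d)) (Num 2))
       (Then (guards [(False, adj_exp (Var d) (Var (pos N (N - 3))))] (Write flag_exp (Num 1)))
         (expand_stmt N d (Suc d))))"
  have s: "sem (process_stmt N d) vs \<mu> = sem R ?vs \<mu>2"
    using x(1) b unfolding process_stmt_def R_def[symmetric] by (simp add: \<mu>1_def \<mu>2_def mult_2)
  show ?thesis
  proof (cases "x < n")
    \<comment> \<open>Here \<open>x\<close> is the sentinel \<open>n\<close>: nothing is pending,
      and the round changes only the temporary.\<close>
    case False
    then have "\<forall>v<n. \<mu>2 (states + v) \<noteq> 1" using x(2) st ne by (simp add: \<mu>1_def)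
    moreover have "sem R ?vs \<mu>2 = \<mu>2"
      using False b assms(2) by (simp add: R_def sem_guards base_def nth_append)
    ultimately show ?thesis using inv unfolding s by (simp add: reach_inv_def)
  next
    case True
    then have x1: "\<mu>2 (states + x) = 1" using x(2) st ne by (auto simp: \<mu>1_def)
    define \<mu>3 where "\<mu>3 = \<mu>2(states + x := 2)"
    have r3: "ready \<mu>3" using inv by (simp add: \<mu>3_def reach_inv_def ready_upd)
    have bs: "base ?vs" "holds_copy N f ?vs" "length ?vs = Suc d" "?vs ! 0 = n" "?vs ! 1 = m"
      "?vs ! 2 = states" "?vs ! d = x"
      using assms by (auto simp: base_def nth_append)
    define y where "y = f (N - 3)"
    have y: "?vs ! pos N (N - 3) = y" "y < n" using holds_copyD[OF bs(2), of "N - 3"] assms(4) by (auto simp: y_def)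
    define \<mu>4 where "\<mu>4 = (if (x, y) \<in> E then \<mu>3(2 * m := 1) else \<mu>3)"
    have r4: "ready \<mu>4" using r3 by (simp add: \<mu>4_def ready_upd)
    have adj: "ev (adj_exp (Var d) (Var (pos N (N - 3)))) ?vs \<mu>3 = of_bool ((x, y) \<in> E)"
      using ev_adj_exp[OF r3 bs(1), of "Var d" "Var (pos N (N - 3))"] bs(7) y True by simp
    define \<mu>5 where "\<mu>5 = sem (expand_stmt N d (Suc d)) ?vs \<mu>4"
    have ex: "\<forall>a<states. \<mu>5 a = \<mu>4 a" "\<And>v. v < n \<Longrightarrow> \<mu>5 (states + v) =
      (if \<mu>4 (states + v) = 0 \<and> (x, v) \<in> E \<and> free_vertex E N f v then 1 else \<mu>4 (states + v))"
      using sem_expand_stmt[OF bs(1,3) r4 bs(2) _ bs(7) True] unfolding \<mu>5_def by auto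
    have s5: "sem R ?vs \<mu>2 = \<mu>5"
      using True bs adj unfolding R_def sem_guards
      by (simp add: sem_guards \<mu>3_def[symmetric] mult_2) (simp add: \<mu>5_def \<mu>4_def mult_2)
    have st4: "\<mu>4 (states + v) = (if v = x then 2 else \<mu>2 (states + v))" for v
      using ne by (simp add: \<mu>4_def \<mu>3_def)
    have st5: "\<mu>5 (states + v) = (if v = x then 2 else if \<mu>2 (states + v) = 0 \<and> (x, v) \<in> E \<and>
        free_vertex E N f v then 1 else \<mu>2 (states + v))" if "v < n" for v
      using ex(2)[OF that] unfolding st4 by auto
    have two: "\<mu>5 (states + v) = 2 \<longleftrightarrow> v = x \<or> \<mu>2 (states + v) = 2" if "v < n" for v
      using st5[OF that] by auto
    have zero: "\<mu>5 (states + v) \<noteq> 0 \<longleftrightarrow> v = x \<or> \<mu>2 (states + v) \<noteq> 0 \<or> (x, v) \<in> E \<and> free_vertex E N f v"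
      if "v < n" for v
      using st5[OF that] by auto
    let ?Q = "{(u, v) \<in> E. free_vertex E N f v}"
    have reach: "\<And>v. v < n \<Longrightarrow> \<mu>2 (states + v) \<noteq> 0 \<Longrightarrow> (f (N - 2), v) \<in> ?Q\<^sup>*"
      using inv by (simp add: reach_inv_def)
    have "ready \<mu>5" using ready_cong[OF r4] ex(1) by blast
    moreover have "\<forall>v<n. \<mu>5 (states + v) \<le> 2" using st5 inv by (simp add: reach_inv_def)
    moreover have "\<mu>5 (states + f (N - 2)) \<noteq> 0"
      using zero[of "f (N - 2)"] inv holds_copyD[OF bs(2), of "N - 2"] assms(4)
      by (simp add: reach_inv_def)
    moreover have "\<forall>v<n. \<mu>5 (states + v) \<noteq> 0 \<longrightarrow> (f (N - 2), v) \<in> ?Q\<^sup>*"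
    proof (intro allI impI)
      fix v
      assume "v < n" "\<mu>5 (states + v) \<noteq> 0"
      then consider "v = x" | "\<mu>2 (states + v) \<noteq> 0" | "(x, v) \<in> ?Q" using zero by auto
      then show "(f (N - 2), v) \<in> ?Q\<^sup>*"
      proof cases
        case 1
        with reach[OF True] x1 show ?thesis by simp
      next
        case 2
        with reach \<open>v < n\<close> show ?thesis by simp
      next
        case 3
        with reach[OF True] x1 show ?thesis by (simp add: rtrancl.rtrancl_into_rtrancl)
      qed
    qed
    moreover have "\<forall>u<n. \<mu>5 (states + u) = 2 \<longrightarrow>
       (\<forall>v<n. (u, v) \<in> E \<and> free_vertex E N f v \<longrightarrow> \<mu>5 (states + v) \<noteq> 0)"
      using two zero inv unfolding reach_inv_def by blast
    moreover have "\<mu>5 (2 * m) = of_bool (fl \<or> (\<exists>u<n. \<mu>5 (states + u) = 2 \<and> (u, f (N - 3)) \<in> E))"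
    proof -
      have "\<mu>5 (2 * m) = \<mu>4 (2 * m)" using ex(1) by (simp add: states_def matrix_def)
      also have "\<dots> = (if (x, y) \<in> E then 1 else \<mu>2 (2 * m))"
        using ne(2)[of x] by (auto simp: \<mu>4_def \<mu>3_def)
      also have "\<mu>2 (2 * m) = of_bool (fl \<or> (\<exists>u<n. \<mu>2 (states + u) = 2 \<and> (u, y) \<in> E))"
        using inv by (simp add: reach_inv_def y_def)
      also have "(if (x, y) \<in> E then 1 else of_bool (fl \<or> (\<exists>u<n. \<mu>2 (states + u) = 2 \<and> (u, y) \<in> E))) =
          of_bool (fl \<or> (\<exists>u<n. \<mu>5 (states + u) = 2 \<and> (u, y) \<in> E))"
        using two True by auto
      finally show ?thesis by (simp add: y_def)
    qed
    \<comment> \<open>\<open>x\<close> was in state 1, hence not yet counted among the processed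
      vertices.\<close>
    moreover have "Suc i \<le> card {u. u < n \<and> \<mu>5 (states + u) = 2} \<or> (\<forall>v<n. \<mu>5 (states + v) \<noteq> 1)"
    proof -
      have "{u. u < n \<and> \<mu>5 (states + u) = 2} = insert x {u. u < n \<and> \<mu>2 (states + u) = 2}"
        using two True by auto
      moreover have "i \<le> card {u. u < n \<and> \<mu>2 (states + u) = 2}"
        using inv x1 True by (auto simp: reach_inv_def)
      ultimately show ?thesis using x1 by simp
    qed
    ultimately show ?thesis unfolding s s5 reach_inv_def by (intro conjI)
  qed
qed

text \<open>The flag \<open>fl\<close> found on entry is arbitrary, so the results of successive
  guesses accumulate as a disjunction; loops around \<open>s\<close> then become existential
  quantifiers around \<open>\<phi>\<close>.\<close>

definition finds :: "stmt \<Rightarrow> nat list \<Rightarrow> bool \<Rightarrow> bool" where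
  "finds s vs \<phi> \<longleftrightarrow> (\<forall>\<mu> fl. ready \<mu> \<and> \<mu> (2 * m) = of_bool fl \<longrightarrow>
     ready (sem s vs \<mu>) \<and> sem s vs \<mu> (2 * m) = of_bool (fl \<or> \<phi>))"

lemma finds_reach_stmt:
  assumes "base vs" "length vs = d" "holds_copy N f vs" "4 \<le> N"
  shows "finds (reach_stmt N d) vs (linked E N f)"
  unfolding finds_def
proof (intro allI impI)
  fix \<mu> fl
  assume \<mu>: "ready \<mu> \<and> \<mu> (2 * m) = of_bool fl"
  let ?Q = "{(u, v) \<in> E. free_vertex E N f v}"
  have b: "vs ! 0 = n" "vs ! 2 = states" "(vs @ [v]) ! 2 = states" "(vs @ [v]) ! d = v" for v
    using assms by (auto simp: base_def nth_append)
  have t: "vs ! pos N (N - 2) = f (N - 2)" "f (N - 2) < n"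
    using holds_copyD[OF assms(3), of "N - 2"] assms(4) by auto
  define \<mu>1 where "\<mu>1 = fold (\<lambda>v. sem (Write (Plus (Var 2) (Var d)) (Num 0)) (vs @ [v])) [0..<n] \<mu>"
  have "(\<forall>a<states. \<mu>1 a = \<mu> a) \<and> (\<forall>v<n. \<mu>1 (states + v) = 0)"
    unfolding \<mu>1_def
    by (rule fold_upt_invariant[where P = "\<lambda>i \<nu>. (\<forall>a<states. \<nu> a = \<mu> a) \<and> (\<forall>v<i. \<nu> (states + v) = 0)"])
      (auto simp: b less_Suc_eq)
  then have \<mu>1: "\<And>a. a < states \<Longrightarrow> \<mu>1 a = \<mu> a" "\<And>v. v < n \<Longrightarrow> \<mu>1 (states + v) = 0" by auto
  define \<mu>2 where "\<mu>2 = \<mu>1(states + f (N - 2) := 1)"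
  have st2: "\<And>v. v < n \<Longrightarrow> \<mu>2 (states + v) = of_bool (v = f (N - 2))" using \<mu>1 by (simp add: \<mu>2_def)
  have "ready \<mu>1" using \<mu> \<mu>1 ready_cong by blast
  then have "ready \<mu>2" by (simp add: \<mu>2_def ready_upd)
  moreover have "\<mu>2 (2 * m) = of_bool fl" using \<mu> \<mu>1(1)[of "2 * m"] by (simp add: \<mu>2_def states_def matrix_def)
  moreover have "\<mu>2 (states + v) \<noteq> 2" if "v < n" for v using st2[OF that] by simp
  ultimately have inv0: "reach_inv N f fl 0 \<mu>2" using st2 t(2) by (auto simp: reach_inv_def)
  define \<mu>3 where "\<mu>3 = fold (\<lambda>v. sem (process_stmt N (Suc d)) (vs @ [v])) [0..<n] \<mu>2"
  have inv: "reach_inv N f fl n \<mu>3"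
    unfolding \<mu>3_def
  proof (rule fold_upt_invariant[where P = "reach_inv N f fl", OF inv0])
    fix i \<nu>
    assume "reach_inv N f fl i \<nu>"
    then show "reach_inv N f fl (Suc i) (sem (process_stmt N (Suc d)) (vs @ [i]) \<nu>)"
      using assms by (intro reach_inv_process) auto
  qed
  have s: "sem (reach_stmt N d) vs \<mu> = \<mu>3"
    unfolding reach_stmt_def \<mu>3_def \<mu>2_def \<mu>1_def using b t by simp
  \<comment> \<open>Either all \<open>n\<close> vertices are processed and none is in state 1, or
    the progress conjunct of the invariant says directly that none is.\<close>
  have no1: "\<mu>3 (states + v) \<noteq> 1" if "v < n" for v
  proof (cases "n \<le> card {u. u < n \<and> \<mu>3 (states + u) = 2}")
    case True
    then have "{u. u < n \<and> \<mu>3 (states + u) = 2} = {..<n}" by (intro card_seteq) auto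
    with that have "\<mu>3 (states + v) = 2" by blast
    then show ?thesis by simp
  next
    case False
    with inv that show ?thesis by (simp add: reach_inv_def)
  qed
  \<comment> \<open>With nothing pending, every seen vertex is processed, so state 2 propagates
    along the relation.\<close>
  have seen: "\<mu>3 (states + u) = 2" if "(f (N - 2), u) \<in> ?Q\<^sup>*" for u
    using that
  proof (induction rule: rtrancl_induct)
    case base
    have "\<mu>3 (states + f (N - 2)) \<le> 2" "\<mu>3 (states + f (N - 2)) \<noteq> 0" using inv t(2) by (auto simp: reach_inv_def)
    with no1[OF t(2)] show ?case by linarith
  next
    case (step u v)
    then have uv: "u < n" "v < n" using E_range by auto
    then have "\<mu>3 (states + v) \<le> 2" "\<mu>3 (states + v) \<noteq> 0" using inv step by (auto simp: reach_inv_def)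
    with no1[OF uv(2)] show ?case by linarith
  qed
  have linked: "(\<exists>u<n. \<mu>3 (states + u) = 2 \<and> (u, f (N - 3)) \<in> E) \<longleftrightarrow> linked E N f"
  proof
    assume "\<exists>u<n. \<mu>3 (states + u) = 2 \<and> (u, f (N - 3)) \<in> E"
    then obtain u where u: "u < n" "\<mu>3 (states + u) = 2" "(u, f (N - 3)) \<in> E" by blast
    then have "\<mu>3 (states + u) \<noteq> 0" by simp
    then have "(f (N - 2), u) \<in> ?Q\<^sup>*" using inv u(1) by (simp add: reach_inv_def)
    with u(3) show "linked E N f" unfolding linked_def by blast
  next
    assume "linked E N f"
    then obtain u where "(f (N - 2), u) \<in> ?Q\<^sup>*" "(u, f (N - 3)) \<in> E" unfolding linked_def by blast
    with seen E_range show "\<exists>u<n. \<mu>3 (states + u) = 2 \<and> (u, f (N - 3)) \<in> E" by blast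
  qed
  have "ready \<mu>3" "\<mu>3 (2 * m) = of_bool (fl \<or> (\<exists>u<n. \<mu>3 (states + u) = 2 \<and> (u, f (N - 3)) \<in> E))"
    using inv unfolding reach_inv_def by blast+
  then show "ready (sem (reach_stmt N d) vs \<mu>) \<and>
      sem (reach_stmt N d) vs \<mu> (2 * m) = of_bool (fl \<or> linked E N f)"
    unfolding s linked by (rule conjI)
qed

section \<open>Loops over guesses as existential quantifiers\<close>

lemma finds_For:
  assumes "vs ! p = k" "\<And>v. v < k \<Longrightarrow> finds s (vs @ [v]) (\<phi> v)"
  shows "finds (For p s) vs (\<exists>v<k. \<phi> v)"
  unfolding finds_def sem.simps assms(1)
proof (intro allI impI)
  fix \<mu> fl
  assume \<mu>: "ready \<mu> \<and> \<mu> (2 * m) = of_bool fl"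
  show "ready (fold (\<lambda>v. sem s (vs @ [v])) [0..<k] \<mu>) \<and>
      fold (\<lambda>v. sem s (vs @ [v])) [0..<k] \<mu> (2 * m) = of_bool (fl \<or> (\<exists>v<k. \<phi> v))"
  proof (rule fold_upt_invariant[where P = "\<lambda>i \<nu>. ready \<nu> \<and> \<nu> (2 * m) = of_bool (fl \<or> (\<exists>v<i. \<phi> v))"])
    fix i \<nu>
    assume i: "i < k" and \<nu>: "ready \<nu> \<and> \<nu> (2 * m) = of_bool (fl \<or> (\<exists>v<i. \<phi> v))"
    have "(fl \<or> (\<exists>v<i. \<phi> v)) \<or> \<phi> i \<longleftrightarrow> fl \<or> (\<exists>v<Suc i. \<phi> v)" by (auto simp: less_Suc_eq)
    moreover have "ready (sem s (vs @ [i]) \<nu>) \<and>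
        sem s (vs @ [i]) \<nu> (2 * m) = of_bool ((fl \<or> (\<exists>v<i. \<phi> v)) \<or> \<phi> i)"
      using assms(2)[OF i, unfolded finds_def, rule_format, OF \<nu>] .
    ultimately show "ready (sem s (vs @ [i]) \<nu>) \<and>
        sem s (vs @ [i]) \<nu> (2 * m) = of_bool (fl \<or> (\<exists>v<Suc i. \<phi> v))" by (simp only:)
  qed (use \<mu> in auto)
qed

lemma finds_For_vertices:
  assumes "base vs"
    and "\<And>ws. length ws = k \<Longrightarrow> set ws \<subseteq> {..<n} \<Longrightarrow> finds s (vs @ ws) (\<phi> ws)"
  shows "finds ((For 0 ^^ k) s) vs (\<exists>ws. length ws = k \<and> set ws \<subseteq> {..<n} \<and> \<phi> ws)"
  using assms
proof (induction k arbitrary: vs \<phi>)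
  case 0
  then show ?case using "0.prems"(2)[of "[]"] by simp
next
  case (Suc k)
  have "finds ((For 0 ^^ k) s) (vs @ [v])
      (\<exists>ws. length ws = k \<and> set ws \<subseteq> {..<n} \<and> \<phi> (v # ws))" if "v < n" for v
    using Suc.prems that by (intro Suc.IH) auto
  then have "finds (For 0 ((For 0 ^^ k) s)) vs
      (\<exists>v<n. \<exists>ws. length ws = k \<and> set ws \<subseteq> {..<n} \<and> \<phi> (v # ws))"
    using Suc.prems(1) by (intro finds_For) (auto simp: base_def)
  moreover have "(\<exists>v<n. \<exists>ws. length ws = k \<and> set ws \<subseteq> {..<n} \<and> \<phi> (v # ws)) \<longleftrightarrow>
      (\<exists>ws. length ws = Suc k \<and> set ws \<subseteq> {..<n} \<and> \<phi> ws)"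
  proof
    assume "\<exists>v<n. \<exists>ws. length ws = k \<and> set ws \<subseteq> {..<n} \<and> \<phi> (v # ws)"
    then obtain v ws where "v < n" "length ws = k" "set ws \<subseteq> {..<n}" "\<phi> (v # ws)" by blast
    then show "\<exists>ws. length ws = Suc k \<and> set ws \<subseteq> {..<n} \<and> \<phi> ws"
      by (intro exI[of _ "v # ws"]) simp
  next
    assume "\<exists>ws. length ws = Suc k \<and> set ws \<subseteq> {..<n} \<and> \<phi> ws"
    then obtain v ws where "length (v # ws) = Suc k" "set (v # ws) \<subseteq> {..<n}" "\<phi> (v # ws)"
      by (metis length_Suc_conv)
    then show "\<exists>v<n. \<exists>ws. length ws = k \<and> set ws \<subseteq> {..<n} \<and> \<phi> (v # ws)"
      by (intro exI[of _ v] conjI exI[of _ ws]) simp_all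
  qed
  ultimately show ?case by simp
qed

lemma finds_arc_loop:
  assumes "base vs" "length vs = d"
    and "\<And>k. k < m \<Longrightarrow> finds s (vs @ [k, fst (arc k), snd (arc k)]) (\<phi> k)"
  shows "finds (arc_loop r d s) vs (\<exists>k<m. \<phi> k)"
  unfolding arc_loop_def
proof (rule finds_For)
  show "vs ! 1 = m" using assms(1) by (simp add: base_def)
next
  fix k
  assume k: "k < m"
  have "sem (Bind (tail_exp r d) (Bind (head_exp r d) s)) (vs @ [k]) \<mu> =
      sem s (vs @ [k, fst (arc k), snd (arc k)]) \<mu>" if "ready \<mu>" for \<mu>
  proof -
    have l: "loaded \<mu>" using that by (simp add: ready_def)
    have "(vs @ [k]) ! d = k" "(vs @ [k, fst (arc k)]) ! d = k"
      using assms(2) by (auto simp: nth_append)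
    then show ?thesis using ev_tail_head[OF l _ k] by simp
  qed
  with assms(3)[OF k] show "finds (Bind (tail_exp r d) (Bind (head_exp r d) s)) (vs @ [k]) (\<phi> k)"
    by (simp add: finds_def)
qed

lemma finds_copy_tests:
  assumes "base vs" "holds_copy N f vs" "finds s vs \<phi>"
  shows "finds (guards (copy_tests N A) s) vs (partial_copy E N A f \<and> \<phi>)"
  unfolding finds_def
proof (intro allI impI)
  fix \<mu> fl
  assume \<mu>: "ready \<mu> \<and> \<mu> (2 * m) = of_bool fl"
  then have "(\<forall>(b, e)\<in>set (copy_tests N A). (ev e vs \<mu> = 0) = b) \<longleftrightarrow> partial_copy E N A f"
    by (intro copy_tests_iff assms(1,2)) simp
  with \<mu> assms(3) show "ready (sem (guards (copy_tests N A) s) vs \<mu>) \<and>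
      sem (guards (copy_tests N A) s) vs \<mu> (2 * m) = of_bool (fl \<or> partial_copy E N A f \<and> \<phi>)"
    unfolding sem_guards finds_def by simp
qed

lemma nth_pos:
  assumes "4 \<le> N" "length ws = N - 4" "j < N"
  shows "([n, m, states, k, x, y] @ ws @ [k', t, z]) ! pos N j =
    (if j = 0 then x else if j = 1 then y else if j < N - 2 then ws ! (j - 2)
     else if j = N - 2 then t else z)"
proof -
  consider "j = 0" | "j = 1" | "2 \<le> j" "j < N - 2" | "j = N - 2" | "j = N - 1" using assms by linarith
  then show ?thesis
  proof cases
    case 3
    then have "4 + j = length [n, m, states, k, x, y] + (j - 2)" by simp
    moreover have "j - 2 < length ws" using 3 assms by linarith
    ultimately show ?thesis unfolding pos_def using 3
      by (simp only: nth_append_length_plus if_True) (simp add: nth_append)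
  next
    case 4
    then have "pos N j = length ([n, m, states, k, x, y] @ ws) + 1"
      using assms by (simp add: pos_def)
    then have "([n, m, states, k, x, y] @ ws @ [k', t, z]) ! pos N j = [k', t, z] ! 1"
      by (metis append_assoc nth_append_length_plus)
    moreover have "j \<noteq> 0" "j \<noteq> 1" "\<not> j < N - 2" "j = N - 2" using 4 assms by linarith+
    ultimately show ?thesis by simp
  next
    case 5
    then have "pos N j = length ([n, m, states, k, x, y] @ ws) + 2"
      using assms by (simp add: pos_def)
    then have "([n, m, states, k, x, y] @ ws @ [k', t, z]) ! pos N j = [k', t, z] ! 2"
      by (metis append_assoc nth_append_length_plus)
    moreover have "j \<noteq> 0" "j \<noteq> 1" "\<not> j < N - 2" "j \<noteq> N - 2" using 5 assms by linarith+
    ultimately show ?thesis by simp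
  qed (use assms in \<open>auto simp: pos_def\<close>)
qed

lemma partial_copy_cong:
  assumes "\<And>i. i < N \<Longrightarrow> f i = g i"
  shows "partial_copy E N A f \<longleftrightarrow> partial_copy E N A g"
proof -
  have "inj_on f {..<N} \<longleftrightarrow> inj_on g {..<N}" using assms by (intro inj_on_cong) simp
  then show ?thesis unfolding partial_copy_def by (simp add: assms cong: conj_cong)
qed

lemma linked_cong:
  assumes "4 \<le> N" "\<And>i. i < N \<Longrightarrow> f i = g i"
  shows "linked E N f \<longleftrightarrow> linked E N g"
proof -
  have "free_vertex E N f v \<longleftrightarrow> free_vertex E N g v" for v
    unfolding free_vertex_def using assms(2) by auto
  moreover have "f (N - 2) = g (N - 2)" "f (N - 3) = g (N - 3)" using assms by auto
  ultimately show ?thesis by (simp add: linked_def)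
qed

text \<open>The two assumptions on \<open>A\<close> make \<open>(f 0, f 1)\<close> and
  \<open>(f (N - 2), f (N - 1))\<close> arcs for every partial copy, so looping over arcs misses
  none of them. Each arc loop replaces two vertex loops: a factor \<open>m\<close> instead of
  \<open>n ^ 2\<close>.\<close>

lemma finds_search_stmt:
  assumes "4 \<le> N" "A 0 1" "A (N - 2) (N - 1)"
  shows "finds (search_stmt r N A) [n, m, states]
    (\<exists>f. (\<forall>i<N. f i < n) \<and> partial_copy E N A f \<and> linked E N f)"
proof -
  define val where "val k ws k' j = ([n, m, states, k, fst (arc k), snd (arc k)] @ ws @
     [k', fst (arc k'), snd (arc k')]) ! pos N j" for k ws k' j
  have val: "val k ws k' j = (if j = 0 then fst (arc k) else if j = 1 then snd (arc k)
      else if j < N - 2 then ws ! (j - 2) else if j = N - 2 then fst (arc k') else snd (arc k'))"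
    if "length ws = N - 4" "j < N" for k ws k' j
    unfolding val_def by (rule nth_pos[OF assms(1) that])
  have val_less: "val k ws k' j < n"
    if "k < m" "k' < m" "length ws = N - 4" "set ws \<subseteq> {..<n}" "j < N" for k ws k' j
  proof -
    have "ws ! (j - 2) < n" if "2 \<le> j" "j < N - 2"
    proof -
      have "j - 2 < length ws" using that \<open>length ws = N - 4\<close> by linarith
      then show ?thesis using \<open>set ws \<subseteq> {..<n}\<close> nth_mem by blast
    qed
    with that arc_range show ?thesis by (auto simp: val)
  qed
  let ?\<phi> = "\<lambda>f. partial_copy E N A f \<and> linked E N f"
  have "finds (search_stmt r N A) [n, m, states]
    (\<exists>k<m. \<exists>ws. length ws = N - 4 \<and> set ws \<subseteq> {..<n} \<and> (\<exists>k'<m. ?\<phi> (val k ws k')))"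
    unfolding search_stmt_def
  proof (intro finds_arc_loop finds_For_vertices)
    fix k ws k'
    assume k: "k < m" "k' < m" and ws: "length ws = N - 4" "set ws \<subseteq> {..<n}"
    let ?vs = "(([n, m, states] @ [k, fst (arc k), snd (arc k)]) @ ws) @ [k', fst (arc k'), snd (arc k')]"
    have "base [n, m, states]" by (simp add: base_def)
    then have base: "base ?vs" by (simp only: base_append)
    have len: "length ?vs = N + 5" using assms(1) ws by simp
    have "val k ws k' j = ?vs ! pos N j" for j unfolding val_def by simp
    moreover have "pos N j < length ?vs" if "j < N" for j using that len by (simp add: pos_def)
    ultimately have copy: "holds_copy N (val k ws k') ?vs"
      using val_less[OF k ws] by (simp only: holds_copy_def) blast
    show "finds (guards (copy_tests N A) (reach_stmt N (N + 5))) ?vs (?\<phi> (val k ws k'))"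
      by (intro finds_copy_tests finds_reach_stmt base len copy assms(1))
  qed (use assms in \<open>auto simp: base_def\<close>)
  moreover have "(\<exists>k<m. \<exists>ws. length ws = N - 4 \<and> set ws \<subseteq> {..<n} \<and> (\<exists>k'<m. ?\<phi> (val k ws k'))) \<longleftrightarrow>
      (\<exists>f. (\<forall>i<N. f i < n) \<and> ?\<phi> f)"
  proof
    assume "\<exists>f. (\<forall>i<N. f i < n) \<and> ?\<phi> f"
    then obtain f where f: "\<forall>i<N. f i < n" "?\<phi> f" by blast
    have "(f 0, f 1) \<in> E" "(f (N - 2), f (N - 1)) \<in> E"
      using f(2) assms unfolding partial_copy_def by auto
    then obtain k k' where k: "k < m" "k' < m" "arc k = (f 0, f 1)" "arc k' = (f (N - 2), f (N - 1))"
      unfolding E_def by auto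
    define ws where "ws = map f [2..<N - 2]"
    have ws: "length ws = N - 4" "set ws \<subseteq> {..<n}" using f(1) by (auto simp: ws_def)
    have "val k ws k' j = f j" if "j < N" for j
    proof -
      have "j = N - 1" if "\<not> j < N - 2" "j \<noteq> N - 2" using that \<open>j < N\<close> by simp
      moreover have "2 + (j - 2) = j" if "j \<noteq> 0" "j \<noteq> 1" using that by linarith
      then have "ws ! (j - 2) = f j" if "j \<noteq> 0" "j \<noteq> 1" "j < N - 2"
        using that by (simp add: ws_def nth_upt del: add_2_eq_Suc add_2_eq_Suc')
      ultimately show ?thesis using k that ws(1) by (simp add: val)
    qed
    then have "?\<phi> (val k ws k')"
      using f(2) partial_copy_cong[of N "val k ws k'" f] linked_cong[OF assms(1), of "val k ws k'" f] by simp
    with k ws show "\<exists>k<m. \<exists>ws. length ws = N - 4 \<and> set ws \<subseteq> {..<n} \<and> (\<exists>k'<m. ?\<phi> (val k ws k'))"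
      by blast
  next
    assume "\<exists>k<m. \<exists>ws. length ws = N - 4 \<and> set ws \<subseteq> {..<n} \<and> (\<exists>k'<m. ?\<phi> (val k ws k'))"
    then obtain k ws k' where "k < m" "length ws = N - 4" "set ws \<subseteq> {..<n}" "k' < m"
      and \<phi>: "partial_copy E N A (val k ws k')" "linked E N (val k ws k')"
      by (elim exE conjE) (rule that)
    then have "\<forall>i<N. val k ws k' i < n" using val_less by simp
    with \<phi> show "\<exists>f. (\<forall>i<N. f i < n) \<and> ?\<phi> f" by (intro exI conjI)
  qed
  ultimately show ?thesis by simp
qed

theorem sem_main_stmt:
  assumes "4 \<le> N" "A 0 1" "A (N - 2) (N - 1)"
    and "loaded \<mu>" "\<And>a. 2 * m \<le> a \<Longrightarrow> \<mu> a = 0"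
  shows "sem (main_stmt r N A) [n, m] \<mu> (2 * m) =
    of_bool (\<exists>f. (\<forall>i<N. f i < n) \<and> partial_copy E N A f \<and> linked E N f)"
proof -
  define \<nu> where "\<nu> = sem (setup_stmt r) [n, m] \<mu>"
  have \<nu>: "ready \<nu>" "\<nu> (2 * m) = of_bool False" using ready_setup[OF assms(4,5)] by (auto simp: \<nu>_def)
  then have "\<nu> (2 * m + 2 + n) = states" by (simp add: ready_def states_def)
  then have "sem (main_stmt r N A) [n, m] \<mu> = sem (search_stmt r N A) [n, m, states] \<nu>"
    by (simp add: main_stmt_def \<nu>_def[symmetric] mult_2)
  moreover have "sem (search_stmt r N A) [n, m, states] \<nu> (2 * m) =
      of_bool (False \<or> (\<exists>f. (\<forall>i<N. f i < n) \<and> partial_copy E N A f \<and> linked E N f))"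
    using finds_search_stmt[OF assms(1-3), unfolded finds_def, rule_format, OF conjI[OF \<nu>]]
    by (rule conjunct2)
  ultimately show ?thesis by (simp only: simp_thms)
qed

end

section \<open>Scoping and running time of the whole algorithm\<close>

lemma wf_main_stmt: "4 \<le> N \<Longrightarrow> wf_stmt 2 (main_stmt r N A)"
proof -
  assume N: "4 \<le> N"
  have pos: "pos N j < N + 5" if "j < N" for j using that by (simp add: pos_def)
  have copy: "\<forall>(b, e)\<in>set (copy_tests N A). wf_exp (N + 5) e"
    using pos by (auto simp: copy_tests_def dist_exp_def adj_exp_def)
  have free: "\<forall>(b, e)\<in>set (free_tests N (Var d)). wf_exp (Suc d) e" if "N + 5 \<le> d" for d
    using pos that by (fastforce simp: free_tests_def dist_exp_def adj_exp_def)
  have "wf_stmt (N + 5) (reach_stmt N (N + 5))"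
    using pos[of "N - 3"] pos[of "N - 2"] N free[of "7 + N"]
    by (simp add: reach_stmt_def process_stmt_def scan_stmt_def expand_stmt_def wf_guards
        dist_exp_def adj_exp_def ball_Un)
  then have inner: "wf_stmt (N + 2) (arc_loop r (N + 2) (guards (copy_tests N A) (reach_stmt N (N + 5))))"
    using copy unfolding arc_loop_def wf_stmt.simps wf_guards
    by (simp add: tail_exp_def head_exp_def numeral_eq_Suc)
  have nest: "wf_stmt d ((For 0 ^^ k) s) \<longleftrightarrow> wf_stmt (d + k) s" for d k s
    by (induction k arbitrary: d) auto
  have "wf_stmt 6 ((For 0 ^^ (N - 4)) (arc_loop r (N + 2)
      (guards (copy_tests N A) (reach_stmt N (N + 5)))))"
    unfolding nest using inner N by (simp add: add.commute)
  then have search: "wf_stmt 3 (search_stmt r N A)"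
    unfolding search_stmt_def arc_loop_def[of r 3] wf_stmt.simps
    by (simp add: tail_exp_def head_exp_def)
  have "wf_stmt 2 (setup_stmt r)"
    by (simp add: setup_stmt_def tail_exp_def head_exp_def)
  with search show ?thesis unfolding main_stmt_def wf_stmt.simps by (simp add: numeral_eq_Suc)
qed

text \<open>The search contributes \<open>n ^ 2\<close>, the inner arc loop \<open>m\<close>, the
  vertex loops \<open>n ^ (N - 4)\<close> and the outer arc loop another \<open>m\<close>. The setup
  consists of one simple loop of each kind and is dominated.\<close>

lemma time_main_stmt:
  assumes "4 \<le> N"
  shows "time_bounded (main_stmt r N A) (N - 2) 2"
proof -
  note basic = time_bounded_Write time_bounded_Then time_bounded_guards time_bounded_Bind
  have For0: "time_bounded s a b \<Longrightarrow> a' = Suc a \<Longrightarrow> time_bounded (For 0 s) a' b"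
    and For1: "time_bounded s a b \<Longrightarrow> b' = Suc b \<Longrightarrow> time_bounded (For 1 s) a b'" for s a b a' b'
    by (rule time_bounded_For; simp)+
  have leaf: "time_bounded (For 0 (guards ts (Write x y))) 1 0" for ts x y
    by (rule For0[of _ 0]) (intro basic, simp)
  have wr: "time_bounded (guards ts (Write x y)) 1 0" for ts x y
    by (intro basic)
  have "time_bounded (process_stmt N d) 1 0" for d
    unfolding process_stmt_def scan_stmt_def expand_stmt_def by (intro leaf wr basic)
  then have process: "time_bounded (For 0 (process_stmt N d)) 2 0" for d
    by (intro For0[of _ 1]) simp_all
  have clear: "time_bounded (For 0 (Write x y)) 2 0" for x y
    by (rule For0[of _ 1]) (intro basic, simp)
  have reach: "time_bounded (reach_stmt N d) 2 0" for d
    unfolding reach_stmt_def by (intro basic process clear)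
  have inner: "time_bounded (arc_loop r (N + 2) (guards (copy_tests N A) (reach_stmt N (N + 5)))) 2 1"
    unfolding arc_loop_def by (rule For1[of _ _ 0]) (intro basic reach, simp)
  have "time_bounded s a b \<Longrightarrow> time_bounded ((For 0 ^^ k) s) (a + k) b" for s a b k
    by (induction k) (auto intro: For0)
  from this[OF inner, of "N - 4"]
  have "time_bounded ((For 0 ^^ (N - 4)) (arc_loop r (N + 2)
      (guards (copy_tests N A) (reach_stmt N (N + 5))))) (N - 2) 1"
    using assms by (simp add: numeral_eq_Suc Suc_diff_Suc)
  then have search: "time_bounded (search_stmt r N A) (N - 2) 2"
    unfolding search_stmt_def arc_loop_def[of r 3] by (intro For1[of _ _ 1] basic) simp_all
  have "time_bounded (For 0 (Write x y)) (N - 2) 2" for x y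
    by (rule For0[of _ "N - 3"]) (intro basic, use assms in simp)
  moreover have "time_bounded (For 1 (Write x y)) (N - 2) 2" for x y
    by (rule For1[of _ _ 1]) (intro basic, simp)
  ultimately have "time_bounded (setup_stmt r) (N - 2) 2"
    unfolding setup_stmt_def by (intro basic)
  with search show ?thesis unfolding main_stmt_def by (intro basic)
qed

section \<open>Induced subdivisions as triples of blocks\<close>

abbreviation walk_arcs :: "'a list \<Rightarrow> ('a \<times> 'a) set" where
  "walk_arcs p \<equiv> set (vwalk_arcs p)"

section \<open>Arc sets of vertex lists\<close>

lemma vwalk_arcsD: "(u, v) \<in> walk_arcs p \<Longrightarrow> u \<in> set p \<and> v \<in> set p"
  by (induction p rule: vwalk_arcs.induct) auto

lemma vwalk_arcs_join: "vwalk_arcs (p @ y # q) = vwalk_arcs (p @ [y]) @ vwalk_arcs (y # q)"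
proof (induction p)
  case (Cons x p)
  then show ?case by (cases p) auto
qed simp

lemma vwalk_arcs_butlast_join:
  assumes "p \<noteq> []" "q \<noteq> []" "last p = hd q"
  shows "walk_arcs (butlast p @ q) = walk_arcs p \<union> walk_arcs q"
proof -
  obtain y q' where q: "q = y # q'" using assms(2) by (cases q) auto
  have "butlast p @ [y] = p" using assms(1,3) q by (metis append_butlast_last_id list.sel(1))
  then show ?thesis using vwalk_arcs_join[of "butlast p" y q'] q by simp
qed

lemma set_vwalk_arcs_rev: "walk_arcs (rev p) = (walk_arcs p)\<inverse>"
proof (induction p rule: vwalk_arcs.induct)
  case (3 x y xs)
  have "vwalk_arcs (rev (x # y # xs)) = vwalk_arcs (rev xs @ [y]) @ [(y, x)]"
    using vwalk_arcs_join[of "rev xs" y "[x]"] by simp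
  with 3 show ?case by auto
qed auto

lemma vwalk_arcs_map: "vwalk_arcs (map g p) = map (map_prod g g) (vwalk_arcs p)"
  by (induction p rule: vwalk_arcs.induct) auto

lemma vwalk_arcs_neq: "distinct p \<Longrightarrow> (u, v) \<in> walk_arcs p \<Longrightarrow> u \<noteq> v"
  by (induction p rule: vwalk_arcs.induct) auto

text \<open>In a list without repetitions a vertex has at most one successor, and for a vertex of
  the suffix it lies in the suffix too.\<close>

lemma vwalk_arcs_suffix:
  assumes "distinct (p @ q)" "(u, v) \<in> walk_arcs (p @ q)" "u \<in> set q"
  shows "(u, v) \<in> walk_arcs q"
  using assms
proof (induction p)
  case (Cons x p)
  then show ?case by (cases "p @ q = []") auto
qed simp

lemma vwalk_arcs_prefix:
  assumes "distinct (p @ q)" "(u, v) \<in> walk_arcs (p @ q)" "v \<in> set p"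
  shows "(u, v) \<in> walk_arcs p"
proof -
  have "(v, u) \<in> walk_arcs (rev q @ rev p)"
    using assms(2) set_vwalk_arcs_rev[of "p @ q"] by auto
  then have "(v, u) \<in> walk_arcs (rev p)"
    by (rule vwalk_arcs_suffix[rotated]) (use assms(1,3) in auto)
  then show ?thesis by (simp add: set_vwalk_arcs_rev)
qed

text \<open>The second block is traversed against the order of \<open>P\<close>, so \<open>a\<close> and \<open>b\<close> are both directed
  paths, with a common end.\<close>

definition shape :: "'a list \<Rightarrow> 'a list \<Rightarrow> 'a \<Rightarrow> 'a set \<Rightarrow> ('a \<times> 'a) set \<Rightarrow> bool" where
  "shape a b z V E \<longleftrightarrow> a \<noteq> [] \<and> b \<noteq> [] \<and> last a = last b \<and> distinct (a @ butlast b @ [z]) \<and>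
     V = set a \<union> set b \<union> {z} \<and>
     E = walk_arcs a \<union> walk_arcs b \<union> {(hd b, z)}"

lemma set_butlast_last: "b \<noteq> [] \<Longrightarrow> set b = insert (last b) (set (butlast b))"
  by (metis append_butlast_last_id list.simps(15) rotate1.simps(2) set_rotate1)

lemma shape_distinct:
  assumes "shape a b z V E"
  shows "distinct a" "distinct b" "set a \<inter> set b = {last b}" "z \<notin> set a" "z \<notin> set b"
proof -
  have *: "set b = insert (last b) (set (butlast b))" "last b \<in> set a" "distinct (butlast b)"
    using assms set_butlast_last[of b] last_in_set[of a] by (auto simp: shape_def)
  show "distinct a" using assms by (simp add: shape_def)
  have "last b \<notin> set (butlast b)" using assms *(2) by (auto simp: shape_def)
  then have "distinct (butlast b @ [last b])" using *(3) by simp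
  then show "distinct b" using assms unfolding shape_def by (metis append_butlast_last_id)
  show "set a \<inter> set b = {last b}" "z \<notin> set a" "z \<notin> set b"
    using assms * by (auto simp: shape_def)
qed

lemma shape_wf: "shape a b z V E \<Longrightarrow> E \<subseteq> V \<times> V"
  by (auto simp: shape_def dest: vwalk_arcsD)

lemma shape_map:
  assumes "shape a b z V E" "inj_on g V"
  shows "shape (map g a) (map g b) (g z) (g ` V) (map_prod g g ` E)"
proof -
  have "set (a @ butlast b @ [z]) \<subseteq> V" using assms(1) by (auto simp: shape_def dest: in_set_butlastD)
  then have "inj_on g (set (a @ butlast b @ [z]))" using assms(2) inj_on_subset by blast
  moreover have "distinct (a @ butlast b @ [z])" using assms(1) by (simp add: shape_def)
  ultimately have "distinct (map g (a @ butlast b @ [z]))" by (simp only: distinct_map)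
  with assms(1) show ?thesis
    by (auto simp: shape_def vwalk_arcs_map map_butlast last_map hd_map image_Un simp del: distinct_append)
qed

section \<open>Subdivisions, induced embeddings and reversal\<close>

lemma is_subdivisionE:
  assumes "is_subdivision D S"
  obtains p where
    "\<And>a b. (a, b) \<in> parcs D \<Longrightarrow> set (p (a, b)) \<subseteq> pverts S \<and> distinct (p (a, b)) \<and>
        2 \<le> length (p (a, b)) \<and> hd (p (a, b)) = a \<and> last (p (a, b)) = b \<and>
        set (p (a, b)) \<inter> pverts D = {a, b}"
    "\<And>e f. e \<in> parcs D \<Longrightarrow> f \<in> parcs D \<Longrightarrow> e \<noteq> f \<Longrightarrow> set (p e) \<inter> set (p f) \<subseteq> pverts D"
    "pverts S = pverts D \<union> (\<Union>e\<in>parcs D. set (p e))"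
    "parcs S = (\<Union>e\<in>parcs D. walk_arcs (p e))"
proof -
  obtain p where p: "\<forall>(a, b)\<in>parcs D. vpath (p (a, b)) (with_proj S) \<and>
      1 \<le> vwalk_length (p (a, b)) \<and> hd (p (a, b)) = a \<and> last (p (a, b)) = b \<and>
      set (p (a, b)) \<inter> pverts D = {a, b}"
    "\<forall>e\<in>parcs D. \<forall>f\<in>parcs D. e \<noteq> f \<longrightarrow> set (p e) \<inter> set (p f) \<subseteq> pverts D"
    "pverts S = pverts D \<union> (\<Union>e\<in>parcs D. set (p e))"
    "parcs S = (\<Union>e\<in>parcs D. walk_arcs (p e))"
    using assms unfolding is_subdivision_def by (elim exE conjE) (rule that)
  show thesis
  proof (rule that[of p])
    fix a b
    assume "(a, b) \<in> parcs D"
    from bspec[OF p(1) this] show "set (p (a, b)) \<subseteq> pverts S \<and> distinct (p (a, b)) \<and>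
        2 \<le> length (p (a, b)) \<and> hd (p (a, b)) = a \<and> last (p (a, b)) = b \<and>
        set (p (a, b)) \<inter> pverts D = {a, b}"
      by (auto simp: vpath_def vwalk_def)
  next
    fix e f
    assume "e \<in> parcs D" "f \<in> parcs D" "e \<noteq> f"
    then show "set (p e) \<inter> set (p f) \<subseteq> pverts D" using p(2) by simp
  qed (fact p(3,4))+
qed

lemma is_subdivisionI:
  assumes "\<And>a b. (a, b) \<in> parcs D \<Longrightarrow> distinct (p (a, b)) \<and> 2 \<le> length (p (a, b)) \<and>
      hd (p (a, b)) = a \<and> last (p (a, b)) = b \<and> set (p (a, b)) \<inter> pverts D = {a, b}"
    and "\<And>e f. e \<in> parcs D \<Longrightarrow> f \<in> parcs D \<Longrightarrow> e \<noteq> f \<Longrightarrow> set (p e) \<inter> set (p f) \<subseteq> pverts D"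
    and "pverts S = pverts D \<union> (\<Union>e\<in>parcs D. set (p e))"
    and "parcs S = (\<Union>e\<in>parcs D. walk_arcs (p e))"
  shows "is_subdivision D S"
  unfolding is_subdivision_def
proof (intro exI[of _ p] conjI)
  show "\<forall>(a, b)\<in>parcs D. vpath (p (a, b)) (with_proj S) \<and>
      1 \<le> vwalk_length (p (a, b)) \<and> hd (p (a, b)) = a \<and> last (p (a, b)) = b \<and>
      set (p (a, b)) \<inter> pverts D = {a, b}"
  proof (rule ballI)
    fix e
    assume e: "e \<in> parcs D"
    obtain a b where ab: "e = (a, b)" by (cases e)
    have "set (p e) \<subseteq> pverts S" "walk_arcs (p e) \<subseteq> parcs S" using assms(3,4) e by auto
    moreover have "p (a, b) \<noteq> []" using assms(1)[of a b] e ab by auto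
    ultimately show "case e of (a, b) \<Rightarrow> vpath (p (a, b)) (with_proj S) \<and>
      1 \<le> vwalk_length (p (a, b)) \<and> hd (p (a, b)) = a \<and> last (p (a, b)) = b \<and>
      set (p (a, b)) \<inter> pverts D = {a, b}"
      using assms(1)[of a b] e by (auto simp: ab vpath_def vwalk_def)
  qed
qed (use assms(2-4) in simp_all)

lemma subdivision_wf:
  assumes "is_subdivision D S"
  shows "parcs S \<subseteq> pverts S \<times> pverts S"
proof
  fix x
  assume x: "x \<in> parcs S"
  obtain p where p: "pverts S = pverts D \<union> (\<Union>e\<in>parcs D. set (p e))"
    "parcs S = (\<Union>e\<in>parcs D. walk_arcs (p e))"
    using assms by (rule is_subdivisionE)
  obtain u v where uv: "x = (u, v)" by (cases x)
  obtain e where "e \<in> parcs D" "(u, v) \<in> walk_arcs (p e)" using x p(2) uv by blast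
  then show "x \<in> pverts S \<times> pverts S" using vwalk_arcsD[of u v "p e"] p(1) uv by blast
qed

text \<open>In a simple digraph the arc part of an isomorphism is forced by its vertex part. So an
  induced copy amounts to a vertex injection that preserves and reflects arcs, namely the inverse of
  the isomorphism onto \<open>S\<close>.\<close>

lemma contains_induced_subdivision_iff:
  assumes "pair_wf_digraph G"
  shows "contains_induced_subdivision D G \<longleftrightarrow>
    (\<exists>S g. is_subdivision D S \<and> inj_on g (pverts S) \<and> g ` pverts S \<subseteq> pverts G \<and>
       (\<forall>u\<in>pverts S. \<forall>v\<in>pverts S. (u, v) \<in> parcs S \<longleftrightarrow> (g u, g v) \<in> parcs G))"
proof
  assume "contains_induced_subdivision D G"
  then obtain H S where H: "induced_subgraph H (with_proj G)" and S: "is_subdivision D S"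
    and iso: "digraph_iso H (with_proj S)"
    unfolding contains_induced_subdivision_def by blast
  have H': "verts H \<subseteq> pverts G" "tail H = fst" "head H = snd"
      "arcs H = {e \<in> parcs G. fst e \<in> verts H \<and> snd e \<in> verts H}"
    using H by (auto simp: induced_subgraph_def subgraph_def compatible_def)
  obtain f where f: "pre_digraph.digraph_isomorphism H f" "with_proj S = app_iso f H"
    using iso by (auto simp: digraph_iso_def)
  let ?h = "iso_verts f"
  have inj: "inj_on ?h (verts H)" using f(1) by (simp add: pre_digraph.digraph_isomorphism_def)
  \<comment> \<open>\<open>with_proj S\<close> has the projections as tail and head maps, which pins
    down the corresponding fields of \<open>f\<close>.\<close>
  have tl: "iso_tail f = fst" "iso_head f = snd"
    using arg_cong[OF f(2), of tail] arg_cong[OF f(2), of head]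
    by (simp_all add: tail_app_iso head_app_iso)
  have "iso_arcs f e = (?h (fst e), ?h (snd e))" if "e \<in> arcs H" for e
  proof -
    have "?h (tail H e) = iso_tail f (iso_arcs f e)" "?h (head H e) = iso_head f (iso_arcs f e)"
      using f(1) that unfolding pre_digraph.digraph_isomorphism_def by blast+
    then show ?thesis by (simp add: tl H'(2,3) prod_eq_iff)
  qed
  then have arcsS: "parcs S = (\<lambda>e. (?h (fst e), ?h (snd e))) ` arcs H"
    using arg_cong[OF f(2), of arcs] by (simp add: arcs_app_iso)
  have vertsS: "pverts S = ?h ` verts H"
    using arg_cong[OF f(2), of verts] by (simp add: verts_app_iso)
  define g where "g = the_inv_into (verts H) ?h"
  have g: "g (?h x) = x" if "x \<in> verts H" for x
    using inj that by (simp add: g_def the_inv_into_f_f)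
  have "inj_on g (pverts S)" unfolding vertsS using g by (auto simp: inj_on_def)
  moreover have "g ` pverts S \<subseteq> pverts G" unfolding vertsS using g H'(1) by auto
  moreover have "(u, v) \<in> parcs S \<longleftrightarrow> (g u, g v) \<in> parcs G" if uv: "u \<in> pverts S" "v \<in> pverts S" for u v
  proof -
    obtain x y where xy: "u = ?h x" "v = ?h y" "x \<in> verts H" "y \<in> verts H"
      using uv unfolding vertsS by blast
    have "(u, v) \<in> parcs S \<longleftrightarrow> (x, y) \<in> arcs H"
    proof
      assume "(u, v) \<in> parcs S"
      then obtain e where e: "e \<in> arcs H" "?h (fst e) = ?h x" "?h (snd e) = ?h y"
        unfolding arcsS xy(1,2) by auto
      then have "fst e = x" "snd e = y" using inj_onD[OF inj] xy(3,4) H'(4) by auto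
      with e(1) show "(x, y) \<in> arcs H" by (metis prod.collapse)
    next
      assume "(x, y) \<in> arcs H"
      then show "(u, v) \<in> parcs S" unfolding arcsS xy(1,2) by (rule rev_image_eqI) simp
    qed
    then show ?thesis using xy g H'(4) by simp
  qed
  ultimately show "\<exists>S g. is_subdivision D S \<and> inj_on g (pverts S) \<and> g ` pverts S \<subseteq> pverts G \<and>
       (\<forall>u\<in>pverts S. \<forall>v\<in>pverts S. (u, v) \<in> parcs S \<longleftrightarrow> (g u, g v) \<in> parcs G)"
    using S by blast
next
  assume "\<exists>S g. is_subdivision D S \<and> inj_on g (pverts S) \<and> g ` pverts S \<subseteq> pverts G \<and>
       (\<forall>u\<in>pverts S. \<forall>v\<in>pverts S. (u, v) \<in> parcs S \<longleftrightarrow> (g u, g v) \<in> parcs G)"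
  then obtain S g where S: "is_subdivision D S" and inj: "inj_on g (pverts S)"
    and sub: "g ` pverts S \<subseteq> pverts G"
    and arcs: "\<forall>u\<in>pverts S. \<forall>v\<in>pverts S. (u, v) \<in> parcs S \<longleftrightarrow> (g u, g v) \<in> parcs G"
    by (elim exE conjE) (rule that)
  define U where "U = g ` pverts S"
  define H :: "(nat, nat \<times> nat) pre_digraph" where
    "H = \<lparr>verts = U, arcs = parcs G \<inter> U \<times> U, tail = fst, head = snd\<rparr>"
  define h where "h = the_inv_into (pverts S) g"
  have h: "h (g x) = x" if "x \<in> pverts S" for x
    using inj that by (simp add: h_def the_inv_into_f_f)
  have wfH: "wf_digraph H" by (auto simp: H_def wf_digraph_def)
  have "induced_subgraph H (with_proj G)"
    using assms wfH sub
    by (auto simp: induced_subgraph_def subgraph_def compatible_def H_def U_def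
        wf_digraph_def pair_wf_digraph_def)
  moreover have "digraph_iso H (with_proj S)"
  proof -
    define f :: "(nat, nat \<times> nat, nat, nat \<times> nat) digraph_isomorphism" where
      "f = \<lparr>iso_verts = h, iso_arcs = map_prod h h, iso_head = snd, iso_tail = fst\<rparr>"
    have injh: "inj_on h U" using h by (auto simp: U_def inj_on_def)
    then have "inj_on (map_prod h h) (arcs H)"
      using inj_on_subset[OF map_prod_inj_on[OF injh injh]] by (simp add: H_def)
    then have "pre_digraph.digraph_isomorphism H f"
      using wfH injh by (auto simp: pre_digraph.digraph_isomorphism_def f_def H_def)
    moreover have "map_prod h h ` (parcs G \<inter> U \<times> U) = parcs S"
    proof
      show "map_prod h h ` (parcs G \<inter> U \<times> U) \<subseteq> parcs S" using arcs h by (auto simp: U_def)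
      show "parcs S \<subseteq> map_prod h h ` (parcs G \<inter> U \<times> U)"
      proof
        fix e
        assume e: "e \<in> parcs S"
        obtain u v where uv: "e = (u, v)" "u \<in> pverts S" "v \<in> pverts S"
          using e subdivision_wf[OF S] by (cases e) auto
        then have "map_prod h h (g u, g v) = e" "(g u, g v) \<in> parcs G \<inter> U \<times> U"
          using e arcs h by (auto simp: U_def)
        then show "e \<in> map_prod h h ` (parcs G \<inter> U \<times> U)" by (metis image_eqI)
      qed
    qed
    then have "app_iso f H = with_proj S"
      using h by (auto simp: app_iso_def with_proj_def f_def H_def U_def image_image)
    ultimately show ?thesis unfolding digraph_iso_def by metis
  qed
  ultimately show "contains_induced_subdivision D G"
    unfolding contains_induced_subdivision_def using S by blast
qed

definition reversed :: "'a pair_pre_digraph \<Rightarrow> 'a pair_pre_digraph" where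
  "reversed G = \<lparr>pverts = pverts G, parcs = (parcs G)\<inverse>\<rparr>"

lemma reversed_simps [simp]:
  "pverts (reversed G) = pverts G" "parcs (reversed G) = (parcs G)\<inverse>" "reversed (reversed G) = G"
  by (simp_all add: reversed_def)

lemma is_subdivision_reversed:
  assumes "is_subdivision D S"
  shows "is_subdivision (reversed D) (reversed S)"
proof -
  obtain p where p:
    "\<And>a b. (a, b) \<in> parcs D \<Longrightarrow> set (p (a, b)) \<subseteq> pverts S \<and> distinct (p (a, b)) \<and>
        2 \<le> length (p (a, b)) \<and> hd (p (a, b)) = a \<and> last (p (a, b)) = b \<and>
        set (p (a, b)) \<inter> pverts D = {a, b}"
    "\<And>e f. e \<in> parcs D \<Longrightarrow> f \<in> parcs D \<Longrightarrow> e \<noteq> f \<Longrightarrow> set (p e) \<inter> set (p f) \<subseteq> pverts D"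
    "pverts S = pverts D \<union> (\<Union>e\<in>parcs D. set (p e))"
    "parcs S = (\<Union>e\<in>parcs D. walk_arcs (p e))"
    using assms by (rule is_subdivisionE) blast
  define q where "q e = rev (p (prod.swap e))" for e
  have swap: "(\<Union>e\<in>(parcs D)\<inverse>. F (prod.swap e)) = (\<Union>e\<in>parcs D. F e)" for F :: "_ \<Rightarrow> 'b set"
    by force
  show ?thesis
  proof (rule is_subdivisionI[of _ q])
    fix a b
    assume "(a, b) \<in> parcs (reversed D)"
    then have ba: "(b, a) \<in> parcs D" by simp
    have "p (b, a) \<noteq> []" using p(1)[OF ba] by auto
    with p(1)[OF ba] show "distinct (q (a, b)) \<and> 2 \<le> length (q (a, b)) \<and>
      hd (q (a, b)) = a \<and> last (q (a, b)) = b \<and> set (q (a, b)) \<inter> pverts (reversed D) = {a, b}"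
      by (auto simp: q_def hd_rev last_rev)
  next
    fix e f
    assume "e \<in> parcs (reversed D)" "f \<in> parcs (reversed D)" "e \<noteq> f"
    then show "set (q e) \<inter> set (q f) \<subseteq> pverts (reversed D)"
      using p(2)[of "prod.swap e" "prod.swap f"] by (cases e; cases f) (auto simp: q_def)
  next
    show "pverts (reversed S) = pverts (reversed D) \<union> (\<Union>e\<in>parcs (reversed D). set (q e))"
      unfolding q_def set_rev using p(3) swap[of "\<lambda>e. set (p e)"] by simp
    show "parcs (reversed S) = (\<Union>e\<in>parcs (reversed D). walk_arcs (q e))"
      unfolding q_def set_vwalk_arcs_rev
      using p(4) swap[of "\<lambda>e. (walk_arcs (p e))\<inverse>"] by (simp add: converse_UNION)
  qed
qed

lemma contains_reversed:
  assumes "pair_wf_digraph G"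
  shows "contains_induced_subdivision (reversed D) (reversed G) \<longleftrightarrow> contains_induced_subdivision D G"
proof -
  have imp: "contains_induced_subdivision (reversed D) (reversed G)"
    if c: "contains_induced_subdivision D G" and G: "pair_wf_digraph G" for D G :: "nat pair_pre_digraph"
  proof -
    have G': "pair_wf_digraph (reversed G)" using G by (auto simp: pair_wf_digraph_def)
    obtain S g where "is_subdivision D S" "inj_on g (pverts S)" "g ` pverts S \<subseteq> pverts G"
       "\<forall>u\<in>pverts S. \<forall>v\<in>pverts S. (u, v) \<in> parcs S \<longleftrightarrow> (g u, g v) \<in> parcs G"
      using c contains_induced_subdivision_iff[OF G] by blast
    then show ?thesis
      unfolding contains_induced_subdivision_iff[OF G']
      by (intro exI[of _ "reversed S"] exI[of _ g]) (auto intro: is_subdivision_reversed)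
  qed
  have "pair_wf_digraph (reversed G)" using assms by (auto simp: pair_wf_digraph_def)
  with imp[of D G] imp[of "reversed D" "reversed G"] assms show ?thesis by auto
qed

section \<open>From subdivisions to three-block paths and back\<close>

lemma subdivision_path:
  assumes p: "\<And>a b. (a, b) \<in> parcs D \<Longrightarrow> set (p (a, b)) \<subseteq> pverts S \<and> distinct (p (a, b)) \<and>
        2 \<le> length (p (a, b)) \<and> hd (p (a, b)) = a \<and> last (p (a, b)) = b \<and>
        set (p (a, b)) \<inter> pverts D = {a, b}"
      "\<And>e f. e \<in> parcs D \<Longrightarrow> f \<in> parcs D \<Longrightarrow> e \<noteq> f \<Longrightarrow> set (p e) \<inter> set (p f) \<subseteq> pverts D"
    and ys: "ys \<noteq> []" "distinct ys" "set ys \<subseteq> pverts D" "walk_arcs ys \<subseteq> parcs D"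
  shows "\<exists>q. q \<noteq> [] \<and> distinct q \<and> hd q = hd ys \<and> last q = last ys \<and> length ys \<le> length q \<and>
    set q = set ys \<union> (\<Union>e\<in>walk_arcs ys. set (p e)) \<and>
    walk_arcs q = (\<Union>e\<in>walk_arcs ys. walk_arcs (p e))"
  using ys
proof (induction ys rule: vwalk_arcs.induct)
  case (2 x)
  show ?case by (rule exI[of _ "[x]"]) simp
next
  case (3 x y xs)
  let ?e = "(x, y)" and ?A = "walk_arcs (y # xs)"
  obtain q where q: "q \<noteq> []" "distinct q" "hd q = y" "last q = last (y # xs)"
    "length (y # xs) \<le> length q"
    "set q = set (y # xs) \<union> (\<Union>e\<in>?A. set (p e))"
    "walk_arcs q = (\<Union>e\<in>?A. walk_arcs (p e))"
    using 3 by auto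
  have e: "?e \<in> parcs D" "x \<noteq> y" using 3 by auto
  note pe = p(1)[OF e(1)]
  have pne: "p ?e \<noteq> []" using pe by auto
  \<comment> \<open>A replacing path meets \<open>pverts D\<close> only in the two ends of its arc,
    so \<open>q\<close> passes through no branch vertices other than those of
    \<open>y # xs\<close>.\<close>
  have qD: "set q \<inter> pverts D \<subseteq> set (y # xs)"
  proof
    fix v
    assume v: "v \<in> set q \<inter> pverts D"
    show "v \<in> set (y # xs)"
    proof (cases "v \<in> set (y # xs)")
      case False
      then obtain a b where ab: "(a, b) \<in> ?A" "v \<in> set (p (a, b))" using v q(6) by auto
      then have "(a, b) \<in> parcs D" using 3(4,5) by auto
      with p(1)[OF this] ab(2) v have "v = a \<or> v = b" by auto
      with vwalk_arcsD[OF ab(1)] show ?thesis by auto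
    qed
  qed
  have "set (p ?e) \<inter> set q \<subseteq> pverts D"
  proof
    fix v
    assume v: "v \<in> set (p ?e) \<inter> set q"
    show "v \<in> pverts D"
    proof (cases "v \<in> set (y # xs)")
      case True
      then show ?thesis using 3(4) by auto
    next
      case False
      then obtain f where f: "f \<in> ?A" "v \<in> set (p f)" using v q(6) by auto
      have "f \<noteq> ?e" using vwalk_arcsD[of x y "y # xs"] f(1) 3(3) by auto
      moreover have "f \<in> parcs D" using f(1) 3(5) by auto
      ultimately show ?thesis using p(2)[OF e(1)] v f(2) by blast
    qed
  qed
  \<comment> \<open>The new piece can therefore touch \<open>q\<close> only in \<open>x\<close> or
    \<open>y\<close>, and \<open>x\<close> is not in \<open>y # xs\<close>.\<close>
  with qD pe have "set (p ?e) \<inter> set q \<subseteq> {x, y} \<inter> set (y # xs)" by blast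
  then have int: "set (p ?e) \<inter> set q \<subseteq> {y}" using 3(3) by auto
  have pe_split: "p ?e = butlast (p ?e) @ [y]" using pe pne by (metis append_butlast_last_id)
  then have "y \<notin> set (butlast (p ?e))" "distinct (butlast (p ?e))"
    using pe by (metis distinct_append distinct_butlast not_distinct_conv_prefix)+
  then have dist: "distinct (butlast (p ?e) @ q)"
    using q(2) int by (auto dest: in_set_butlastD)
  have "2 \<le> length (p ?e)" using pe by simp
  then have ne: "butlast (p ?e) \<noteq> []" by (cases "p ?e") auto
  have hd: "hd (butlast (p ?e) @ q) = x"
    using ne pe pe_split by (metis hd_append2)
  have "set (p ?e) = insert y (set (butlast (p ?e)))" using set_butlast_last[OF pne] pe by simp
  moreover have "y \<in> set q" using q(1,3) by auto
  moreover have "x \<in> set (p ?e)" using pe by blast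
  ultimately have verts: "set (butlast (p ?e) @ q) = set (x # y # xs) \<union>
      (\<Union>e\<in>walk_arcs (x # y # xs). set (p e))"
    using q(6) by auto
  have arcs: "walk_arcs (butlast (p ?e) @ q) =
      (\<Union>e\<in>walk_arcs (x # y # xs). walk_arcs (p e))"
    using vwalk_arcs_butlast_join[OF pne q(1)] pe q(3,7) by simp
  have len: "length (x # y # xs) \<le> length (butlast (p ?e) @ q)"
    using q(5) \<open>2 \<le> length (p ?e)\<close> by simp
  show ?case
    using q(1,4) dist hd verts arcs len by (intro exI[of _ "butlast (p ?e) @ q"]) simp
qed simp

text \<open>Dropping vertices at the two ends of an induced path keeps it induced. So the first
  block is shortened from its origin and the third from its terminus, while the second, lying
  between them, is kept whole.\<close>

lemma subdivision_contains_shape: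
  assumes P: "shape aP bP zP (pverts P) (parcs P)" "2 \<le> length bP" and S: "is_subdivision P S"
  shows "\<exists>a b z U. U \<subseteq> pverts S \<and> shape a b z U (parcs S \<inter> U \<times> U) \<and>
    length a = length aP \<and> length bP \<le> length b"
proof -
  obtain p where p:
    "\<And>a b. (a, b) \<in> parcs P \<Longrightarrow> set (p (a, b)) \<subseteq> pverts S \<and> distinct (p (a, b)) \<and>
        2 \<le> length (p (a, b)) \<and> hd (p (a, b)) = a \<and> last (p (a, b)) = b \<and>
        set (p (a, b)) \<inter> pverts P = {a, b}"
    "\<And>e f. e \<in> parcs P \<Longrightarrow> f \<in> parcs P \<Longrightarrow> e \<noteq> f \<Longrightarrow> set (p e) \<inter> set (p f) \<subseteq> pverts P"
    and vS: "pverts S = pverts P \<union> (\<Union>e\<in>parcs P. set (p e))"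
    and aS: "parcs S = (\<Union>e\<in>parcs P. walk_arcs (p e))"
    using S by (rule is_subdivisionE) blast
  note dP = shape_distinct[OF P(1)]
  have ne: "aP \<noteq> []" "bP \<noteq> []" "last aP = last bP" using P(1) by (auto simp: shape_def)
  have vP: "pverts P = set aP \<union> set bP \<union> {zP}"
    and aP: "parcs P = walk_arcs aP \<union> walk_arcs bP \<union> walk_arcs [hd bP, zP]"
    using P(1) by (auto simp: shape_def)
  define s t where "s = last bP" and "t = hd bP"
  have t: "t \<in> set bP" "t \<noteq> s" "zP \<noteq> t"
  proof -
    show "t \<in> set bP" using ne by (simp add: t_def)
    obtain x y ys where "bP = x # y # ys" using P(2) by (metis Suc_le_length_iff numeral_2_eq_2)
    with dP(2) show "t \<noteq> s" by (auto simp: t_def s_def)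
    show "zP \<noteq> t" using \<open>t \<in> set bP\<close> dP(5) by auto
  qed
  have tc: "set [t, zP] \<subseteq> pverts P" "walk_arcs [t, zP] \<subseteq> parcs P"
    using t vP aP by (auto simp: t_def)
  have path: "\<exists>q. q \<noteq> [] \<and> distinct q \<and> hd q = hd ys \<and> last q = last ys \<and> length ys \<le> length q \<and>
    set q = set ys \<union> (\<Union>e\<in>walk_arcs ys. set (p e)) \<and>
    walk_arcs q = (\<Union>e\<in>walk_arcs ys. walk_arcs (p e))"
    if "ys \<noteq> []" "distinct ys" "set ys \<subseteq> pverts P" "walk_arcs ys \<subseteq> parcs P" for ys
    by (rule subdivision_path[of P p S]) (rule p that | assumption)+
  have "set aP \<subseteq> pverts P" "walk_arcs aP \<subseteq> parcs P" using vP aP by auto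
  from path[OF ne(1) dP(1) this] obtain qa where
    qa: "qa \<noteq> []" "distinct qa" "hd qa = hd aP" "last qa = last aP" "length aP \<le> length qa"
    "set qa = set aP \<union> (\<Union>e\<in>walk_arcs aP. set (p e))"
    "walk_arcs qa = (\<Union>e\<in>walk_arcs aP. walk_arcs (p e))"
    by (elim exE conjE) (rule that)
  have "set bP \<subseteq> pverts P" "walk_arcs bP \<subseteq> parcs P" using vP aP by auto
  from path[OF ne(2) dP(2) this] obtain qb where
    qb: "qb \<noteq> []" "distinct qb" "hd qb = hd bP" "last qb = last bP" "length bP \<le> length qb"
    "set qb = set bP \<union> (\<Union>e\<in>walk_arcs bP. set (p e))"
    "walk_arcs qb = (\<Union>e\<in>walk_arcs bP. walk_arcs (p e))"
    by (elim exE conjE) (rule that)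
  have "[t, zP] \<noteq> []" "distinct [t, zP]" using t(3) by auto
  from path[OF this tc] obtain qc where
    qc: "qc \<noteq> []" "distinct qc" "hd qc = hd [t, zP]" "last qc = last [t, zP]"
    "length [t, zP] \<le> length qc"
    "set qc = set [t, zP] \<union> (\<Union>e\<in>walk_arcs [t, zP]. set (p e))"
    "walk_arcs qc = (\<Union>e\<in>walk_arcs [t, zP]. walk_arcs (p e))"
    by (elim exE conjE) (rule that)
  have qa_last: "last qa = s" and qb_ends: "hd qb = t" "last qb = s" and qc_hd: "hd qc = t"
    and qc_len: "2 \<le> length qc"
    using qa(4) qb(3,4) qc(3,5) ne(3) by (simp_all add: s_def t_def)
  \<comment> \<open>Arc-disjoint paths of \<open>P\<close> are expanded to paths that share only
    common branch vertices, since distinct arcs are replaced by internally disjoint paths.\<close>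
  have meet: "set q \<inter> set q' \<subseteq> set ys \<inter> set ys'"
    if arcs: "walk_arcs ys \<subseteq> parcs P" "walk_arcs ys' \<subseteq> parcs P"
      and verts: "set ys \<subseteq> pverts P" "set ys' \<subseteq> pverts P"
      and q: "set q = set ys \<union> (\<Union>e\<in>walk_arcs ys. set (p e))"
        "set q' = set ys' \<union> (\<Union>e\<in>walk_arcs ys'. set (p e))"
      and disj: "walk_arcs ys \<inter> walk_arcs ys' = {}" for q q' ys ys'
  proof -
    have inP: "v \<in> set xs"
      if v: "v \<in> pverts P" "v \<in> set xs \<union> (\<Union>e\<in>walk_arcs xs. set (p e))"
        and xs: "walk_arcs xs \<subseteq> parcs P" for v xs
    proof (cases "v \<in> set xs")
      case False
      then obtain a b where ab: "(a, b) \<in> walk_arcs xs" "v \<in> set (p (a, b))" using v by auto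
      then have "set (p (a, b)) \<inter> pverts P = {a, b}" using p(1)[of a b] xs by auto
      then have "v = a \<or> v = b" using ab(2) v(1) by auto
      with vwalk_arcsD[OF ab(1)] show ?thesis by auto
    qed
    show ?thesis
    proof
      fix v
      assume v: "v \<in> set q \<inter> set q'"
      have "v \<in> pverts P"
      proof (cases "v \<in> set ys \<or> v \<in> set ys'")
        case True
        then show ?thesis using verts by auto
      next
        case False
        then obtain e f where ef: "e \<in> walk_arcs ys" "f \<in> walk_arcs ys'"
          "v \<in> set (p e)" "v \<in> set (p f)" using v q by auto
        then have "e \<noteq> f" using disj by auto
        then have "set (p e) \<inter> set (p f) \<subseteq> pverts P" using ef(1,2) arcs by (intro p(2)) auto
        then show ?thesis using ef(3,4) by auto
      qed
      moreover have "v \<in> set q" "v \<in> set q'" using v by auto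
      ultimately show "v \<in> set ys \<inter> set ys'"
        using inP[of v ys] inP[of v ys'] arcs unfolding q by blast
    qed
  qed
  have "walk_arcs aP \<inter> walk_arcs bP = {}"
  proof (rule equals0I)
    fix e
    assume e: "e \<in> walk_arcs aP \<inter> walk_arcs bP"
    obtain u v where uv: "e = (u, v)" by (cases e)
    then have "u \<in> set aP \<inter> set bP" "v \<in> set aP \<inter> set bP" "u \<noteq> v"
      using e vwalk_arcsD[of u v aP] vwalk_arcsD[of u v bP] vwalk_arcs_neq[OF dP(1)] by auto
    then show False unfolding dP(3) by simp
  qed
  then have ab: "set qa \<inter> set qb \<subseteq> {s}"
    using meet[OF _ _ _ _ qa(6) qb(6)] vP aP dP(3) by (auto simp: s_def)
  have "walk_arcs aP \<inter> walk_arcs [t, zP] = {}" using dP(4) by (auto dest: vwalk_arcsD)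
  then have "set qa \<inter> set qc \<subseteq> set aP \<inter> {t, zP}"
    using meet[OF _ _ _ _ qa(6) qc(6)] vP aP tc by auto
  then have ac: "set qa \<inter> set qc = {}" using t dP(3,4) by (auto simp: s_def)
  have "walk_arcs bP \<inter> walk_arcs [t, zP] = {}" using dP(5) by (auto dest: vwalk_arcsD)
  then have "set qb \<inter> set qc \<subseteq> set bP \<inter> {t, zP}"
    using meet[OF _ _ _ _ qb(6) qc(6)] vP aP tc by auto
  then have bc: "set qb \<inter> set qc \<subseteq> {t}" using dP(5) by auto
  \<comment> \<open>The last \<open>length aP\<close> vertices of \<open>qa\<close> are kept, so
    that its end \<open>s\<close> stays.\<close>
  define a where "a = drop (length qa - length aP) qa"
  define pre where "pre = take (length qa - length aP) qa"
  have pre: "qa = pre @ a" by (simp add: a_def pre_def)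
  have la: "length a = length aP" using qa(5) by (simp add: a_def)
  have ane: "a \<noteq> []" using la ne by auto
  \<comment> \<open>Only the first arc of the path replacing \<open>(t, zP)\<close> is kept.\<close>
  obtain z rest where zr: "qc = [t, z] @ rest" using qc_hd qc_len
    by (metis Suc_le_length_iff append_Cons append_Nil list.sel(1) numeral_2_eq_2)
  define U where "U = set a \<union> set qb \<union> {z}"
  have zq: "z \<in> set qc" "z \<noteq> t" using zr qc(2) by auto
  have last_a: "last a = s" using qa_last pre ane by simp
  have sb: "s \<notin> set (butlast qb)" "distinct (butlast qb)"
  proof -
    have "qb = butlast qb @ [s]" using qb(1) qb_ends by (metis append_butlast_last_id)
    then have "distinct (butlast qb @ [s])" using qb(2) by metis
    then show "s \<notin> set (butlast qb)" "distinct (butlast qb)" by auto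
  qed
  have asub: "set a \<subseteq> set qa" using pre by auto
  have "distinct a" using qa(2) pre by simp
  moreover have "set a \<inter> set (butlast qb) = {}" using ab asub sb(1) in_set_butlastD by fastforce
  moreover have "z \<notin> set a" using ac asub zq(1) by blast
  moreover have "z \<notin> set (butlast qb)" using bc zq in_set_butlastD by fastforce
  ultimately have d: "distinct (a @ butlast qb @ [z])" using sb(2) by simp
  have "parcs S = walk_arcs qa \<union> walk_arcs qb \<union> walk_arcs qc"
    unfolding aS qa(7) qb(7) qc(7) aP t_def UN_Un by (rule refl)
  moreover have "walk_arcs qa \<inter> U \<times> U = walk_arcs a"
  proof
    show "walk_arcs a \<subseteq> walk_arcs qa \<inter> U \<times> U"
      using set_vwalk_arcs_append2[of a pre] pre by (auto simp: U_def dest: vwalk_arcsD)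
    show "walk_arcs qa \<inter> U \<times> U \<subseteq> walk_arcs a"
    proof clarify
      fix u v
      assume uv: "(u, v) \<in> walk_arcs qa" "u \<in> U"
      have "u \<in> set qa" using vwalk_arcsD[OF uv(1)] by simp
      then have "u \<in> set a" using uv(2) ab ac zq last_a last_in_set[OF ane] by (auto simp: U_def)
      then show "(u, v) \<in> walk_arcs a"
        using vwalk_arcs_suffix[of pre a u v] uv(1) qa(2) unfolding pre by blast
    qed
  qed
  moreover have "walk_arcs qb \<inter> U \<times> U = walk_arcs qb"
    by (auto simp: U_def dest: vwalk_arcsD)
  moreover have "walk_arcs qc \<inter> U \<times> U = {(t, z)}"
  proof
    have "t \<in> set qb" using qb(1) qb_ends by auto
    then show "{(t, z)} \<subseteq> walk_arcs qc \<inter> U \<times> U" using zr by (auto simp: U_def)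
    show "walk_arcs qc \<inter> U \<times> U \<subseteq> {(t, z)}"
    proof clarify
      fix u v
      assume uv: "(u, v) \<in> walk_arcs qc" "v \<in> U"
      have "v \<in> set qc" using vwalk_arcsD[OF uv(1)] by simp
      then have "v \<in> set [t, z]" using uv(2) ac bc asub by (auto simp: U_def)
      then have "(u, v) \<in> walk_arcs [t, z]"
        using vwalk_arcs_prefix[of "[t, z]" rest u v] uv(1) qc(2) unfolding zr by blast
      then show "u = t \<and> v = z" by simp
    qed
  qed
  ultimately have "parcs S \<inter> U \<times> U = walk_arcs a \<union> walk_arcs qb \<union> {(hd qb, z)}"
    unfolding qb_ends(1) by blast
  then have "shape a qb z U (parcs S \<inter> U \<times> U)"
    using ane qb(1) qb_ends last_a d by (simp add: shape_def U_def)
  moreover have "U \<subseteq> pverts S"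
  proof -
    have "set qa \<union> set qb \<union> set qc \<subseteq> pverts S"
      unfolding qa(6) qb(6) qc(6) vS using vP aP tc by blast
    then show ?thesis using asub zq by (auto simp: U_def)
  qed
  ultimately show ?thesis using la qb(5) by blast
qed

text \<open>Only the first arc \<open>(t, y)\<close> of \<open>bP\<close> has to be replaced by a
  longer path; it takes up all surplus vertices of \<open>b\<close>, and every other arc stays as it
  is.\<close>

lemma shape_gives_subdivision:
  fixes P :: "nat pair_pre_digraph"
  assumes P: "shape aP bP zP (pverts P) (parcs P)" "2 \<le> length bP"
    and len: "length a = length aP" "length bP \<le> length b"
    and sh: "shape a b z U E"
  shows "\<exists>S g. is_subdivision P S \<and> inj_on g (pverts S) \<and> g ` pverts S = U \<and>
    map_prod g g ` parcs S = E"
proof -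
  note dP = shape_distinct[OF P(1)]
  obtain t y c where bP: "bP = t # y # c" using P(2) by (metis Suc_le_length_iff numeral_2_eq_2)
  have neP: "aP \<noteq> []" "last aP = last (y # c)" using P(1) bP by (auto simp: shape_def)
  have vP: "pverts P = set aP \<union> set bP \<union> {zP}"
    and aP: "parcs P = walk_arcs aP \<union> walk_arcs bP \<union> {(t, zP)}"
    using P(1) by (auto simp: shape_def bP)
  \<comment> \<open>New internal vertices come from the vertex type itself, which is infinite; their
    number is the surplus \<open>length b - length bP\<close>.\<close>
  have "infinite (- pverts P)" using vP by (simp add: finite_compl)
  then obtain F where F: "finite F" "card F = length b - length bP" "F \<subseteq> - pverts P"
    using infinite_arbitrarily_large by blast
  obtain fs where fs: "set fs = F" "distinct fs" using finite_distinct_list[OF F(1)] by blast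
  have lfs: "length fs = length b - length bP" using fs F(2) distinct_card by fastforce
  define bS where "bS = t # fs @ y # c"
  define S where "S = \<lparr>pverts = set aP \<union> set bS \<union> {zP},
    parcs = walk_arcs aP \<union> walk_arcs bS \<union> {(t, zP)}\<rparr>"
  have fresh: "set fs \<inter> (set aP \<union> set bP \<union> {zP}) = {}" using fs F(3) vP by auto
  have bl: "butlast bS = t # fs @ butlast (y # c)" by (simp add: bS_def butlast_append)
  have "distinct (aP @ butlast bP @ [zP])" using P(1) by (simp add: shape_def)
  then have dS: "distinct (aP @ butlast bS @ [zP])"
    unfolding bl using fresh fs(2) by (auto simp: bP dest: in_set_butlastD split: if_splits)
  have shS: "shape aP bS zP (pverts S) (parcs S)"
    using neP dS by (simp add: shape_def S_def bS_def)
  define p where "p e = (if e = (t, y) then t # fs @ [y] else [fst e, snd e])" for e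
  have arcs_bS: "walk_arcs bS = walk_arcs (t # fs @ [y]) \<union> walk_arcs (y # c)"
    using vwalk_arcs_join[of "t # fs" y c] by (simp add: bS_def)
  have ty: "(t, y) \<notin> walk_arcs aP" "(t, y) \<notin> walk_arcs (y # c)" "y \<noteq> zP"
  proof -
    have "t \<noteq> last bP" using dP(2) by (auto simp: bP)
    then have "t \<notin> set aP" using dP(3) bP by auto
    then show "(t, y) \<notin> walk_arcs aP" by (auto dest: vwalk_arcsD)
    show "(t, y) \<notin> walk_arcs (y # c)" using dP(2) bP by (auto dest: vwalk_arcsD)
    show "y \<noteq> zP" using dP(5) bP by auto
  qed
  have short: "(\<Union>e\<in>X. walk_arcs (p e)) = X" if "(t, y) \<notin> X" for X
  proof -
    have "vwalk_arcs (p e) = [e]" if "e \<in> X" for e using that \<open>(t, y) \<notin> X\<close> by (auto simp: p_def)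
    then show ?thesis by simp
  qed
  have bP': "walk_arcs bP = {(t, y)} \<union> walk_arcs (y # c)" by (simp add: bP)
  have sub: "is_subdivision P S"
  proof (rule is_subdivisionI[of _ p])
    fix u v
    assume uv: "(u, v) \<in> parcs P"
    then have V: "u \<in> pverts P" "v \<in> pverts P" using shape_wf[OF P(1)] by auto
    have "u \<noteq> v" using uv vwalk_arcs_neq[OF dP(1)] vwalk_arcs_neq[OF dP(2)] dP(5) by (auto simp: aP bP)
    moreover have "distinct (t # fs @ [y])" "set (t # fs @ [y]) \<inter> pverts P = {t, y}"
      using fresh fs(2) dP(2) vP by (auto simp: bP)
    ultimately show "distinct (p (u, v)) \<and> 2 \<le> length (p (u, v)) \<and> hd (p (u, v)) = u \<and>
      last (p (u, v)) = v \<and> set (p (u, v)) \<inter> pverts P = {u, v}"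
      using V by (simp add: p_def)
  next
    fix e f
    assume ef: "e \<in> parcs P" "f \<in> parcs P" "e \<noteq> f"
    have "set (p h) \<subseteq> pverts P" if "h \<in> parcs P" "h \<noteq> (t, y)" for h
      using shape_wf[OF P(1)] that by (cases h) (auto simp: p_def)
    then show "set (p e) \<inter> set (p f) \<subseteq> pverts P" using ef by (cases "e = (t, y)") blast+
  next
    have "set (p e) \<subseteq> pverts P \<union> set fs" if "e \<in> parcs P" for e
      using shape_wf[OF P(1)] that vP bP by (cases e) (auto simp: p_def)
    moreover have "set fs \<subseteq> set (p (t, y))" "(t, y) \<in> parcs P" by (auto simp: p_def aP bP)
    ultimately have "pverts P \<union> (\<Union>e\<in>parcs P. set (p e)) = pverts P \<union> set fs" by blast
    then show "pverts S = pverts P \<union> (\<Union>e\<in>parcs P. set (p e))"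
      using vP by (auto simp: S_def bS_def bP)
  next
    have "(\<Union>e\<in>parcs P. walk_arcs (p e)) = walk_arcs aP \<union>
        (walk_arcs (p (t, y)) \<union> walk_arcs (y # c)) \<union> {(t, zP)}"
      unfolding aP bP' UN_Un using short[OF ty(1)] short[OF ty(2)] short[of "{(t, zP)}"] ty(3) by simp
    then show "parcs S = (\<Union>e\<in>parcs P. walk_arcs (p e))"
      by (simp add: S_def arcs_bS p_def)
  qed
  let ?LS = "aP @ butlast bS @ [zP]" and ?LG = "a @ butlast b @ [z]"
  have lenS: "length (butlast bS) = length (butlast b)" using lfs len(2) by (simp add: bS_def bP)
  then have lenL: "length ?LS = length ?LG" using len by simp
  \<comment> \<open>Both lists enumerate their vertices without repetition and have equal length, so
    matching them position by position gives the isomorphism.\<close>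
  define g where "g x = the (map_of (zip ?LS ?LG) x)" for x
  have mapL: "map g ?LS = ?LG"
  proof (rule nth_equalityI)
    fix i
    assume i: "i < length (map g ?LS)"
    then have "map_of (zip ?LS ?LG) (?LS ! i) = Some (?LG ! i)"
      using map_of_zip_nth[OF lenL dS] lenL by simp
    with i show "map g ?LS ! i = ?LG ! i" by (simp add: g_def del: map_append)
  qed (use lenL in simp)
  have mg: "map g aP = a" "map g (butlast bS) = butlast b" "g zP = z"
    using mapL len lenS by (auto simp: append_eq_append_conv)
  have gne: "a \<noteq> []" "b \<noteq> []" "last a = last b" using sh by (auto simp: shape_def)
  have bSne: "bS \<noteq> []" "last bS = last aP" using neP by (auto simp: bS_def)
  have "g (last bS) = last b" using mg(1) gne neP(1) bSne(2) by (metis last_map)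
  then have mb: "map g bS = b"
    using mg(2) bSne(1) gne(2) by (metis append_butlast_last_id list.simps(8,9) map_append)
  have vS: "pverts S = set ?LS" using shS set_butlast_last[of bS] bSne neP(1) last_in_set[of aP]
    by (auto simp: shape_def)
  have "distinct (map g ?LS)" unfolding mapL using sh by (simp add: shape_def)
  then have inj: "inj_on g (pverts S)" unfolding vS distinct_map by (rule conjunct2)
  have "shape a b z (g ` pverts S) (map_prod g g ` parcs S)"
    using shape_map[OF shS inj] unfolding mg mb .
  then have "g ` pverts S = U \<and> map_prod g g ` parcs S = E"
    using sh unfolding shape_def by blast
  with sub inj show ?thesis by blast
qed

theorem contains_iff_shape:
  assumes "pair_wf_digraph G" "shape aP bP zP (pverts P) (parcs P)" "2 \<le> length bP"
  shows "contains_induced_subdivision P G \<longleftrightarrow>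
    (\<exists>a b z U. U \<subseteq> pverts G \<and> shape a b z U (parcs G \<inter> U \<times> U) \<and>
       length a = length aP \<and> length bP \<le> length b)"
  unfolding contains_induced_subdivision_iff[OF assms(1)]
proof
  assume "\<exists>S g. is_subdivision P S \<and> inj_on g (pverts S) \<and> g ` pverts S \<subseteq> pverts G \<and>
       (\<forall>u\<in>pverts S. \<forall>v\<in>pverts S. (u, v) \<in> parcs S \<longleftrightarrow> (g u, g v) \<in> parcs G)"
  then obtain S g where S: "is_subdivision P S" and inj: "inj_on g (pverts S)"
    and sub: "g ` pverts S \<subseteq> pverts G"
    and arcs: "\<forall>u\<in>pverts S. \<forall>v\<in>pverts S. (u, v) \<in> parcs S \<longleftrightarrow> (g u, g v) \<in> parcs G"
    by (elim exE conjE) (rule that)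
  obtain a b z U where U: "U \<subseteq> pverts S" "shape a b z U (parcs S \<inter> U \<times> U)"
    "length a = length aP" "length bP \<le> length b"
    using subdivision_contains_shape[OF assms(2,3) S] by (elim exE conjE) (rule that)
  have "map_prod g g ` (parcs S \<inter> U \<times> U) = parcs G \<inter> (g ` U) \<times> (g ` U)"
  proof
    show "map_prod g g ` (parcs S \<inter> U \<times> U) \<subseteq> parcs G \<inter> (g ` U) \<times> (g ` U)"
      using arcs U(1) by auto
    show "parcs G \<inter> (g ` U) \<times> (g ` U) \<subseteq> map_prod g g ` (parcs S \<inter> U \<times> U)"
    proof
      fix e
      assume "e \<in> parcs G \<inter> (g ` U) \<times> (g ` U)"
      then obtain u v where uv: "e = (g u, g v)" "u \<in> U" "v \<in> U" "(g u, g v) \<in> parcs G" by auto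
      then have "(u, v) \<in> parcs S \<inter> U \<times> U" using arcs U(1) by auto
      then show "e \<in> map_prod g g ` (parcs S \<inter> U \<times> U)"
        by (rule rev_image_eqI) (simp add: uv)
    qed
  qed
  with shape_map[OF U(2) inj_on_subset[OF inj U(1)]]
  have "shape (map g a) (map g b) (g z) (g ` U) (parcs G \<inter> (g ` U) \<times> (g ` U))" by simp
  moreover have "g ` U \<subseteq> pverts G" using sub U(1) by blast
  ultimately show "\<exists>a b z U. U \<subseteq> pverts G \<and> shape a b z U (parcs G \<inter> U \<times> U) \<and>
       length a = length aP \<and> length bP \<le> length b"
    using U(3,4) by (intro exI[of _ "map g a"] exI[of _ "map g b"] exI[of _ "g z"] exI[of _ "g ` U"]) simp
next
  assume "\<exists>a b z U. U \<subseteq> pverts G \<and> shape a b z U (parcs G \<inter> U \<times> U) \<and>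
       length a = length aP \<and> length bP \<le> length b"
  then obtain a b z U where U: "U \<subseteq> pverts G" "shape a b z U (parcs G \<inter> U \<times> U)"
    "length a = length aP" "length bP \<le> length b" by (elim exE conjE) (rule that)
  obtain S g where S: "is_subdivision P S" "inj_on g (pverts S)" "g ` pverts S = U"
    "map_prod g g ` parcs S = parcs G \<inter> U \<times> U"
    using shape_gives_subdivision[OF assms(2,3) U(3,4,2)] by (elim exE conjE) (rule that)
  have "(u, v) \<in> parcs S \<longleftrightarrow> (g u, g v) \<in> parcs G" if "u \<in> pverts S" "v \<in> pverts S" for u v
  proof
    assume "(u, v) \<in> parcs S"
    then have "(g u, g v) \<in> map_prod g g ` parcs S" by (rule rev_image_eqI) simp
    then show "(g u, g v) \<in> parcs G" unfolding S(4) by simp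
  next
    assume "(g u, g v) \<in> parcs G"
    moreover have "g u \<in> U" "g v \<in> U" using S(3) that by auto
    ultimately have "(g u, g v) \<in> map_prod g g ` parcs S" unfolding S(4) by simp
    then obtain u' v' where uv: "(u', v') \<in> parcs S" "g u' = g u" "g v' = g v" by auto
    moreover from this have "u' \<in> pverts S" "v' \<in> pverts S" using subdivision_wf[OF S(1)] by auto
    ultimately have "u' = u" "v' = v"
      using inj_onD[OF S(2), of u' u] inj_onD[OF S(2), of v' v] that by simp_all
    with uv(1) show "(u, v) \<in> parcs S" by simp
  qed
  with S(1-3) U(1) show "\<exists>S g. is_subdivision P S \<and> inj_on g (pverts S) \<and> g ` pverts S \<subseteq> pverts G \<and>
       (\<forall>u\<in>pverts S. \<forall>v\<in>pverts S. (u, v) \<in> parcs S \<longleftrightarrow> (g u, g v) \<in> parcs G)"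
    by (intro exI[of _ S] exI[of _ g]) simp
qed

section \<open>Induced subdivisions and reachability\<close>

lemma set_vwalk_arcs_nth: "walk_arcs p = {(p ! l, p ! Suc l) | l. Suc l < length p}"
proof (induction p rule: vwalk_arcs.induct)
  case (3 x y xs)
  have ex_Suc: "(\<exists>l. Q l) \<longleftrightarrow> Q 0 \<or> (\<exists>l. Q (Suc l))" for Q :: "nat \<Rightarrow> bool"
    by (metis not0_implies_Suc)
  have "(\<exists>l. e = ((x # y # xs) ! l, (y # xs) ! l) \<and> l < length (y # xs)) \<longleftrightarrow>
      e = (x, y) \<or> (\<exists>l. e = ((y # xs) ! l, xs ! l) \<and> l < length xs)" for e
    by (subst ex_Suc) simp
  with 3 show ?case by auto
qed auto

lemma vwalk_arcs_not_ends:
  assumes "distinct q" "(u, v) \<in> walk_arcs q"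
  shows "v \<noteq> hd q" "u \<noteq> last q"
proof -
  obtain l where l: "Suc l < length q" "u = q ! l" "v = q ! Suc l"
    using assms(2) by (auto simp: set_vwalk_arcs_nth)
  then have "q \<noteq> []" by auto
  then have "hd q = q ! 0" "last q = q ! (length q - 1)" by (simp_all add: hd_conv_nth last_conv_nth)
  moreover have "length q - 1 < length q" "0 < length q" using \<open>q \<noteq> []\<close> by auto
  ultimately show "v \<noteq> hd q" "u \<noteq> last q"
    using l nth_eq_iff_index_eq[OF assms(1), of "Suc l" 0]
      nth_eq_iff_index_eq[OF assms(1), of l "length q - 1"] by auto
qed

text \<open>\<open>q\<close> runs from a candidate for \<open>t\<close> to \<open>y\<close>, and
  \<open>z\<close> is a candidate for the end of the third block. The same predicate
  \<open>W\<close> is asked of \<open>z\<close> and of all vertices of \<open>q\<close> before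
  \<open>y\<close>, so they can exchange roles. Non-adjacency is asked only between \<open>z\<close>
  and \<open>tl q\<close>; chords of \<open>q\<close> are still allowed.\<close>

definition link_path :: "('a \<times> 'a) set \<Rightarrow> ('a \<Rightarrow> bool) \<Rightarrow> 'a \<Rightarrow> 'a list \<Rightarrow> 'a \<Rightarrow> bool" where
  "link_path E W y q z \<longleftrightarrow> 2 \<le> length q \<and> last q = y \<and> (\<forall>v\<in>set (butlast q). W v) \<and> W z \<and>
     walk_arcs q \<subseteq> E \<and> (hd q, z) \<in> E \<and> (\<forall>v\<in>set (tl q). (z, v) \<notin> E \<and> (v, z) \<notin> E)"

text \<open>A link path of least length works for some \<open>z\<close>, which need not be the given one.\<close>

lemma induced_link_path:
  assumes asym: "\<And>u v. (u, v) \<in> E \<Longrightarrow> (v, u) \<notin> E"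
    and y: "\<not> W y" "\<And>v. W v \<Longrightarrow> (y, v) \<notin> E"
    and ex: "link_path E W y q0 z0"
  shows "\<exists>q z. link_path E W y q z \<and> distinct q \<and> z \<notin> set q \<and>
    E \<inter> set q \<times> set q = walk_arcs q"
proof -
  \<comment> \<open>The minimum ranges over all pairs of a path and a vertex \<open>z\<close>, so a
    shorter path with a different \<open>z\<close> contradicts it as well.\<close>
  obtain q z where qz: "link_path E W y q z"
    and least: "\<And>q' z'. link_path E W y q' z' \<Longrightarrow> length q \<le> length q'"
  proof -
    define k where "k = (LEAST k. \<exists>q z. link_path E W y q z \<and> length q = k)"
    have "\<exists>q z. link_path E W y q z \<and> length q = k"
      unfolding k_def by (rule LeastI[of _ "length q0"]) (use ex in blast)
    moreover have "k \<le> length q'" if "link_path E W y q' z'" for q' z'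
      unfolding k_def by (rule Least_le) (use that in blast)
    ultimately show thesis using that by blast
  qed
  have q: "2 \<le> length q" "last q = y" "\<forall>v\<in>set (butlast q). W v" "W z" "walk_arcs q \<subseteq> E"
    "(hd q, z) \<in> E" "\<forall>v\<in>set (tl q). (z, v) \<notin> E \<and> (v, z) \<notin> E"
    using qz by (simp_all add: link_path_def)
  let ?n = "length q"
  have lastq: "q ! (?n - 1) = y" using q(1,2) by (subst (asm) last_conv_nth) auto
  have Wq: "W (q ! i)" if "i < ?n - 1" for i
  proof -
    have "q ! i = butlast q ! i" using that by (simp add: nth_butlast)
    then show ?thesis using q(3) that by (metis length_butlast nth_mem)
  qed
  have step: "(q ! i, q ! Suc i) \<in> E" if "Suc i < ?n" for i
    using q(5) that by (auto simp: set_vwalk_arcs_nth)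
  have tlq: "(z, q ! i) \<notin> E" "(q ! i, z) \<notin> E" if "0 < i" "i < ?n" for i
  proof -
    have "q ! i = tl q ! (i - 1)" "i - 1 < length (tl q)" using that by (auto simp: nth_tl)
    then have "q ! i \<in> set (tl q)" by (metis nth_mem)
    then show "(z, q ! i) \<notin> E" "(q ! i, z) \<notin> E" using q(7) by auto
  qed
  \<comment> \<open>A shortcut along a forward chord keeps the head and the end and adds no vertex
    to the tail, so it gives a shorter link path with the same \<open>z\<close>.\<close>
  have forward: "(q ! i, q ! j) \<notin> E" if ij: "Suc i < j" "j < ?n" for i j
  proof
    assume e: "(q ! i, q ! j) \<in> E"
    define q' where "q' = take (Suc i) q @ drop j q"
    have ne: "take (Suc i) q \<noteq> []" "drop j q \<noteq> []" using ij by auto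
    have "last (take (Suc i) q) = q ! i" using ij by (simp add: take_Suc_conv_app_nth)
    moreover have "hd (drop j q) = q ! j" using ij by (simp add: hd_drop_conv_nth)
    ultimately have arcs: "vwalk_arcs q' = vwalk_arcs (take (Suc i) q) @ (q ! i, q ! j) # vwalk_arcs (drop j q)"
      using vwalk_arcs_append[OF ne] by (simp add: q'_def)
    have "walk_arcs (take (Suc i) q) \<subseteq> E" "walk_arcs (drop j q) \<subseteq> E"
      using q(5) set_vwalk_arcs_append1[of "take (Suc i) q" "drop (Suc i) q"]
        set_vwalk_arcs_append2[of "drop j q" "take j q"] by auto
    with e have "walk_arcs q' \<subseteq> E" by (simp add: arcs)
    moreover have "last q' = y" using ne q(2) ij by (simp add: q'_def)
    moreover have "set (butlast q') \<subseteq> set (butlast q)"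
    proof -
      have "butlast q' = take (Suc i) q @ drop j (butlast q)" using ne by (simp add: q'_def butlast_append butlast_drop)
      moreover have "take (Suc i) q = take (Suc i) (butlast q)" using ij by (simp add: take_butlast)
      ultimately show ?thesis using set_take_subset[of "Suc i" "butlast q"] set_drop_subset[of j "butlast q"] by auto
    qed
    moreover have "hd q' = hd q" using ne by (simp add: q'_def hd_append)
    moreover have "set (tl q') \<subseteq> set (tl q)"
    proof -
      have "tl q' = take i (tl q) @ drop (j - 1) (tl q)"
        using ne ij by (cases q) (auto simp: q'_def drop_Cons')
      then show ?thesis using set_take_subset[of i "tl q"] set_drop_subset[of "j - 1" "tl q"] by auto
    qed
    moreover have "2 \<le> length q'" using ij by (simp add: q'_def)
    ultimately have "link_path E W y q' z" using q by (auto simp: link_path_def)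
    from least[OF this] show False using ij by (simp add: q'_def)
  qed
  \<comment> \<open>A repeated vertex would have a forward chord from its first occurrence to the
    successor of its second; if the second occurrence is the last position, the vertex is
    \<open>y\<close>, which violates \<open>W\<close>.\<close>
  have dist: "distinct q"
  proof (rule ccontr)
    assume "\<not> distinct q"
    then obtain i j where ij: "i < j" "j < ?n" "q ! i = q ! j"
      unfolding distinct_conv_nth by (metis linorder_neqE_nat)
    show False
    proof (cases "Suc j < ?n")
      case True
      with step[OF this] forward[of i "Suc j"] ij show ?thesis by simp
    next
      case False
      then have "q ! j = y" using ij lastq by (metis Suc_lessI diff_Suc_1)
      moreover have "i < ?n - 1" using ij by linarith
      ultimately show ?thesis using Wq[of i] y(1) ij(3) by simp
    qed
  qed
  have backward: "(q ! j, q ! i) \<notin> E" if ij: "Suc i < j" "j < ?n" for i j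
  proof
    let ?back = "\<lambda>j. \<exists>i. Suc i < j \<and> (q ! j, q ! i) \<in> E"
    \<comment> \<open>\<open>y\<close> has no arc to vertices satisfying \<open>W\<close>, so the
      suffix from \<open>j\<close> still contains an arc, as \<open>link_path\<close>
      demands.\<close>
    have not_last: "j < ?n - 1" if "?back j" "j < ?n" for j
    proof (rule ccontr)
      assume "\<not> j < ?n - 1"
      then have "j = ?n - 1" using that by simp
      with that lastq obtain i where "Suc i < ?n - 1" "(y, q ! i) \<in> E" by metis
      with y(2)[OF Wq[of i]] show False by simp
    qed
    assume "(q ! j, q ! i) \<in> E"
    then have "\<exists>j. ?back j \<and> j < ?n" using ij by blast
    then have "\<exists>j. (?back j \<and> j < ?n) \<and> (\<forall>j'. ?back j' \<and> j' < ?n \<longrightarrow> j' \<le> j)"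
      using Nat.ex_has_greatest_nat[of "\<lambda>j. ?back j \<and> j < ?n" _ ?n] by (metis (no_types, lifting) less_imp_le)
    then obtain j where j: "?back j" "j < ?n" and max: "\<And>j'. ?back j' \<Longrightarrow> j' < ?n \<Longrightarrow> j' \<le> j"
      by blast
    from j(1) obtain i where i: "Suc i < j" "(q ! j, q ! i) \<in> E" by blast
    have j1: "j < ?n - 1" using not_last[OF j] .
    have "walk_arcs (drop j q) \<subseteq> E"
      using q(5) set_vwalk_arcs_append2[of "drop j q" "take j q"] by auto
    moreover have "\<forall>v\<in>set (butlast (drop j q)). W v"
      using q(3) by (auto simp: butlast_drop dest: in_set_dropD)
    \<comment> \<open>Arcs from \<open>q ! i\<close> to later vertices are forward chords, and arcs
      from vertices after \<open>j\<close> back to \<open>q ! i\<close> contradict the maximality of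
      \<open>j\<close>.\<close>
    moreover have "(q ! i, v) \<notin> E \<and> (v, q ! i) \<notin> E" if v: "v \<in> set (tl (drop j q))" for v
    proof -
      obtain k where k: "k < ?n - Suc j" "v = q ! (Suc j + k)"
        using v by (auto simp: in_set_conv_nth tl_drop drop_Suc[symmetric] nth_drop simp del: drop_Suc)
      then have "Suc i < Suc j + k" "Suc j + k < ?n" using i j by auto
      moreover from this have "(v, q ! i) \<notin> E" using max[of "Suc j + k"] k(2) by auto
      ultimately show ?thesis using forward[of i "Suc j + k"] k(2) by simp
    qed
    moreover have "hd (drop j q) = q ! j" using j by (simp add: hd_drop_conv_nth)
    ultimately have "link_path E W y (drop j q) (q ! i)"
      using i j1 q(2) Wq[of i] by (auto simp: link_path_def)
    from least[OF this] show False using i j by simp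
  qed
  \<comment> \<open>\<open>z\<close> differs from \<open>y\<close> by \<open>W\<close>; at an
    earlier position it would have an arc to the next vertex, which lies in
    \<open>tl q\<close>.\<close>
  have "z \<notin> set q"
  proof
    assume "z \<in> set q"
    then obtain k where k: "k < ?n" "z = q ! k" by (metis in_set_conv_nth)
    then have "k \<noteq> ?n - 1" using lastq q(4) y(1) by metis
    then have "Suc k < ?n" using k by simp
    with step[OF this] tlq(1)[of "Suc k"] k show False by simp
  qed
  moreover have "E \<inter> set q \<times> set q = walk_arcs q"
  proof
    show "walk_arcs q \<subseteq> E \<inter> set q \<times> set q" using q(5) by (auto dest: vwalk_arcsD)
    show "E \<inter> set q \<times> set q \<subseteq> walk_arcs q"
    proof clarify
      fix u v
      assume uv: "(u, v) \<in> E" "u \<in> set q" "v \<in> set q"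
      obtain i where i: "i < ?n" "u = q ! i" using uv(2) by (metis in_set_conv_nth)
      obtain j where j: "j < ?n" "v = q ! j" using uv(3) by (metis in_set_conv_nth)
      have "i \<noteq> j" using uv(1) asym i j by blast
      moreover have "\<not> Suc i < j" using forward[of i j] uv(1) i j by auto
      moreover have "\<not> Suc j < i" using backward[of j i] uv(1) i j by auto
      moreover have "i \<noteq> Suc j" using step[of j] asym uv(1) i j by auto
      ultimately have "j = Suc i" by linarith
      then show "(u, v) \<in> walk_arcs q" using i j by (auto simp: set_vwalk_arcs_nth)
    qed
  qed
  ultimately show ?thesis using qz dist by blast
qed

section \<open>Reachability, walks and the positions of \<open>P\<close>\<close>

lemma rtrancl_path:
  assumes "(t, u) \<in> {(u, v) \<in> E. free v}\<^sup>*"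
  shows "\<exists>q. q \<noteq> [] \<and> hd q = t \<and> last q = u \<and> walk_arcs q \<subseteq> E \<and> (\<forall>v\<in>set (tl q). free v)"
  using assms
proof (induction rule: rtrancl_induct)
  case base
  show ?case by (rule exI[of _ "[t]"]) simp
next
  case (step u v)
  then obtain q where q: "q \<noteq> []" "hd q = t" "last q = u" "walk_arcs q \<subseteq> E"
    "\<forall>v\<in>set (tl q). free v" by blast
  with step(2) show ?case
    by (intro exI[of _ "q @ [v]"]) (auto simp: vwalk_arcs_append)
qed

lemma path_rtrancl:
  assumes "q \<noteq> []" "walk_arcs q \<subseteq> E" "\<forall>v\<in>set (tl q). free v"
  shows "(hd q, last q) \<in> {(u, v) \<in> E. free v}\<^sup>*"
  using assms
proof (induction q rule: vwalk_arcs.induct)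
  case (3 x y xs)
  then have "(y, last (y # xs)) \<in> {(u, v) \<in> E. free v}\<^sup>*" by auto
  moreover have "(x, y) \<in> {(u, v) \<in> E. free v}" using 3 by auto
  ultimately show ?case by (simp add: converse_rtrancl_into_rtrancl)
qed auto

text \<open>The arcs of \<open>P\<close> between positions:
  \<open>0 \<rightarrow> \<dots> \<rightarrow> k \<leftarrow> \<dots> \<leftarrow> N - 2 \<rightarrow> N - 1\<close>.\<close>

definition pattern :: "nat \<Rightarrow> nat \<Rightarrow> nat \<Rightarrow> nat \<Rightarrow> bool" where
  "pattern k N i j \<longleftrightarrow> j = Suc i \<and> i < k \<or> i = Suc j \<and> k \<le> j \<and> i \<le> N - 2 \<or> i = N - 2 \<and> j = N - 1"

text \<open>The list for the second block stops at position \<open>N - 3\<close>, so it lacks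
  precisely the arc from \<open>N - 2\<close> to \<open>N - 3\<close>, the pair excluded by the last
  assumption.\<close>

lemma pattern_iff_arcs:
  assumes "inj_on f {..<N}" "k + 3 \<le> N" "i < N" "j < N" "(i, j) \<noteq> (N - 2, N - 3)"
  shows "(f i, f j) \<in> walk_arcs (map f [0..<Suc k]) \<union>
      walk_arcs (rev (map f [k..<N - 2])) \<union> {(f (N - 2), f (N - 1))} \<longleftrightarrow> pattern k N i j"
proof -
  have inj: "f l = f l' \<longleftrightarrow> l = l'" if "l < N" "l' < N" for l l'
    using inj_onD[OF assms(1)] that by auto
  have "walk_arcs (map f [0..<Suc k]) = {(f l, f (Suc l)) | l. l < k}"
    unfolding set_vwalk_arcs_nth
    by (intro Collect_cong ex_cong1) (auto simp: nth_map_upt simp del: upt_Suc)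
  then have "(f i, f j) \<in> walk_arcs (map f [0..<Suc k]) \<longleftrightarrow> (\<exists>l<k. f i = f l \<and> f j = f (Suc l))"
    by auto
  also have "\<dots> \<longleftrightarrow> (\<exists>l<k. i = l \<and> j = Suc l)"
  proof -
    have "f i = f l \<and> f j = f (Suc l) \<longleftrightarrow> i = l \<and> j = Suc l" if "l < k" for l
      using inj[of i l] inj[of j "Suc l"] that assms(2-4) by simp
    then show ?thesis by blast
  qed
  also have "\<dots> \<longleftrightarrow> j = Suc i \<and> i < k" by auto
  finally have 1: "(f i, f j) \<in> walk_arcs (map f [0..<Suc k]) \<longleftrightarrow> j = Suc i \<and> i < k" .
  have "(f i, f j) \<in> walk_arcs (rev (map f [k..<N - 2])) \<longleftrightarrow>
      (\<exists>l. Suc l < N - 2 - k \<and> f j = f (k + l) \<and> f i = f (Suc (k + l)))"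
    unfolding set_vwalk_arcs_rev converse_iff
    unfolding set_vwalk_arcs_nth mem_Collect_eq
    by (intro ex_cong1) (auto simp: nth_map_upt)
  also have "\<dots> \<longleftrightarrow> (\<exists>l. Suc l < N - 2 - k \<and> j = k + l \<and> i = Suc (k + l))"
  proof (intro ex_cong1 conj_cong refl)
    fix l
    assume "Suc l < N - 2 - k"
    then show "f j = f (k + l) \<longleftrightarrow> j = k + l" "f i = f (Suc (k + l)) \<longleftrightarrow> i = Suc (k + l)"
      using inj[of j "k + l"] inj[of i "Suc (k + l)"] assms(3,4) by simp_all
  qed
  also have "\<dots> \<longleftrightarrow> i = Suc j \<and> k \<le> j \<and> i < N - 2"
    by (auto intro!: exI[of _ "j - k"])
  finally have 2: "(f i, f j) \<in> walk_arcs (rev (map f [k..<N - 2])) \<longleftrightarrow>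
      i = Suc j \<and> k \<le> j \<and> i < N - 2" .
  have 3: "(f i, f j) = (f (N - 2), f (N - 1)) \<longleftrightarrow> i = N - 2 \<and> j = N - 1"
    using inj[of i "N - 2"] inj[of j "N - 1"] assms by auto
  show ?thesis unfolding pattern_def Un_iff 1 2 singleton_iff 3 using assms(2,5) by auto
qed

lemma shape_if_linked:
  assumes E: "E \<subseteq> V \<times> V" "\<And>u v. (u, v) \<in> E \<Longrightarrow> (v, u) \<notin> E"
    and k: "1 \<le> k" "k + 3 \<le> N"
    and f: "\<forall>i<N. f i \<in> V" "partial_copy E N (pattern k N) f" "linked E N f"
  shows "\<exists>a b z U. U \<subseteq> V \<and> shape a b z U (E \<inter> U \<times> U) \<and> length a = Suc k \<and> N - 1 - k \<le> length b"
proof -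
  have inj: "inj_on f {..<N}"
    and copy: "\<And>i j. i < N \<Longrightarrow> j < N \<Longrightarrow> (i, j) \<noteq> (N - 2, N - 3) \<Longrightarrow> (f i, f j) \<in> E \<longleftrightarrow> pattern k N i j"
    using f(2) by (auto simp: partial_copy_def)
  have inj_iff: "f l = f l' \<longleftrightarrow> l = l'" if "l < N" "l' < N" for l l'
    using inj_onD[OF inj] that by auto
  define a c t y where "a = map f [0..<Suc k]" and "c = rev (map f [k..<N - 2])"
    and "t = f (N - 2)" and "y = f (N - 3)"
  define z where "z = f (N - 1)"
  \<comment> \<open>\<open>F\<close> is the part of the guess that stays fixed, whereas
    \<open>t\<close> and \<open>z\<close> may still be exchanged. \<open>W\<close> expresses that a
    vertex outside \<open>F\<close> fits to \<open>F\<close>, whichever role it plays.\<close>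
  define F where "F = f ` {..<N - 2}"
  define W where "W v \<longleftrightarrow> v \<notin> F \<and> (\<forall>x\<in>F. (x, v) \<notin> E) \<and> (\<forall>x\<in>F - {y}. (v, x) \<notin> E)" for v
  have F: "set a \<union> set c = F"
  proof -
    have "{0..<Suc k} \<union> {k..<N - 2} = {..<N - 2}" using k by auto
    then show ?thesis unfolding F_def a_def c_def set_rev set_map set_upt image_Un[symmetric] by simp
  qed
  have yF: "y \<in> F" using k by (auto simp: F_def y_def)
  have Wt: "W t"
    unfolding W_def F_def
  proof (intro conjI ballI notI)
    assume "t \<in> f ` {..<N - 2}"
    then show False using inj_iff by (auto simp: t_def)
  next
    fix x
    assume "x \<in> f ` {..<N - 2}" and e: "(x, t) \<in> E"
    then obtain i where "i < N - 2" "x = f i" by auto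
    then show False using copy[of i "N - 2"] e k by (auto simp: t_def pattern_def)
  next
    fix x
    assume "x \<in> f ` {..<N - 2} - {y}" and e: "(t, x) \<in> E"
    then obtain i where "i < N - 2" "x = f i" "i \<noteq> N - 3" by (auto simp: y_def)
    then show False using copy[of "N - 2" i] e k by (auto simp: t_def pattern_def)
  qed
  have z_nonadj: "(x, z) \<notin> E" "(z, x) \<notin> E" if xF: "x \<in> F" for x
  proof -
    obtain i where i: "i < N - 2" "x = f i" using xF by (auto simp: F_def)
    then have "i < N" "N - 1 < N" "(i, N - 1) \<noteq> (N - 2, N - 3)" "(N - 1, i) \<noteq> (N - 2, N - 3)"
      using k by auto
    moreover have "\<not> pattern k N i (N - 1)" "\<not> pattern k N (N - 1) i"
      unfolding pattern_def using i(1) k by arith+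
    ultimately show "(x, z) \<notin> E" "(z, x) \<notin> E"
      using copy[of i "N - 1"] copy[of "N - 1" i] unfolding z_def i(2) by simp_all
  qed
  have "z \<notin> F" using inj_iff by (auto simp: z_def F_def)
  then have Wz: "W z" using z_nonadj by (auto simp: W_def)
  have tz: "(t, z) \<in> E" using copy[of "N - 2" "N - 1"] k by (simp add: t_def z_def pattern_def)
  obtain u where u: "(t, u) \<in> {(u, v) \<in> E. free_vertex E N f v}\<^sup>*" "(u, y) \<in> E"
    using f(3) unfolding linked_def t_def y_def by blast
  obtain q0 where q0: "q0 \<noteq> []" "hd q0 = t" "last q0 = u" "walk_arcs q0 \<subseteq> E"
    "\<forall>v\<in>set (tl q0). free_vertex E N f v"
    using rtrancl_path[OF u(1)] by blast
  have free: "W v \<and> (z, v) \<notin> E \<and> (v, z) \<notin> E" if "free_vertex E N f v" for v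
  proof -
    have "W v"
      unfolding W_def F_def
    proof (intro conjI ballI notI)
      fix x
      assume "x \<in> f ` {..<N - 2} - {y}" and e: "(v, x) \<in> E"
      then obtain i where "i < N - 2" "x = f i" "i \<noteq> N - 3" by (auto simp: y_def)
      moreover from this have "i < N" "i \<noteq> N - 2" by auto
      ultimately show False using that e by (auto simp: free_vertex_def)
    next
      assume "v \<in> f ` {..<N - 2}"
      then obtain i where "i < N - 2" "v = f i" by auto
      moreover from this have "i < N" by auto
      ultimately show False using that by (auto simp: free_vertex_def)
    next
      fix x
      assume "x \<in> f ` {..<N - 2}" and e: "(x, v) \<in> E"
      then obtain i where "i < N - 2" "x = f i" by auto
      moreover from this have "i < N" "i \<noteq> N - 2" by auto
      ultimately show False using that e by (auto simp: free_vertex_def)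
    qed
    moreover have "N - 1 < N" "N - 1 \<noteq> N - 2" "N - 1 \<noteq> N - 3" using k by auto
    then have "(z, v) \<notin> E \<and> (v, z) \<notin> E" using that unfolding free_vertex_def z_def by blast
    ultimately show ?thesis by simp
  qed
  have "link_path E W y (q0 @ [y]) z"
    unfolding link_path_def
  proof (intro conjI ballI)
    show "2 \<le> length (q0 @ [y])" using q0(1) by (cases q0) auto
    show "walk_arcs (q0 @ [y]) \<subseteq> E" using q0 u(2) by (simp add: vwalk_arcs_append)
    show "(hd (q0 @ [y]), z) \<in> E" using q0 tz by simp
  next
    fix v
    assume "v \<in> set (butlast (q0 @ [y]))"
    then have "v = t \<or> v \<in> set (tl q0)" using q0(1,2) by (cases q0) auto
    then show "W v" using Wt free q0(5) by auto
  next
    fix v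
    assume "v \<in> set (tl (q0 @ [y]))"
    then have "v = y \<or> v \<in> set (tl q0)" using q0(1) by (cases q0) auto
    then show "(z, v) \<notin> E" "(v, z) \<notin> E" using free q0(5) z_nonadj[OF yF] by auto
  qed (use Wz in auto)
  moreover have "\<not> W y" "\<And>v. W v \<Longrightarrow> (y, v) \<notin> E" using yF by (auto simp: W_def)
  \<comment> \<open>From here on \<open>z\<close> is the vertex that comes with the shortest path,
    and it need not be \<open>f (N - 1)\<close>.\<close>
  ultimately obtain q z where qz: "link_path E W y q z" "distinct q" "z \<notin> set q"
    "E \<inter> set q \<times> set q = walk_arcs q"
    using induced_link_path[of E W y] E(2) by blast
  then have q: "2 \<le> length q" "last q = y" "\<forall>v\<in>set (butlast q). W v" "W z" "walk_arcs q \<subseteq> E"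
    "(hd q, z) \<in> E" "\<forall>v\<in>set (tl q). (z, v) \<notin> E \<and> (v, z) \<notin> E"
    by (simp_all add: link_path_def)
  have qne: "q \<noteq> []" "butlast q \<noteq> []" using q(1) by (auto simp: Suc_le_length_iff numeral_2_eq_2)
  have cne: "c \<noteq> []" "length c = N - 2 - k" using k by (auto simp: c_def)
  have hdc: "hd c = y" unfolding c_def y_def using k by (simp add: hd_rev last_map)
  have lastc: "last c = f k" unfolding c_def using k by (simp add: last_rev hd_map)
  define b where "b = butlast q @ c"
  define U where "U = set a \<union> set b \<union> {z}"
  have setq: "set q = insert y (set (butlast q))" using set_butlast_last[OF qne(1)] q(2) by simp
  have U: "U = F \<union> set q \<union> {z}" using F yF by (auto simp: U_def b_def setq)
  have arcs_b: "walk_arcs b = walk_arcs q \<union> walk_arcs c"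
    unfolding b_def by (rule vwalk_arcs_butlast_join[OF qne(1) cne(1)]) (simp add: q(2) hdc)
  have hdb: "hd b = hd q" using qne by (cases q) (auto simp: b_def)
  have core: "E \<inter> F \<times> F = walk_arcs a \<union> walk_arcs c"
  proof -
    have "(f i, f j) \<in> E \<longleftrightarrow> (f i, f j) \<in> walk_arcs a \<union> walk_arcs c"
      if ij: "i < N - 2" "j < N - 2" for i j
    proof -
      have "(f i, f j) \<noteq> (f (N - 2), f (N - 1))" using inj_iff[of i "N - 2"] ij by auto
      then show ?thesis
        using copy[of i j] pattern_iff_arcs[OF inj k(2), of i j] ij
        unfolding a_def c_def by auto
    qed
    moreover have "walk_arcs a \<union> walk_arcs c \<subseteq> F \<times> F"
      using F by (auto dest!: vwalk_arcsD)
    ultimately show ?thesis unfolding F_def by blast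
  qed
  \<comment> \<open>By \<open>W\<close>, an arc between \<open>F\<close> and the new vertices can
    only enter \<open>y\<close>. From \<open>q\<close> it is then an arc of the induced path, and
    from \<open>z\<close> it is impossible because \<open>y\<close> lies in
    \<open>tl q\<close>.\<close>
  have "E \<inter> U \<times> U = walk_arcs a \<union> walk_arcs b \<union> {(hd b, z)}"
  proof
    show "walk_arcs a \<union> walk_arcs b \<union> {(hd b, z)} \<subseteq> E \<inter> U \<times> U"
    proof -
      let ?X = "E \<inter> (F \<union> set q \<union> {z}) \<times> (F \<union> set q \<union> {z})"
      have "walk_arcs a \<union> walk_arcs c \<subseteq> ?X" unfolding core[symmetric] by auto
      moreover have "walk_arcs q \<subseteq> ?X" unfolding qz(4)[symmetric] by auto
      moreover have "hd q \<in> set q" using qne by simp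
      then have "(hd q, z) \<in> ?X" using q(6) by simp
      ultimately show ?thesis unfolding arcs_b hdb U by simp
    qed
    show "E \<inter> U \<times> U \<subseteq> walk_arcs a \<union> walk_arcs b \<union> {(hd b, z)}"
    proof (rule subsetI)
      fix e
      assume "e \<in> E \<inter> U \<times> U"
      then obtain u v where e: "e = (u, v)" and uv: "(u, v) \<in> E" "u \<in> U" "v \<in> U" by auto
      have cases: "x \<in> F \<or> W x \<and> x \<in> set q \<or> x = z" if "x \<in> U" for x
        using that q(3) yF unfolding U setq by auto
      have "tl q \<noteq> []" "last (tl q) = y" using q(1,2) by (cases q; auto)+
      then have ytl: "y \<in> set (tl q)" by (metis last_in_set)
      have ends: "x = hd q \<or> x \<in> set (tl q)" if "x \<in> set q" for x using that by (cases q) auto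
      consider "u \<in> F" "v \<in> F" | "u \<in> F" "W v" | "u \<in> set q" "v \<in> set q" | "W u" "v \<in> F" "u = z"
        | "W u" "v \<in> F" "u \<in> set q" | "u \<in> set q" "v = z" | "u = z" "v \<in> set q" | "u = z" "v = z"
        using cases[OF uv(2)] cases[OF uv(3)] q(4) by blast
      then have "(u, v) \<in> walk_arcs a \<union> (walk_arcs q \<union> walk_arcs c) \<union> {(hd q, z)}"
      proof cases
        case 1
        then have "(u, v) \<in> E \<inter> F \<times> F" using uv(1) by simp
        then show ?thesis
          unfolding core by blast
      next
        case 2
        then have False using uv(1) by (auto simp: W_def)
        then show ?thesis ..
      next
        case 3
        then have "(u, v) \<in> E \<inter> set q \<times> set q" using uv(1) by simp
        then show ?thesis
          unfolding qz(4) by blast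
      next
        case 4
        then have "v = y" using uv(1) by (auto simp: W_def)
        then have False using 4 uv(1) q(7) ytl by blast
        then show ?thesis ..
      next
        case 5
        then have "v = y" using uv(1) by (auto simp: W_def)
        moreover have "y \<in> set q" using setq by simp
        ultimately have "(u, v) \<in> E \<inter> set q \<times> set q" using 5(3) uv(1) by simp
        then show ?thesis
          unfolding qz(4) by blast
      next
        case 6
        then have "u = hd q" using ends uv(1) q(7) by blast
        then show ?thesis
          using 6 by blast
      next
        case 7
        then have False using ends uv(1) q(6,7) E(2) by blast
        then show ?thesis ..
      next
        case 8
        then have False using uv(1) E(2) by blast
        then show ?thesis ..
      qed
      then show "e \<in> walk_arcs a \<union> walk_arcs b \<union> {(hd b, z)}"
        unfolding e arcs_b hdb .
    qed
  qed
  moreover have "distinct (a @ butlast b @ [z])"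
  proof -
    have bc: "butlast c = rev (map f [Suc k..<N - 2])"
      unfolding c_def using k by (subst upt_conv_Cons) auto
    have "distinct (a @ map f [Suc k..<N - 2])"
    proof -
      have "a @ map f [Suc k..<N - 2] = map f [0..<N - 2]"
        unfolding a_def map_append[symmetric] using k upt_add_eq_append[of 0 "Suc k" "N - 3 - k"]
        by (simp add: Suc_diff_Suc numeral_eq_Suc)
      moreover have "inj_on f {0..<N - 2}" using inj by (rule inj_on_subset) auto
      ultimately show ?thesis by (simp only: distinct_map set_upt) simp
    qed
    then have "distinct (a @ butlast c)" unfolding bc by auto
    moreover have "distinct (butlast q)" using qz(2) by (rule distinct_butlast)
    moreover have "set (butlast q) \<inter> F = {}" using q(3) by (auto simp: W_def)
    moreover have "set a \<subseteq> F" "set (butlast c) \<subseteq> F" using F by (auto dest: in_set_butlastD)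
    moreover have "z \<notin> F" "z \<notin> set (butlast q)" using q(4) qz(3) by (auto simp: W_def dest: in_set_butlastD)
    ultimately show ?thesis using cne(1) unfolding b_def butlast_append by auto
  qed
  moreover have "last a = f k" by (simp add: a_def)
  moreover have "last b = last c" "b \<noteq> []" using cne(1) by (simp_all add: b_def)
  moreover have "a \<noteq> []" by (simp add: a_def)
  ultimately have "shape a b z U (E \<inter> U \<times> U)"
    using lastc unfolding shape_def by (simp add: U_def)
  moreover have "U \<subseteq> V"
  proof -
    have "q ! i \<in> V" if "i < length q" for i
    proof (cases i)
      case 0
      then show ?thesis using q(6) E(1) qne(1) by (auto simp: hd_conv_nth)
    next
      case (Suc j)
      then have "(q ! j, q ! i) \<in> E" using q(5) that by (auto simp: set_vwalk_arcs_nth)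
      then show ?thesis using E(1) by blast
    qed
    then have "set q \<subseteq> V" by (metis in_set_conv_nth subsetI)
    moreover have "F \<subseteq> V" using f(1) by (auto simp: F_def)
    ultimately show ?thesis unfolding U using q(6) E(1) by blast
  qed
  \<comment> \<open>\<open>c\<close> has \<open>N - 2 - k\<close> vertices, and
    \<open>butlast q\<close> has at least one.\<close>
  moreover have "N - 1 - k \<le> length b" using cne(2) q(1) by (simp add: b_def)
  moreover have "length a = Suc k" by (simp add: a_def)
  ultimately show ?thesis by blast
qed

text \<open>\<open>b\<close> is cut so that its end part \<open>c\<close> has the length prescribed
  by \<open>P\<close>; everything between \<open>t\<close> and the head \<open>y\<close> of
  \<open>c\<close> is left to the search. As the shape is induced, the vertices strictly between
  them are free.\<close>

lemma linked_if_shape: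
  assumes k: "1 \<le> k" "k + 3 \<le> N"
    and U: "U \<subseteq> V" "shape a b z U (E \<inter> U \<times> U)" "length a = Suc k" "N - 1 - k \<le> length b"
  shows "\<exists>f. (\<forall>i<N. f i \<in> V) \<and> partial_copy E N (pattern k N) f \<and> linked E N f"
proof -
  note d = shape_distinct[OF U(2)]
  have sh: "a \<noteq> []" "b \<noteq> []" "last a = last b" "U = set a \<union> set b \<union> {z}"
    "E \<inter> U \<times> U = walk_arcs a \<union> walk_arcs b \<union> {(hd b, z)}"
    using U(2) unfolding shape_def by blast+
  \<comment> \<open>The second block of \<open>P\<close> has \<open>N - 1 - k\<close> vertices. All
    but \<open>t\<close> are matched by \<open>c\<close>, which explains \<open>N - 2 - k\<close>;
    thus \<open>l\<close> is the position of \<open>y\<close> in \<open>b\<close>.\<close>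
  define l where "l = length b - (N - 2 - k)"
  have l: "1 \<le> l" "l < length b" using U(4) k by (auto simp: l_def)
  define c q t s where "c = drop l b" and "q = take (Suc l) b" and "t = hd b" and "s = last b"
  have cne: "c \<noteq> []" "length c = N - 2 - k" "last c = s" using l k U(4) by (auto simp: c_def l_def s_def)
  have qne: "q \<noteq> []" "2 \<le> length q" "hd q = t" "last q = hd c"
    using l sh(2)
    by (auto simp: q_def c_def t_def take_Suc_conv_app_nth hd_drop_conv_nth)
  have dq: "distinct q" using d(2) by (simp add: q_def)
  have bl: "butlast q = take l b" using l by (simp add: q_def take_Suc_conv_app_nth)
  have b: "b = butlast q @ c" unfolding bl c_def by simp
  have arcs_b: "walk_arcs b = walk_arcs q \<union> walk_arcs c"
    unfolding b by (rule vwalk_arcs_butlast_join[OF qne(1) cne(1) qne(4)])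
  have dqc: "set (butlast q) \<inter> set c = {}" "distinct c" using d(2) unfolding b by auto
  have tb: "t \<in> set (butlast q)" using l sh(2) unfolding bl t_def by (cases b; cases l) auto
  \<comment> \<open>The order of \<open>P\<close>: the first block up to \<open>s\<close>, then
    \<open>c\<close> backwards from the vertex before \<open>s\<close> up to \<open>y\<close>, then
    \<open>t\<close> and \<open>z\<close>.\<close>
  define fs where "fs = a @ tl (rev c) @ [t, z]"
  have rc: "rev c = s # tl (rev c)" using cne by (metis hd_Cons_tl hd_rev rev_is_Nil_conv)
  have len: "length fs = N" using U(3) cne(2) k by (simp add: fs_def)
  have sc: "set c = insert s (set (tl (rev c)))" by (metis rc list.simps(15) set_rev)
  have dr: "s \<notin> set (tl (rev c))" "distinct (tl (rev c))"
    using dqc(2) rc by (metis distinct.simps(2) distinct_rev)+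
  have cb: "set c \<subseteq> set b" "set (butlast q) \<subseteq> set b" "set q \<subseteq> set b" unfolding b[symmetric]
    using b set_append[of "butlast q" c] by (auto simp: q_def dest: in_set_takeD)
  have "t \<notin> set c" using tb dqc(1) by blast
  then have ts: "t \<noteq> s" using sc by auto
  have ta: "t \<notin> set a" using d(3) tb cb ts unfolding s_def by blast
  have tlc: "set (tl (rev c)) \<subseteq> set c" using sc by (metis subset_insertI)
  have "set a \<inter> set (tl (rev c)) = {}"
  proof (rule equals0I)
    fix x
    assume x: "x \<in> set a \<inter> set (tl (rev c))"
    then have "x \<in> set a \<inter> set b" using tlc cb(1) by auto
    then have "x = s" unfolding d(3) s_def by simp
    with x dr(1) show False by simp
  qed
  moreover have "t \<in> set b" using tb cb(2) by (rule set_rev_mp)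
  ultimately have dfs: "distinct fs"
    unfolding fs_def distinct_append using d(1,4,5) dr(2) ta tlc \<open>t \<notin> set c\<close> cb(1) by auto
  define f where "f i = fs ! i" for i
  have inj: "inj_on f {..<N}" using dfs len by (auto simp: f_def inj_on_def nth_eq_iff_index_eq)
  have inj_iff: "f i = f j \<longleftrightarrow> i = j" if "i < N" "j < N" for i j
    using inj_onD[OF inj] that by auto
  have fU: "f i \<in> U" if "i < N" for i
  proof -
    have "f i \<in> set fs" using that len by (simp add: f_def)
    then have "f i \<in> set a \<or> f i \<in> set c \<or> f i = t \<or> f i = z" unfolding fs_def sc by auto
    then show ?thesis unfolding sh(4) using cb tb by blast
  qed
  have fa: "map f [0..<Suc k] = a"
    by (rule nth_equalityI) (use U(3) in \<open>auto simp: f_def fs_def nth_append simp del: upt_Suc\<close>)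
  have fc: "map f [k..<N - 2] = rev c"
  proof (rule nth_equalityI)
    show "length (map f [k..<N - 2]) = length (rev c)" using cne(2) by simp
    fix i
    assume "i < length (map f [k..<N - 2])"
    then have i: "i < N - 2 - k" by simp
    show "map f [k..<N - 2] ! i = rev c ! i"
    proof (cases i)
      case 0
      have "f k = last a" using U(3) sh(1) by (simp add: f_def fs_def nth_append last_conv_nth)
      then show ?thesis using 0 i sh(3) by (subst rc) (simp add: nth_map_upt s_def)
    next
      case (Suc j)
      have "j < length (tl (rev c))" using i Suc cne(2) by simp
      moreover have "f (k + i) = (tl (rev c) @ [t, z]) ! j"
        using Suc U(3) by (simp add: f_def fs_def nth_append)
      ultimately show ?thesis using i Suc by (subst rc) (simp add: nth_map_upt nth_append)
    qed
  qed
  have ft: "f (N - 2) = t" and fz: "f (N - 1) = z"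
  proof -
    have "N - 2 = length (a @ tl (rev c)) + 0" "N - 1 = length (a @ tl (rev c)) + 1"
      using U(3) cne(2) k by simp_all
    then show "f (N - 2) = t" "f (N - 1) = z"
      unfolding f_def fs_def append_assoc[symmetric] by (simp_all only: nth_append_length_plus) simp_all
  qed
  have fy: "f (N - 3) = hd c"
  proof -
    have "hd c = last (map f [k..<N - 2])" unfolding fc by (simp add: last_rev cne(1))
    also have "\<dots> = f (N - 3)" using k by (simp add: last_map)
    finally show ?thesis ..
  qed
  \<comment> \<open>\<open>t\<close> and \<open>y\<close> are the only guessed vertices on
    \<open>q\<close>, so the only arc of \<open>q\<close> that can join two of them is
    \<open>(t, y)\<close>, the exempted pair.\<close>
  have qf: "i = N - 2 \<or> i = N - 3" if "f i \<in> set q" "i < N" for i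
  proof -
    have "f i \<in> set (butlast q) \<or> f i = hd c"
      using that(1) set_butlast_last[OF qne(1)] qne(4) by auto
    then show ?thesis
    proof
      assume fi: "f i \<in> set (butlast q)"
      have "f i \<in> set fs" using that(2) len by (simp add: f_def)
      moreover have "f i \<notin> set c" using fi dqc(1) by blast
      moreover have "f i \<notin> set a"
      proof
        assume "f i \<in> set a"
        then have "f i = s" using d(3) cb(2) fi unfolding s_def by blast
        with \<open>f i \<notin> set c\<close> sc show False by simp
      qed
      moreover have "f i \<noteq> z" using fi d(5) cb(2) by auto
      ultimately have "f i = t" unfolding fs_def sc by auto
      then show ?thesis using inj_iff[of i "N - 2"] ft that(2) k by simp
    next
      assume "f i = hd c"
      then show ?thesis using inj_iff[of i "N - 3"] fy that(2) k by simp
    qed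
  qed
  have qarcs: "i = N - 2 \<and> j = N - 3" if "(f i, f j) \<in> walk_arcs q" "i < N" "j < N" for i j
  proof -
    have "f i \<in> set q" "f j \<in> set q" using vwalk_arcsD[OF that(1)] by auto
    moreover have "f j \<noteq> t" "f i \<noteq> hd c" using vwalk_arcs_not_ends[OF dq that(1)] qne(3,4) by auto
    ultimately show ?thesis using qf[of i] qf[of j] that(2,3) ft fy by auto
  qed
  have arcs: "(u, v) \<in> E \<longleftrightarrow> (u, v) \<in> walk_arcs a \<union> walk_arcs q \<union> walk_arcs c \<union> {(t, z)}"
    if "u \<in> U" "v \<in> U" for u v
  proof -
    have "(u, v) \<in> E \<longleftrightarrow> (u, v) \<in> E \<inter> U \<times> U" using that by simp
    then show ?thesis unfolding sh(5) arcs_b t_def by blast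
  qed
  have copy: "partial_copy E N (pattern k N) f"
    unfolding partial_copy_def
  proof (intro conjI allI impI)
    fix i j
    assume ij: "i < N" "j < N" "(i, j) \<noteq> (N - 2, N - 3)"
    have "(f i, f j) \<notin> walk_arcs q" using qarcs ij by auto
    then have "(f i, f j) \<in> E \<longleftrightarrow> (f i, f j) \<in> walk_arcs a \<union> walk_arcs c \<union> {(t, z)}"
      using arcs[OF fU[OF ij(1)] fU[OF ij(2)]] by blast
    then show "(f i, f j) \<in> E \<longleftrightarrow> pattern k N i j"
      using pattern_iff_arcs[OF inj k(2) ij] unfolding fa fc ft fz rev_rev_ident by blast
  qed (rule inj)
  \<comment> \<open>All arcs within \<open>U\<close> at an inner vertex of \<open>q\<close> belong
    to \<open>q\<close>, and no arc of \<open>q\<close> leaves its end \<open>y\<close>.\<close>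
  have free: "free_vertex E N f v" if v: "v \<in> set (tl (butlast q))" for v
  proof -
    have vb: "v \<in> set (butlast q)" "v \<noteq> t"
    proof -
      show "v \<in> set (butlast q)" using v by (cases "butlast q") auto
      have "butlast q = t # tl (butlast q)" using qne tb by (cases q) (auto split: if_splits)
      moreover have "distinct (butlast q)" using dq by (rule distinct_butlast)
      ultimately show "v \<noteq> t" using v by (metis distinct.simps(2))
    qed
    have vc: "v \<notin> set c" using vb(1) dqc(1) by blast
    have vU: "v \<in> U" using vb(1) cb(2) by (auto simp: sh(4))
    have va: "v \<notin> set a"
    proof
      assume "v \<in> set a"
      then have "v = s" using d(3) cb(2) vb unfolding s_def by blast
      with vc sc show False by simp
    qed
    have vz: "v \<noteq> z" using vb d(5) cb(2) by auto
    have ne: "v \<noteq> f i" if "i < N" for i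
    proof -
      have "f i \<in> set fs" using that len by (simp add: f_def)
      then have "f i \<in> set a \<or> f i \<in> set c \<or> f i = t \<or> f i = z" unfolding fs_def sc by auto
      then show ?thesis using va vc vz vb(2) by auto
    qed
    have in_q: "(u, w) \<in> walk_arcs q" if "(u, w) \<in> E" "u \<in> U" "w \<in> U" "u = v \<or> w = v" for u w
      using arcs[OF that(2,3)] that va vc vz vb(2) vwalk_arcsD[of u w a] vwalk_arcsD[of u w c] by auto
    show ?thesis
      unfolding free_vertex_def
    proof (intro conjI allI impI notI)
      fix i
      assume i: "i < N" "i \<noteq> N - 2 \<and> i \<noteq> N - 3" and "(v, f i) \<in> E"
      then have "(v, f i) \<in> walk_arcs q" using in_q vU fU by blast
      then have "f i \<in> set q" by (auto dest: vwalk_arcsD)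
      then show False using qf i by blast
    next
      fix i
      assume i: "i < N" "i \<noteq> N - 2" and "(f i, v) \<in> E"
      then have *: "(f i, v) \<in> walk_arcs q" using in_q vU fU by blast
      then have "f i \<in> set q" by (auto dest: vwalk_arcsD)
      then have "f i = hd c" using qf i fy by blast
      then show False using vwalk_arcs_not_ends(2)[OF dq *] qne(4) by simp
    qed (use ne in blast)
  qed
  have "linked E N f"
    unfolding linked_def ft fy
  proof (intro exI conjI)
    have bne: "butlast q \<noteq> []" using tb by auto
    have qq: "q = butlast q @ [hd c]" using qne(1,4) by (metis append_butlast_last_id)
    have qE: "walk_arcs q \<subseteq> E" using sh(5) arcs_b by blast
    have "vwalk_arcs q = vwalk_arcs (butlast q) @ [(last (butlast q), hd c)]"
      using vwalk_arcs_append[OF bne, of "[hd c]"] qq by simp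
    then have "walk_arcs (butlast q) \<subseteq> E" and lst: "(last (butlast q), hd c) \<in> E" using qE by auto
    moreover have "hd (butlast q) = t" using bne qne(3) qq by (metis hd_append2)
    ultimately show "(t, last (butlast q)) \<in> {(u, v). (u, v) \<in> E \<and> free_vertex E N f v}\<^sup>*"
      using path_rtrancl[OF bne, of E "free_vertex E N f"] free by auto
    show "(last (butlast q), hd c) \<in> E" by (rule lst)
  qed
  with copy fU U(1) show ?thesis by blast
qed

section \<open>The blocks of the given path\<close>

text \<open>Any two consecutive vertices are joined by exactly one arc, so \<open>P\<close> is
  determined by one sign for each position.\<close>

lemma oriented_path_arcs:
  assumes "oriented_path P xs"
  shows "(u, v) \<in> parcs P \<longleftrightarrow> (\<exists>l. Suc l < length xs \<and>
    (if (xs ! l, xs ! Suc l) \<in> parcs P then u = xs ! l \<and> v = xs ! Suc l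
     else u = xs ! Suc l \<and> v = xs ! l))"
proof -
  have op: "parcs P \<union> (parcs P)\<inverse> = walk_arcs xs \<union> (walk_arcs xs)\<inverse>"
    and anti: "\<And>u v. (u, v) \<in> parcs P \<Longrightarrow> (v, u) \<notin> parcs P"
    using assms by (auto simp: oriented_path_def oriented_graph_def)
  have arc: "(xs ! l, xs ! Suc l) \<in> parcs P \<or> (xs ! Suc l, xs ! l) \<in> parcs P" if "Suc l < length xs" for l
  proof -
    have "(xs ! l, xs ! Suc l) \<in> walk_arcs xs" using that by (auto simp: set_vwalk_arcs_nth)
    then have "(xs ! l, xs ! Suc l) \<in> parcs P \<union> (parcs P)\<inverse>" unfolding op by blast
    then show ?thesis by blast
  qed
  show ?thesis
  proof
    assume uv: "(u, v) \<in> parcs P"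
    then have "(u, v) \<in> parcs P \<union> (parcs P)\<inverse>" by blast
    then have "(u, v) \<in> walk_arcs xs \<or> (v, u) \<in> walk_arcs xs" unfolding op by blast
    then show "\<exists>l. Suc l < length xs \<and> (if (xs ! l, xs ! Suc l) \<in> parcs P then u = xs ! l \<and> v = xs ! Suc l
     else u = xs ! Suc l \<and> v = xs ! l)"
    proof
      assume "(u, v) \<in> walk_arcs xs"
      then obtain l where "Suc l < length xs" "u = xs ! l" "v = xs ! Suc l"
        by (auto simp: set_vwalk_arcs_nth)
      then show ?thesis using uv by (intro exI[of _ l]) simp
    next
      assume "(v, u) \<in> walk_arcs xs"
      then obtain l where "Suc l < length xs" "v = xs ! l" "u = xs ! Suc l"
        by (auto simp: set_vwalk_arcs_nth)
      then show ?thesis using anti[OF uv] by (intro exI[of _ l]) simp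
    qed
  next
    assume "\<exists>l. Suc l < length xs \<and> (if (xs ! l, xs ! Suc l) \<in> parcs P then u = xs ! l \<and> v = xs ! Suc l
     else u = xs ! Suc l \<and> v = xs ! l)"
    then obtain l where "Suc l < length xs"
      "if (xs ! l, xs ! Suc l) \<in> parcs P then u = xs ! l \<and> v = xs ! Suc l
       else u = xs ! Suc l \<and> v = xs ! l" by blast
    then show "(u, v) \<in> parcs P" using arc[of l] by (auto split: if_splits)
  qed
qed

lemma directed_segment_iff:
  assumes "oriented_path P xs"
  shows "directed_segment P xs (i, j) \<longleftrightarrow> i < j \<and> j < length xs \<and>
    (\<forall>l\<in>{i..<j}. (xs ! l, xs ! Suc l) \<in> parcs P \<longleftrightarrow> (xs ! i, xs ! Suc i) \<in> parcs P)"
proof -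
  have anti: "\<And>u v. (u, v) \<in> parcs P \<Longrightarrow> (v, u) \<notin> parcs P"
    using assms by (auto simp: oriented_path_def oriented_graph_def)
  have rev: "(xs ! Suc l, xs ! l) \<in> parcs P \<longleftrightarrow> (xs ! l, xs ! Suc l) \<notin> parcs P"
    if "Suc l < length xs" for l
  proof
    assume "(xs ! l, xs ! Suc l) \<notin> parcs P"
    then show "(xs ! Suc l, xs ! l) \<in> parcs P"
      using that by (subst oriented_path_arcs[OF assms]) (intro exI[of _ l], simp)
  qed (rule anti)
  show ?thesis
  proof (cases "i < j \<and> j < length xs")
    case True
    then have "(\<forall>l\<in>{i..<j}. (xs ! Suc l, xs ! l) \<in> parcs P) \<longleftrightarrow>
        (\<forall>l\<in>{i..<j}. (xs ! l, xs ! Suc l) \<notin> parcs P)"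
      using rev by (intro ball_cong refl) simp
    moreover have "i \<in> {i..<j}" using True by simp
    ultimately show ?thesis using True unfolding directed_segment_def by auto
  qed (auto simp: directed_segment_def)
qed

lemma blocksD:
  assumes "(i, j) \<in> blocks P xs"
  shows "directed_segment P xs (i, j)"
    and "directed_segment P xs (i', j') \<Longrightarrow> i' \<le> i \<Longrightarrow> j \<le> j' \<Longrightarrow> i' = i \<and> j' = j"
proof -
  have *: "directed_segment P xs (i, j) \<and> (\<forall>i' j'. directed_segment P xs (i', j') \<and> i' \<le> i \<and> j \<le> j' \<longrightarrow>
      i' = i \<and> j' = j)"
    using assms unfolding blocks_def mem_Collect_eq prod.case .
  show "directed_segment P xs (i, j)" by (rule conjunct1[OF *])
  show "directed_segment P xs (i', j') \<Longrightarrow> i' \<le> i \<Longrightarrow> j \<le> j' \<Longrightarrow> i' = i \<and> j' = j"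
    by (rule conjunct2[OF *, rule_format]) simp
qed

text \<open>A block is determined by its first vertex, which is the origin or a point where the direction
  changes.\<close>

lemma card_blocks:
  assumes P: "oriented_path P xs"
  shows "card (blocks P xs) = card {i. Suc i < length xs \<and> (i = 0 \<or>
    ((xs ! (i - 1), xs ! Suc (i - 1)) \<in> parcs P) \<noteq> ((xs ! i, xs ! Suc i) \<in> parcs P))}"
    (is "_ = card ?S")
proof -
  define s where "s l \<longleftrightarrow> (xs ! l, xs ! Suc l) \<in> parcs P" for l
  have S: "i \<in> ?S \<longleftrightarrow> Suc i < length xs \<and> (i = 0 \<or> s (i - 1) \<noteq> s i)" for i
    unfolding s_def mem_Collect_eq by (rule refl)
  have seg: "directed_segment P xs (i, j) \<longleftrightarrow> i < j \<and> j < length xs \<and> (\<forall>l\<in>{i..<j}. s l = s i)" for i j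
    unfolding s_def by (rule directed_segment_iff[OF P])
  have start: "i \<in> ?S" if ij: "(i, j) \<in> blocks P xs" for i j
  proof -
    have d: "i < j" "j < length xs" "\<forall>l\<in>{i..<j}. s l = s i"
      using blocksD(1)[OF ij] unfolding seg by blast+
    have "s (i - 1) \<noteq> s i" if "i \<noteq> 0"
    proof
      assume eq: "s (i - 1) = s i"
      have "s l = s (i - 1)" if "l \<in> {i - 1..<j}" for l
      proof (cases "l = i - 1")
        case False
        then have "l \<in> {i..<j}" using that by auto
        with d(3) eq show ?thesis by blast
      qed simp
      then have "\<forall>l\<in>{i - 1..<j}. s l = s (i - 1)" by blast
      moreover have "i - 1 < j" using d(1) by simp
      ultimately have "directed_segment P xs (i - 1, j)" using d(2) unfolding seg by blast
      from blocksD(2)[OF ij this diff_le_self order_refl] that show False by simp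
    qed
    with d(1,2) show ?thesis unfolding S by auto
  qed
  have "bij_betw fst (blocks P xs) ?S"
    unfolding bij_betw_def
  proof
    show "inj_on fst (blocks P xs)"
    proof (rule inj_onI)
      fix e e'
      assume e: "e \<in> blocks P xs" "e' \<in> blocks P xs" "fst e = fst e'"
      obtain i j j' where ij: "e = (i, j)" "e' = (i, j')" using e(3) by (cases e; cases e') auto
      show "e = e'"
        using blocksD(2)[OF e(1)[unfolded ij] blocksD(1)[OF e(2)[unfolded ij]]]
          blocksD(2)[OF e(2)[unfolded ij] blocksD(1)[OF e(1)[unfolded ij]]]
        by (cases "j \<le> j'") (simp_all add: ij)
    qed
    show "fst ` blocks P xs = ?S"
    proof
      show "fst ` blocks P xs \<subseteq> ?S"
      proof
        fix i
        assume "i \<in> fst ` blocks P xs"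
        then obtain j where "(i, j) \<in> blocks P xs" by auto
        then show "i \<in> ?S" by (rule start)
      qed
      show "?S \<subseteq> fst ` blocks P xs"
      proof
        fix i
        assume "i \<in> ?S"
        then have i: "Suc i < length xs" "i = 0 \<or> s (i - 1) \<noteq> s i" unfolding S by blast+
        \<comment> \<open>The block starting at \<open>i\<close> is the longest directed segment
          from there; it cannot be extended to the left, since \<open>i\<close> is 0 or a change of
          direction.\<close>
        define J where "J = {j. directed_segment P xs (i, j)}"
        have "J \<subseteq> {..<length xs}" unfolding J_def seg by auto
        then have "finite J" by (rule finite_subset) simp
        moreover have "Suc i \<in> J" unfolding J_def mem_Collect_eq seg using i(1) by (auto simp: le_less_Suc_eq)
        ultimately have j: "Max J \<in> J" "\<And>j. j \<in> J \<Longrightarrow> j \<le> Max J" using Max_in by auto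
        have d: "directed_segment P xs (i, Max J)" using j(1) by (simp add: J_def)
        have max: "i' = i \<and> j' = Max J"
          if ij': "directed_segment P xs (i', j')" "i' \<le> i" "Max J \<le> j'" for i' j'
        proof -
          have c: "s l = s i'" if "l \<in> {i'..<j'}" for l using ij'(1) that unfolding seg by blast
          have "i < Max J" using d unfolding seg by blast
          then have ij: "i < j'" using ij'(3) by simp
          have "i' = i"
          proof (rule ccontr)
            assume "i' \<noteq> i"
            then have "i - 1 \<in> {i'..<j'}" "i \<in> {i'..<j'}" "i \<noteq> 0" using ij'(2) ij by auto
            then show False using c[of i] c[of "i - 1"] i(2) by blast
          qed
          then have "j' \<in> J" using ij'(1) by (simp add: J_def)
          then show ?thesis using j(2) ij'(3) \<open>i' = i\<close> by (simp add: antisym)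
        qed
        have "(i, Max J) \<in> blocks P xs"
          unfolding blocks_def mem_Collect_eq prod.case
          by (intro conjI d allI impI; elim conjE) (simp_all add: max)
        then show "i \<in> fst ` blocks P xs" by (rule rev_image_eqI) simp
      qed
    qed
  qed
  then show ?thesis by (rule bij_betw_same_card)
qed

text \<open>Three blocks mean two changes of direction. A last block of length 1 puts one of them at
  \<open>length xs - 2\<close>; the other one is \<open>k\<close>, the length of the first
  block.\<close>

lemma three_blocks_last_one:
  assumes P: "oriented_path P xs" and three: "card (blocks P xs) = 3"
    and last: "\<exists>i j. (i, j) \<in> blocks P xs \<and> j = length xs - 1 \<and> j - i = 1"
  shows "\<exists>k. 1 \<le> k \<and> k + 3 \<le> length xs \<and> (\<forall>l. Suc l < length xs \<longrightarrow>
    ((xs ! l, xs ! Suc l) \<in> parcs P \<longleftrightarrow> (xs ! 0, xs ! 1) \<in> parcs P) = (l < k \<or> l = length xs - 2))"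
proof -
  let ?s = "\<lambda>l. (xs ! l, xs ! Suc l) \<in> parcs P" and ?N = "length xs"
  define Ch where "Ch = {i. 0 < i \<and> Suc i < ?N \<and> ?s (i - 1) \<noteq> ?s i}"
  have fin: "finite Ch" by (rule finite_subset[of _ "{..<?N}"]) (auto simp: Ch_def)
  obtain i where b: "(i, ?N - 1) \<in> blocks P xs" "?N - 1 - i = 1" using last by blast
  have N2: "2 \<le> ?N" using b(2) by simp
  have i: "i = ?N - 2" using b(2) by simp
  have "{i. Suc i < ?N \<and> (i = 0 \<or> ?s (i - 1) \<noteq> ?s i)} = insert 0 Ch"
    unfolding Ch_def using N2 by fastforce
  then have "card (insert 0 Ch) = 3" using card_blocks[OF P] three by simp
  moreover have "0 \<notin> Ch" by (simp add: Ch_def)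
  ultimately have two: "card Ch = 2" using fin by simp
  have "Ch \<noteq> {}" using two by auto
  then have N3: "3 \<le> ?N" by (auto simp: Ch_def)
  have lastCh: "?N - 2 \<in> Ch"
  proof -
    \<comment> \<open>Otherwise the last two arcs would form a directed segment that properly
      extends the last block.\<close>
    have "?s (?N - 2 - 1) \<noteq> ?s (?N - 2)"
    proof
      assume eq: "?s (?N - 2 - 1) = ?s (?N - 2)"
      have "{?N - 3..<?N - 1} = {?N - 3, ?N - 2}" using N3 by auto
      then have "directed_segment P xs (?N - 3, ?N - 1)"
        using eq N3 by (auto simp: directed_segment_iff[OF P] numeral_eq_Suc)
      from blocksD(2)[OF b(1) this] have "?N - 3 = ?N - 2" using N3 by (simp add: i)
      with N3 show False by simp
    qed
    with N3 show ?thesis by (auto simp: Ch_def)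
  qed
  obtain k where k: "Ch = {k, ?N - 2}" "k \<noteq> ?N - 2"
    using two lastCh by (metis card_2_iff doubleton_eq_iff insertE singletonD)
  have kN: "0 < k" "k < ?N - 2"
  proof -
    have "k \<in> Ch" using k by simp
    with k(2) show "0 < k" "k < ?N - 2" by (auto simp: Ch_def)
  qed
  have same: "?s l = ?s (l - 1)" if "0 < l" "Suc l < ?N" "l \<noteq> k" "l \<noteq> ?N - 2" for l
  proof -
    have "l \<notin> Ch" using that(3,4) unfolding k(1) by simp
    then show ?thesis using that(1,2) unfolding Ch_def by blast
  qed
  have first: "?s l = ?s 0" if "l < k" for l
    using that
  proof (induction l)
    case (Suc l)
    then show ?case using same[of "Suc l"] kN by simp
  qed simp
  have diff: "?s k \<noteq> ?s 0"
  proof -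
    have "k \<in> Ch" unfolding k(1) by simp
    then have "?s (k - 1) \<noteq> ?s k" unfolding Ch_def by blast
    with first[of "k - 1"] kN show ?thesis by simp
  qed
  have second: "?s l = ?s k" if "k \<le> l" "l < ?N - 2" for l
    using that
  proof (induction l rule: dec_induct)
    case (step l)
    then show ?case using same[of "Suc l"] kN by simp
  qed simp
  have third: "?s (?N - 2) = ?s 0"
  proof -
    have "?s (?N - 2 - 1) \<noteq> ?s (?N - 2)" using lastCh by (simp add: Ch_def)
    moreover have "?s (?N - 2 - 1) = ?s k" using second[of "?N - 2 - 1"] kN by simp
    ultimately show ?thesis using diff by blast
  qed
  show ?thesis
  proof (intro exI[of _ k] conjI allI impI)
    fix l
    assume l: "Suc l < ?N"
    consider "l < k" | "k \<le> l" "l < ?N - 2" | "l = ?N - 2" using l by linarith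
    then show "((xs ! l, xs ! Suc l) \<in> parcs P \<longleftrightarrow> (xs ! 0, xs ! 1) \<in> parcs P) = (l < k \<or> l = ?N - 2)"
    proof cases
      case 1
      then show ?thesis using first[OF 1] by simp
    next
      case 2
      then show ?thesis using second[OF 2] diff by auto
    next
      case 3
      then show ?thesis using third by simp
    qed
  qed (use kN in auto)
qed

lemma shape_of_three_blocks:
  assumes xs: "distinct xs" "1 \<le> k" "k + 3 \<le> length xs"
    and arcs: "\<And>u v. (u, v) \<in> A \<longleftrightarrow> (\<exists>l. Suc l < length xs \<and>
      (if l < k \<or> l = length xs - 2 then u = xs ! l \<and> v = xs ! Suc l else u = xs ! Suc l \<and> v = xs ! l))"
  shows "\<exists>a b z. shape a b z (set xs) A \<and> length a = Suc k \<and> length b = length xs - 1 - k"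
proof -
  let ?N = "length xs"
  \<comment> \<open>The second block is read backwards, from position \<open>N - 2\<close> down to
    \<open>k\<close>, so that \<open>b\<close> is directed from \<open>t\<close> to
    \<open>s\<close>.\<close>
  define a b z where "a = map (nth xs) [0..<Suc k]" and "b = rev (map (nth xs) [k..<?N - 1])"
    and "z = xs ! (?N - 1)"
  have ne: "a \<noteq> []" "b \<noteq> []" using xs by (auto simp: a_def b_def)
  have "last a = xs ! k" by (simp add: a_def)
  moreover have "last b = xs ! k" using xs(3) by (simp add: b_def last_rev hd_map)
  moreover have hdb: "hd b = xs ! (?N - 2)" using xs(3) by (simp add: b_def hd_rev last_map numeral_eq_Suc)
  moreover have "distinct (a @ butlast b @ [z])"
  proof -
    have bb: "butlast b = rev (map (nth xs) [Suc k..<?N - 1])"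
      unfolding b_def using xs(3) by (subst upt_conv_Cons) auto
    have "inj_on (nth xs) {..<?N}" using xs(1) by (auto simp: inj_on_def nth_eq_iff_index_eq)
    moreover have "distinct ([0..<Suc k] @ rev [Suc k..<?N - 1] @ [?N - 1])"
      "set ([0..<Suc k] @ rev [Suc k..<?N - 1] @ [?N - 1]) \<subseteq> {..<?N}"
      using xs(3) by auto
    ultimately have "distinct (map (nth xs) ([0..<Suc k] @ rev [Suc k..<?N - 1] @ [?N - 1]))"
      unfolding distinct_map by (meson inj_on_subset)
    then show ?thesis unfolding bb a_def z_def by (simp only: map_append rev_map list.map)
  qed
  moreover have "set xs = set a \<union> set b \<union> {z}"
  proof -
    have "set xs = nth xs ` {..<?N}" by (auto simp: set_conv_nth)
    also have "{..<?N} = {0..<Suc k} \<union> {k..<?N - 1} \<union> {?N - 1}" using xs(3) by auto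
    finally show ?thesis by (simp only: a_def b_def z_def set_map set_rev set_upt image_Un image_insert image_empty)
  qed
  moreover have "A = walk_arcs a \<union> walk_arcs b \<union> {(hd b, z)}"
  proof -
    have arcs_a: "walk_arcs a = {(xs ! l, xs ! Suc l) | l. l < k}"
      unfolding a_def set_vwalk_arcs_nth
      by (intro Collect_cong ex_cong1) (auto simp: nth_map_upt simp del: upt_Suc)
    have "(u, v) \<in> walk_arcs b \<longleftrightarrow> (\<exists>l. k \<le> l \<and> l < ?N - 2 \<and> u = xs ! Suc l \<and> v = xs ! l)" for u v
    proof -
      have "(u, v) \<in> walk_arcs b \<longleftrightarrow>
          (\<exists>l. Suc l < ?N - 1 - k \<and> v = xs ! (k + l) \<and> u = xs ! Suc (k + l))"
        unfolding b_def set_vwalk_arcs_rev converse_iff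
        unfolding set_vwalk_arcs_nth mem_Collect_eq
        by (intro ex_cong1) (auto simp: nth_map_upt)
      also have "\<dots> \<longleftrightarrow> (\<exists>l. k \<le> l \<and> l < ?N - 2 \<and> u = xs ! Suc l \<and> v = xs ! l)"
      proof
        assume "\<exists>l. Suc l < ?N - 1 - k \<and> v = xs ! (k + l) \<and> u = xs ! Suc (k + l)"
        then obtain l where "Suc l < ?N - 1 - k" "v = xs ! (k + l)" "u = xs ! Suc (k + l)" by blast
        then show "\<exists>l. k \<le> l \<and> l < ?N - 2 \<and> u = xs ! Suc l \<and> v = xs ! l"
          by (intro exI[of _ "k + l"]) auto
      next
        assume "\<exists>l. k \<le> l \<and> l < ?N - 2 \<and> u = xs ! Suc l \<and> v = xs ! l"
        then obtain l where "k \<le> l" "l < ?N - 2" "u = xs ! Suc l" "v = xs ! l" by blast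
        then show "\<exists>l. Suc l < ?N - 1 - k \<and> v = xs ! (k + l) \<and> u = xs ! Suc (k + l)"
          by (intro exI[of _ "l - k"]) auto
      qed
      finally show ?thesis .
    qed
    then have arcs_b: "walk_arcs b = {(xs ! Suc l, xs ! l) | l. k \<le> l \<and> l < ?N - 2}" by auto
    have arc_z: "(hd b, z) = (xs ! (?N - 2), xs ! Suc (?N - 2))"
    proof -
      have "Suc (?N - 2) = ?N - 1" using xs(3) by simp
      then show ?thesis unfolding hdb z_def by simp
    qed
    show ?thesis
    proof (intro equalityI subsetI)
      fix e
      assume e: "e \<in> A"
      obtain u v where uv: "e = (u, v)" by (cases e)
      obtain l where l: "Suc l < ?N" and ends: "if l < k \<or> l = ?N - 2 then u = xs ! l \<and> v = xs ! Suc l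
          else u = xs ! Suc l \<and> v = xs ! l" using e unfolding uv arcs by blast
      consider "l < k" | "l = ?N - 2" | "k \<le> l" "l < ?N - 2" using l by linarith
      then show "e \<in> walk_arcs a \<union> walk_arcs b \<union> {(hd b, z)}"
      proof cases
        case 1
        then have "e \<in> walk_arcs a" unfolding arcs_a uv using ends by auto
        then show ?thesis by blast
      next
        case 2
        then have "e = (hd b, z)" unfolding arc_z uv using ends by auto
        then show ?thesis by blast
      next
        case 3
        then have "e \<in> walk_arcs b" unfolding arcs_b uv using ends by auto
        then show ?thesis by blast
      qed
    next
      fix e
      assume "e \<in> walk_arcs a \<union> walk_arcs b \<union> {(hd b, z)}"
      then consider l where "e = (xs ! l, xs ! Suc l)" "l < k"
        | l where "e = (xs ! Suc l, xs ! l)" "k \<le> l" "l < ?N - 2" | "e = (xs ! (?N - 2), xs ! Suc (?N - 2))"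
        unfolding arcs_a arcs_b arc_z by blast
      then show "e \<in> A"
      proof cases
        case (1 l)
        then show ?thesis unfolding 1(1) arcs using xs(3) by (intro exI[of _ l]) simp
      next
        case (2 l)
        then show ?thesis unfolding 2(1) arcs using xs(3) by (intro exI[of _ l]) simp
      next
        case 3
        then show ?thesis unfolding 3 arcs using xs(3) by (intro exI[of _ "?N - 2"]) simp
      qed
    qed
  qed
  ultimately have "shape a b z (set xs) A" using ne unfolding shape_def by simp
  moreover have "length a = Suc k" "length b = ?N - 1 - k" by (simp_all add: a_def b_def)
  ultimately show ?thesis by blast
qed

section \<open>The decision procedure\<close>

theorem corollary22:
  fixes P :: "nat pair_pre_digraph" and xs :: "nat list"
  assumes "oriented_path P xs"
    and "card (blocks P xs) = 3"
    and "\<exists>i j. (i, j) \<in> blocks P xs \<and> j = length xs - 1 \<and> j - i = 1"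
  shows "\<exists>c C. decides_in_time c oriented_graph (contains_induced_subdivision P)
           (\<lambda>n m. C * max 1 (n ^ (card (pverts P) - 2) * m ^ 2))"
proof -
  define N where "N = length xs"
  obtain k where k: "1 \<le> k" "k + 3 \<le> N" and signs: "\<And>l. Suc l < N \<Longrightarrow>
      ((xs ! l, xs ! Suc l) \<in> parcs P \<longleftrightarrow> (xs ! 0, xs ! 1) \<in> parcs P) = (l < k \<or> l = N - 2)"
    using three_blocks_last_one[OF assms] unfolding N_def by blast
  have dist: "distinct xs" and verts: "pverts P = set xs"
    using assms(1) by (auto simp: oriented_path_def)
  have cardP: "card (pverts P) = N" unfolding verts N_def using dist by (rule distinct_card)
  \<comment> \<open>If the first arc of \<open>P\<close> points against the traversal, all arcs of
    \<open>P\<close> and of the input are reversed; the program does the latter by swapping tail and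
    head whenever it reads an arc.\<close>
  define r where "r \<longleftrightarrow> (xs ! 0, xs ! 1) \<notin> parcs P"
  define orient where "orient G = (if r then reversed G else G)" for G :: "nat pair_pre_digraph"
  have "(u, v) \<in> parcs (orient P) \<longleftrightarrow> (\<exists>l. Suc l < length xs \<and>
      (if l < k \<or> l = length xs - 2 then u = xs ! l \<and> v = xs ! Suc l else u = xs ! Suc l \<and> v = xs ! l))"
    (is "_ \<longleftrightarrow> (\<exists>l. _ l \<and> ?ends l)") for u v
  proof -
    have "(u, v) \<in> parcs (orient P) \<longleftrightarrow> (if r then (v, u) else (u, v)) \<in> parcs P"
      by (simp add: orient_def)
    also have "\<dots> \<longleftrightarrow> (\<exists>l. Suc l < length xs \<and> ?ends l)"
    proof (cases r)
      case True
      show ?thesis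
        unfolding if_P[OF True] oriented_path_arcs[OF assms(1), of v u]
        by (intro ex_cong1 conj_cong refl) (use signs True in \<open>auto simp: N_def r_def split: if_splits\<close>)
    next
      case False
      show ?thesis
        unfolding if_not_P[OF False] oriented_path_arcs[OF assms(1), of u v]
        by (intro ex_cong1 conj_cong refl) (use signs False in \<open>auto simp: N_def r_def split: if_splits\<close>)
    qed
    finally show ?thesis .
  qed
  from shape_of_three_blocks[OF dist k(1) k(2)[unfolded N_def] this]
  obtain aP bP zP where shP: "shape aP bP zP (set xs) (parcs (orient P))"
    and lenP: "length aP = Suc k" "length bP = N - 1 - k" unfolding N_def by blast
  have shP': "shape aP bP zP (pverts (orient P)) (parcs (orient P))"
    using shP by (cases r) (simp_all add: orient_def verts)
  let ?found = "\<lambda>n E. \<exists>f. (\<forall>i<N. f i < n) \<and> partial_copy E N (pattern k N) f \<and> linked E N f"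
  have correct: "contains_induced_subdivision P G \<longleftrightarrow> ?found n (parcs (orient G))"
    if G: "oriented_graph G" "pverts G = {..<n}" for G n
  proof -
    have wf: "pair_wf_digraph G" and anti: "\<And>u v. (u, v) \<in> parcs G \<Longrightarrow> (v, u) \<notin> parcs G"
      using G(1) by (auto simp: oriented_graph_def pair_digraph_def pair_fin_digraph_def)
    let ?E = "parcs (orient G)"
    have wf': "pair_wf_digraph (orient G)" using wf by (auto simp: orient_def pair_wf_digraph_def)
    have E: "?E \<subseteq> {..<n} \<times> {..<n}" "\<And>u v. (u, v) \<in> ?E \<Longrightarrow> (v, u) \<notin> ?E"
      using pair_wf_digraph.in_arcsD1[OF wf] pair_wf_digraph.in_arcsD2[OF wf] anti G(2)
      by (auto simp: orient_def split: if_splits)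
    have "contains_induced_subdivision P G \<longleftrightarrow> contains_induced_subdivision (orient P) (orient G)"
      using contains_reversed[OF wf] by (simp add: orient_def)
    also have "\<dots> \<longleftrightarrow> (\<exists>a b z U. U \<subseteq> {..<n} \<and> shape a b z U (?E \<inter> U \<times> U) \<and>
       length a = Suc k \<and> N - 1 - k \<le> length b)"
    proof -
      have "pverts (orient G) = {..<n}" using G(2) by (simp add: orient_def)
      moreover have "2 \<le> length bP" using lenP k by simp
      ultimately show ?thesis using contains_iff_shape[OF wf' shP'] unfolding lenP by simp
    qed
    also have "\<dots> \<longleftrightarrow> ?found n ?E"
    proof
      assume "\<exists>a b z U. U \<subseteq> {..<n} \<and> shape a b z U (?E \<inter> U \<times> U) \<and>
        length a = Suc k \<and> N - 1 - k \<le> length b"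
      then obtain a b z U where "U \<subseteq> {..<n}" "shape a b z U (?E \<inter> U \<times> U)"
        "length a = Suc k" "N - 1 - k \<le> length b" by (elim exE conjE) (rule that)
      from linked_if_shape[OF k this] show "?found n ?E" by simp
    next
      assume "?found n ?E"
      then obtain f where "\<forall>i<N. f i \<in> {..<n}" "partial_copy ?E N (pattern k N) f" "linked ?E N f" by auto
      from shape_if_linked[OF E k this]
      show "\<exists>a b z U. U \<subseteq> {..<n} \<and> shape a b z U (?E \<inter> U \<times> U) \<and>
        length a = Suc k \<and> N - 1 - k \<le> length b" .
    qed
    finally show ?thesis .
  qed
  have N4: "4 \<le> N" using k by simp
  have pat: "pattern k N 0 1" "pattern k N (N - 2) (N - 1)" using k by (auto simp: pattern_def)
  let ?main = "main_stmt r N (pattern k N)"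
  obtain C0 where C0: "\<And>n m. 1 \<le> n \<Longrightarrow> 1 \<le> m \<Longrightarrow> stmt_time n m ?main \<le> C0 * (n ^ (N - 2) * m ^ 2)"
    using time_main_stmt[OF N4] unfolding time_bounded_def by blast
  \<comment> \<open>The 4 counts the steps outside the compiled statement: a constant, a test, an
    addition and a load.\<close>
  have bound: "x \<le> (C0 + 4) * max 1 X" if "x \<le> C0 * max 1 X + 4" for x X :: nat
  proof -
    have "4 * 1 \<le> 4 * max 1 X" by (intro mult_le_mono2) simp
    with that show ?thesis unfolding add_mult_distrib by linarith
  qed
  \<comment> \<open>Without arcs the product \<open>n ^ (N - 2) * m ^ 2\<close> is 0 and the answer
    is negative, since \<open>P\<close> has an arc; this is settled in constant time and accounts
    for \<open>max 1\<close>. Otherwise the flag in cell \<open>2 * m\<close> is copied to register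
    0 at the end.\<close>
  define c where "c = Seq (Const 2 1) (IfLess 1 2 (Const 0 0)
    (Seq (stmt_prog 2 ?main) (Seq (Add 2 1 1) (Load 0 2))))"
  have "decides_in_time c oriented_graph (contains_induced_subdivision P)
           (\<lambda>n m. (C0 + 4) * max 1 (n ^ (N - 2) * m ^ 2))"
    unfolding decides_in_time_def Let_def
  proof (intro allI impI, elim conjE)
    fix n :: nat and as :: "(nat \<times> nat) list"
    assume G: "oriented_graph \<lparr>pverts = {..<n}, parcs = set as\<rparr>"
    let ?G = "\<lparr>pverts = {..<n}, parcs = set as\<rparr>" and ?s0 = "input_state n as"
    let ?s1 = "?s0\<lparr>reg := (reg ?s0)(2 := 1)\<rparr>"
    have wf: "pair_wf_digraph ?G"
      using G by (auto simp: oriented_graph_def pair_digraph_def pair_fin_digraph_def)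
    have range: "set as \<subseteq> {..<n} \<times> {..<n}"
      using pair_wf_digraph.in_arcsD1[OF wf] pair_wf_digraph.in_arcsD2[OF wf] by auto
    interpret input r n as by unfold_locales (rule range)
    have EG: "E = parcs (orient ?G)"
    proof -
      have nths: "set as = (!) as ` {..<length as}" by (auto simp: set_conv_nth)
      show ?thesis
      proof (cases r)
        case True
        have "arc = (\<lambda>k. prod.swap (as ! k))" unfolding arc_def using True by (intro ext) simp
        then have "E = prod.swap ` set as" unfolding E_def nths image_image by (rule arg_cong)
        then show ?thesis using True by (force simp: orient_def)
      next
        case False
        have "arc = (!) as" unfolding arc_def using False by (intro ext) simp
        then have "E = set as" unfolding E_def nths by (rule arg_cong)
        then show ?thesis using False by (simp add: orient_def)
      qed
    qed
    have Q: "contains_induced_subdivision P ?G \<longleftrightarrow> ?found n E"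
      unfolding EG by (rule correct[OF G]) simp
    have first: "exec (Const 2 1) ?s0 1 ?s1" by (rule exec.Const)
    show "\<exists>t s. exec c ?s0 t s \<and> t \<le> (C0 + 4) * max 1 (n ^ (N - 2) * length as ^ 2) \<and>
      reg s 0 = (if contains_induced_subdivision P ?G then 1 else 0)"
    proof (cases "as = []")
      case True
      have "\<not> ?found n E"
      proof
        assume "?found n E"
        then obtain f where "partial_copy E N (pattern k N) f" by blast
        then have "(f 0, f 1) \<in> E" using pat(1) N4 unfolding partial_copy_def by auto
        moreover have "E = {}" unfolding EG orient_def using True by (cases r) simp_all
        ultimately show False by simp
      qed
      moreover have "reg ?s1 1 < reg ?s1 2" using True by (simp add: input_state_def)
      from exec.Seq[OF first exec.IfTrue[OF this exec.Const[of 0 0]]]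
      have "exec c ?s0 (1 + Suc 1) (?s1\<lparr>reg := (reg ?s1)(0 := 0)\<rparr>)" unfolding c_def .
      moreover have "1 + Suc 1 \<le> (C0 + 4) * max 1 (n ^ (N - 2) * length as ^ 2)"
        by (rule bound) simp
      ultimately show ?thesis using Q by (intro exI conjI) (assumption, simp_all)
    next
      case False
      then have m: "1 \<le> length as" by (cases as) auto
      then have n: "1 \<le> n" using range False by (cases as) auto
      have nle: "\<not> reg ?s1 1 < reg ?s1 2" using False by (simp add: input_state_def)
      have "holds_vars [n, length as] ?s1"
        by (auto simp: holds_vars_def input_state_def less_Suc_eq numeral_2_eq_2)
      from exec_stmt_prog[OF this, of ?main] wf_main_stmt[OF N4]
      obtain t s where s: "exec (stmt_prog 2 ?main) ?s1 t s" "t \<le> stmt_time n (length as) ?main"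
        "mem s = sem ?main [n, length as] (mem ?s1)" "holds_vars [n, length as] s"
        by (simp add: numeral_2_eq_2) blast
      have "loaded (mem ?s1)" by (auto simp: loaded_def input_state_def)
      moreover have "mem ?s1 a = 0" if "2 * length as \<le> a" for a using that by (simp add: input_state_def)
      ultimately have res: "mem s (2 * length as) = of_bool (?found n E)"
        unfolding s(3) by (rule sem_main_stmt[OF N4 pat])
      let ?s2 = "s\<lparr>reg := (reg s)(2 := reg s 1 + reg s 1)\<rparr>"
      let ?s3 = "?s2\<lparr>reg := (reg ?s2)(0 := mem ?s2 (reg ?s2 2))\<rparr>"
      have "exec c ?s0 (1 + Suc (t + (1 + 1))) ?s3"
        unfolding c_def
        by (rule exec.Seq[OF first exec.IfFalse[OF nle exec.Seq[OF s(1) exec.Seq[OF exec.Add exec.Load]]]])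
      moreover have "1 + Suc (t + (1 + 1)) \<le> (C0 + 4) * max 1 (n ^ (N - 2) * length as ^ 2)"
      proof (rule bound)
        have "t \<le> C0 * (n ^ (N - 2) * length as ^ 2)" using s(2) C0[OF n m] by simp
        also have "\<dots> \<le> C0 * max 1 (n ^ (N - 2) * length as ^ 2)" by (intro mult_le_mono2) simp
        finally show "1 + Suc (t + (1 + 1)) \<le> C0 * max 1 (n ^ (N - 2) * length as ^ 2) + 4" by simp
      qed
      moreover have "reg s 1 = length as" using s(4) by (simp add: holds_vars_def)
      then have "reg ?s3 0 = (if contains_induced_subdivision P ?G then 1 else 0)"
        using res Q by (simp add: mult_2)
      ultimately show ?thesis by (intro exI conjI)
    qed
  qed
  then show ?thesis unfolding cardP by blast
qed

end
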